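(* There exist constants $C,c>0$ such that, for every $\delta>0$ sufficiently small, there exists $L_0(\delta)>0$ for which the following holds whenever $L\ge L_0(\delta)$. Let $\nu=\nu_{L,\delta}$ denote the (unique) stationary probability measure of the projective process. Then, for every bounded measurable observable $H_p:\mathbb{PT}^2\to\mathbb R$, every initial state $(x_0,y_0,v_0)\in\mathbb{PT}^2$, every $n\ge1$, and every $\varepsilon>0$, $$\mathbb P_{(x_0,y_0,v_0)}\left(\left|\frac1n\sum_{j=1}^nH_p(x_j,y_j,v_j)-\int H_p\,d\nu\right|\ge\varepsilon\right)\le C\exp\left(-cn\frac{\varepsilon^2}{\|H_p\|_\infty^2}\right).$$ Similarly, for every bounded measurable observable $H_2:(\mathbb T^2\times\mathbb T^2)\setminus\Delta\to\mathbb R$, every initial pair $(z_0,\bar z_0)\notin\Delta$, every $n\ge1$, and every $\varepsilon>0$, $$\mathbb P_{(z_0,\bar z_0)}\left(\left|\frac1n\sum_{j=1}^nH_2(z_j,\bar z_j)-\int H_2\,d(m\otimes m)\right|\ge\varepsilon\right)\le C\bigl(1+V_L(z_0,\bar z_0)\bigr)\exp\left(-cn\frac{\varepsilon^2}{\|H_2\|_\infty^2}\right).$$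
   Context: For $L>0$ and $\delta>0$ put $\sigma:=L^{-\delta}$ and $f(x):=L\cos(2\pi x)$. Let $\Omega:=[-\sigma,\sigma]^{\mathbb N_0}$ with the product probability measure $\mathbb P$ whose coordinate marginals are uniform on $[-\sigma,\sigma]$; $\mathbb E$ is the corresponding expectation. For $\omega=(\omega_n)_{n\ge0}\in\Omega$ let $f_\omega(x,y)=f_{\omega_0}(x,y)=\bigl(f(x+\omega_0)-y,\;x+\omega_0\bigr)\pmod 1$ on $\mathbb T^2$. $m$ is normalized Lebesgue measure on $\mathbb T^2$, $d$ the standard distance, $\Delta$ the diagonal of $\mathbb T^2\times\mathbb T^2$. Projective process: on $\mathbb{PT}^2\simeq\mathbb T^2\times\mathbb P^1$ (directions represented by unit vectors up to sign), $(x_{n+1},y_{n+1},v_{n+1})=\left(f_{\omega_n}(x_n,y_n),\frac{Df_{\omega_n}(x_n,y_n)v_n}{|Df_{\omega_n}(x_n,y_n)v_n|}\right)$. For $\delta$ small and $L$ large (depending on $\delta$) it has a unique stationary probability measure. Two-point motion: $(z_{n+1},\bar z_{n+1})=(f_{\omega_n}(z_n),f_{\omega_n}(\bar z_n))$ on $(\mathbb T^2\times\mathbb T^2)\setminus\Delta$, with Koopman operator $\mathcal P_2\phi(z,\bar z)=\mathbb E[\phi(f_\omega(z),f_\omega(\bar z))]$. $\mathbb P_u$ denotes probability when the corresponding process is started at $u$; $\|\cdot\|_\infty$ is the supremum norm. The weight is $V_L(z,\bar z):=d(z,\bar z)^{-\varepsilon_0/\log L}\mathbf 1_{\{d(z,\bar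 z)\le L^{-t}\}}+\mathbf 1_{\{d(z,\bar z)>L^{-t}\}}$, where $\varepsilon_0>0$ and $t\in\mathbb N$ are fixed constants, independent of $L,\delta$, for which exponential mixing of the two-point motion holds in the following sense: there exist $C'>0$, $\gamma\in(0,1)$, $L_0'>0$ such that for all sufficiently small $\delta>0$, all $L>L_0'$, all $n\ge1$ and all measurable $\phi$ with $\|\phi\|_{V_L}:=\sup_{(z,\bar z)\notin\Delta}|\phi(z,\bar z)|/(1+V_L(z,\bar z))<\infty$ one has $\|\mathcal P_2^n\phi-\int\phi\,d(m\otimes m)\|_{V_L}\le C'\gamma^n\|\phi\|_{V_L}$. *)

theory Defs
  imports "HOL-Probability.Probability"
begin

section \<open>The torus\<close>

text \<open>The torus is represented by its fundamental domain \<open>[0,1)\<times>[0,1)\<close>; reduction modulo 1 is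
  the componentwise fractional part.\<close>

type_synonym point = "real \<times> real"

definition torus :: "point set" where
  "torus = {0..<1} \<times> {0..<1}"

definition mod1 :: "point \<Rightarrow> point" where
  "mod1 z = (frac (fst z), frac (snd z))"

definition torus_measure :: "point measure" where
  "torus_measure = restrict_space lborel torus"

definition torus_dist :: "point \<Rightarrow> point \<Rightarrow> real" where
  "torus_dist z z' = Inf {norm (z - z' + (of_int i, of_int j)) | i j :: int. True}"

section \<open>The random maps\<close>

definition noise_size :: "real \<Rightarrow> real \<Rightarrow> real" where
  "noise_size L \<delta> = L powr (- \<delta>)"

text \<open>The product measure lives on all real sequences; it is concentrated on those with values in
  \<open>[-\<sigma>,\<sigma>]\<close>.\<close>

definition noise :: "real \<Rightarrow> real \<Rightarrow> (nat \<Rightarrow> real) measure" where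
  "noise L \<delta> =
     PiM UNIV (\<lambda>_. uniform_measure lborel {- noise_size L \<delta> .. noise_size L \<delta>})"

definition lift_map :: "real \<Rightarrow> real \<Rightarrow> point \<Rightarrow> point" where
  "lift_map L w z = (L * cos (2 * pi * (fst z + w)) - snd z, fst z + w)"

definition torus_map :: "real \<Rightarrow> real \<Rightarrow> point \<Rightarrow> point" where
  "torus_map L w z = mod1 (lift_map L w z)"

text \<open>The derivative of the torus map, in the standard trivialisation of the tangent bundle, is
  that of its lift to the plane.\<close>

definition D_torus_map :: "real \<Rightarrow> real \<Rightarrow> point \<Rightarrow> point \<Rightarrow> point" where
  "D_torus_map L w z = frechet_derivative (lift_map L w) (at z)"

section \<open>The projective process\<close>

text \<open>A direction is the pair \<open>{v, -v}\<close> of antipodal unit vectors. The sigma-algebra on the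
  projective line is the quotient of the Borel sigma-algebra of the circle.\<close>

type_synonym direction = "point set"

definition dir :: "point \<Rightarrow> direction" where
  "dir v = {v, - v}"

definition proj_line :: "direction measure" where
  "proj_line = sigma (dir ` sphere 0 1)
     {A. A \<subseteq> dir ` sphere 0 1 \<and> {v \<in> sphere 0 1. dir v \<in> A} \<in> sets borel}"

definition proj_bundle :: "(point \<times> direction) measure" where
  "proj_bundle = restrict_space borel torus \<Otimes>\<^sub>M proj_line"

definition proj_step :: "real \<Rightarrow> real \<Rightarrow> point \<times> direction \<Rightarrow> point \<times> direction" where
  "proj_step L w u =
     (torus_map L w (fst u),
      (\<lambda>v. D_torus_map L w (fst u) v /\<^sub>R norm (D_torus_map L w (fst u) v)) ` snd u)"

primrec proj_process ::
  "real \<Rightarrow> point \<times> direction \<Rightarrow> nat \<Rightarrow> (nat \<Rightarrow> real) \<Rightarrow> point \<times> direction" where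
  "proj_process L u 0 \<omega> = u"
| "proj_process L u (Suc n) \<omega> = proj_step L (\<omega> n) (proj_process L u n \<omega>)"

definition proj_stationary :: "real \<Rightarrow> real \<Rightarrow> (point \<times> direction) measure \<Rightarrow> bool" where
  "proj_stationary L \<delta> \<nu> \<longleftrightarrow>
     prob_space \<nu> \<and> sets \<nu> = sets proj_bundle \<and>
     (\<forall>A \<in> sets proj_bundle.
        emeasure \<nu> A =
          (\<integral>\<^sup>+u. emeasure (noise L \<delta>) {\<omega> \<in> space (noise L \<delta>). proj_step L (\<omega> 0) u \<in> A} \<partial>\<nu>))"

section \<open>The two-point motion\<close>

text \<open>The product of Lebesgue measures on pairs of distinct points (the diagonal is a null set).\<close>

definition pair_measure_offdiag :: "(point \<times> point) measure" where
  "pair_measure_offdiag =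
     restrict_space (torus_measure \<Otimes>\<^sub>M torus_measure) (torus \<times> torus - Id)"

definition pair_step :: "real \<Rightarrow> real \<Rightarrow> point \<times> point \<Rightarrow> point \<times> point" where
  "pair_step L w p = (torus_map L w (fst p), torus_map L w (snd p))"

primrec pair_process ::
  "real \<Rightarrow> point \<times> point \<Rightarrow> nat \<Rightarrow> (nat \<Rightarrow> real) \<Rightarrow> point \<times> point" where
  "pair_process L p 0 \<omega> = p"
| "pair_process L p (Suc n) \<omega> = pair_step L (\<omega> n) (pair_process L p n \<omega>)"

definition koopman2 ::
  "real \<Rightarrow> real \<Rightarrow> (point \<times> point \<Rightarrow> real) \<Rightarrow> point \<times> point \<Rightarrow> real" where
  "koopman2 L \<delta> \<phi> p = (\<integral>\<omega>. \<phi> (pair_step L (\<omega> 0) p) \<partial>noise L \<delta>)"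

definition weight :: "real \<Rightarrow> nat \<Rightarrow> real \<Rightarrow> point \<times> point \<Rightarrow> real" where
  "weight \<epsilon>\<^sub>0 t L p =
     (if torus_dist (fst p) (snd p) \<le> L powr (- real t)
      then torus_dist (fst p) (snd p) powr (- \<epsilon>\<^sub>0 / ln L) else 1)"

text \<open>Extended-valued, so that finiteness of the norm is a genuine condition.\<close>

definition weight_norm :: "real \<Rightarrow> nat \<Rightarrow> real \<Rightarrow> (point \<times> point \<Rightarrow> real) \<Rightarrow> ennreal" where
  "weight_norm \<epsilon>\<^sub>0 t L \<phi> =
     (SUP p \<in> space pair_measure_offdiag. ennreal (\<bar>\<phi> p\<bar> / (1 + weight \<epsilon>\<^sub>0 t L p)))"

definition two_point_mixing :: "real \<Rightarrow> nat \<Rightarrow> bool" where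
  "two_point_mixing \<epsilon>\<^sub>0 t \<longleftrightarrow>
     (\<exists>C' \<gamma> L\<^sub>0'. C' > 0 \<and> 0 < \<gamma> \<and> \<gamma> < 1 \<and> L\<^sub>0' > 0 \<and>
       (\<exists>\<delta>\<^sub>0 > 0. \<forall>\<delta>. 0 < \<delta> \<and> \<delta> < \<delta>\<^sub>0 \<longrightarrow>
         (\<forall>L > L\<^sub>0'. \<forall>n \<ge> 1. \<forall>\<phi> \<in> borel_measurable pair_measure_offdiag.
            weight_norm \<epsilon>\<^sub>0 t L \<phi> < \<infinity> \<longrightarrow>
            weight_norm \<epsilon>\<^sub>0 t L
              (\<lambda>p. (koopman2 L \<delta> ^^ n) \<phi> p - (\<integral>q. \<phi> q \<partial>pair_measure_offdiag))
            \<le> ennreal (C' * \<gamma> ^ n) * weight_norm \<epsilon>\<^sub>0 t L \<phi>)))"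

definition sup_norm :: "'a measure \<Rightarrow> ('a \<Rightarrow> real) \<Rightarrow> real" where
  "sup_norm M H = (SUP u \<in> space M. \<bar>H u\<bar>)"

end

theory Submission
  imports Defs
begin

text \<open>
  Both estimates come from a bound \<open>E exp(\<lambda> S\<^sub>n) \<le> C W exp(C \<lambda>\<^sup>2 n)\<close> for the sums of a centred
  bounded observable along a Markov chain that mixes in a weighted supremum norm, followed by
  Chernoff's inequality. The moment generating function is computed by iterating the tilted Markov
  operator. Splitting a function into its mean \<open>a\<close> and a rest \<open>b\<close> of mean zero, a block of steps long
  enough for mixing multiplies \<open>a\<close> by \<open>1 + O(\<lambda>\<^sup>2)\<close>, contracts \<open>b\<close>, and couples the two through terms
  of order \<open>\<lambda>\<close> only; hence \<open>b\<close> stays of order \<open>\<lambda> a\<close> and \<open>a\<close> grows by a factor \<open>1 + O(\<lambda>\<^sup>2)\<close> per block.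

  For the two-point motion mixing is the hypothesis. For the projective process it follows from a
  Doeblin minorization of the fifth iterate with a constant independent of \<open>L\<close> and \<open>\<delta>\<close>. In the angles
  \<open>s\<^sub>n = x\<^sub>n + \<omega>\<^sub>n\<close> the chain is the recursion \<open>s\<^sub>n = f(s\<^sub>n\<^sub>-\<^sub>1) - s\<^sub>n\<^sub>-\<^sub>2 + \<omega>\<^sub>n\<close> with slopes
  \<open>\<rho>\<^sub>n = f'(s\<^sub>n) - 1/\<rho>\<^sub>n\<^sub>-\<^sub>1\<close>. The first two angles, whose images under \<open>f\<close> equidistribute on every window of
  length \<open>\<sigma>\<close>, make the position forget its start and render \<open>1/\<rho>\<^sub>1\<close> at most \<open>\<sigma>/2\<close>; the third angle is
  then shifted slightly so that \<open>\<rho>\<^sub>2\<close> no longer depends on \<open>\<rho>\<^sub>1\<close>.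
\<close>

section \<open>Random iterations and their Markov operators\<close>

text \<open>\<open>C\<close> and \<open>c\<close> are chosen before \<delta> and \<open>L\<close>,
  so every constant has to survive \<sigma> -> 0 and an unbounded weight. The weight is harmless
  because the tilted iteration starts from the constant function 1: \<open>W\<close> bounds the
  mean-zero part pointwise, but only its mean, at most \<open>K\<close>, feeds back into the growth
  rate. For the projective process one step carries noise in a single real variable, of density 1/(2
  \<sigma>), while the bundle is three-dimensional. The last three of the five angles supply a
  density on it, the first two erase the start. Five steps cost five powers of 1/\<sigma>. They are
  recovered exactly: for given third and fourth angles the admissible first two fill a volume of
  order \<sigma>^4, and the last angle runs over an arc of length \<sigma>. What makes one window of
  noise wrap around the circle with bounded distortion is L \<sigma>^2 \<ge> 100, which is why
  \<delta> has to be small.\<close>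

primrec orbit :: "('w \<Rightarrow> 'a \<Rightarrow> 'a) \<Rightarrow> 'a \<Rightarrow> nat \<Rightarrow> (nat \<Rightarrow> 'w) \<Rightarrow> 'a" where
  "orbit F u 0 \<omega> = u"
| "orbit F u (Suc n) \<omega> = F (\<omega> n) (orbit F u n \<omega>)"

text \<open>\<open>orbit\<close> appends the newest noise, while conditioning removes the oldest.
  This identity moves the first noise into the initial state.\<close>

lemma orbit_case_nat: "orbit F u (Suc n) (case_nat w \<omega>) = orbit F (F w u) n \<omega>"
  by (induction n) simp_all

lemma sum_head_Suc: "(\<Sum>j=1..Suc n. g j) = g 1 + (\<Sum>j=1..n. g (Suc j))" for g :: "nat \<Rightarrow> real"
  by (induction n) simp_all

locale random_map = prob_space \<mu> for \<mu> :: "'w measure" +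
  fixes M :: "'a measure" and F :: "'w \<Rightarrow> 'a \<Rightarrow> 'a"
  assumes measurable_step: "(\<lambda>(w, u). F w u) \<in> \<mu> \<Otimes>\<^sub>M M \<rightarrow>\<^sub>M M"
begin

sublocale noise: sequence_space \<mu>
  by unfold_locales

abbreviation \<Omega> :: "(nat \<Rightarrow> 'w) measure" where
  "\<Omega> \<equiv> PiM UNIV (\<lambda>_. \<mu>)"

definition koop :: "('a \<Rightarrow> real) \<Rightarrow> 'a \<Rightarrow> real" where
  "koop \<phi> u = (\<integral>w. \<phi> (F w u) \<partial>\<mu>)"

definition bdd :: "real \<Rightarrow> ('a \<Rightarrow> real) \<Rightarrow> bool" where
  "bdd B \<phi> \<longleftrightarrow> \<phi> \<in> borel_measurable M \<and> (\<forall>u\<in>space M. \<bar>\<phi> u\<bar> \<le> B)"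

lemma bdd_measurable: "bdd B \<phi> \<Longrightarrow> \<phi> \<in> borel_measurable M"
  by (simp add: bdd_def)

lemma bddD: "bdd B \<phi> \<Longrightarrow> u \<in> space M \<Longrightarrow> \<bar>\<phi> u\<bar> \<le> B"
  by (simp add: bdd_def)

lemma step_compose_measurable [measurable (raw)]:
  "f \<in> N \<rightarrow>\<^sub>M \<mu> \<Longrightarrow> g \<in> N \<rightarrow>\<^sub>M M \<Longrightarrow> (\<lambda>x. F (f x) (g x)) \<in> N \<rightarrow>\<^sub>M M"
  using measurable_compose[OF measurable_Pair measurable_step, of f N g] by simp

lemma step_space: "w \<in> space \<mu> \<Longrightarrow> u \<in> space M \<Longrightarrow> F w u \<in> space M"
  using measurable_space[OF measurable_step, of "(w, u)"] by (simp add: space_pair_measure)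

lemma orbit_measurable [measurable (raw)]:
  assumes "g \<in> N \<rightarrow>\<^sub>M M" "f \<in> N \<rightarrow>\<^sub>M \<Omega>"
  shows "(\<lambda>x. orbit F (g x) n (f x)) \<in> N \<rightarrow>\<^sub>M M"
proof (induction n)
  case (Suc n)
  have "(\<lambda>x. f x n) \<in> N \<rightarrow>\<^sub>M \<mu>"
    using assms(2) by (rule measurable_compose[OF _ measurable_component_singleton]) simp
  with Suc show ?case by simp
qed (use assms in simp)

lemma orbit_space: "u \<in> space M \<Longrightarrow> \<omega> \<in> space \<Omega> \<Longrightarrow> orbit F u n \<omega> \<in> space M"
  by (induction n) (auto intro!: step_space simp: space_PiM)

lemma measurable_step_at: "u \<in> space M \<Longrightarrow> (\<lambda>w. F w u) \<in> \<mu> \<rightarrow>\<^sub>M M"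
  by measurable

lemma integrable_step:
  assumes "bdd B \<phi>" "u \<in> space M"
  shows "integrable \<mu> (\<lambda>w. \<phi> (F w u))"
  using measurable_compose[OF measurable_step_at[OF assms(2)] bdd_measurable[OF assms(1)]] assms
  by (intro integrable_const_bound[of _ B]) (auto intro!: AE_I2 bddD step_space)

lemma bdd_koop:
  assumes "bdd B \<phi>"
  shows "bdd B (koop \<phi>)"
  unfolding bdd_def
proof safe
  have [measurable]: "\<phi> \<in> borel_measurable M"
    using assms by (rule bdd_measurable)
  show "koop \<phi> \<in> borel_measurable M"
    unfolding koop_def by measurable
  fix u assume u: "u \<in> space M"
  have "\<bar>koop \<phi> u\<bar> \<le> (\<integral>w. \<bar>\<phi> (F w u)\<bar> \<partial>\<mu>)"
    unfolding koop_def by (rule integral_abs_bound)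
  also have "\<dots> \<le> (\<integral>w. B \<partial>\<mu>)"
    using integrable_step[OF assms u] by (intro integral_mono) (auto intro: bddD[OF assms] step_space u)
  finally show "\<bar>koop \<phi> u\<bar> \<le> B"
    by (simp add: prob_space)
qed

lemma bdd_koop_pow: "bdd B \<phi> \<Longrightarrow> bdd B ((koop ^^ n) \<phi>)"
  by (induction n) (auto intro: bdd_koop)

lemma integrable_orbit:
  assumes "bdd B \<phi>" "u \<in> space M"
  shows "integrable \<Omega> (\<lambda>\<omega>. \<phi> (orbit F u n \<omega>))"
proof -
  have [measurable]: "\<phi> \<in> borel_measurable M" "u \<in> space M"
    using assms by (auto intro: bdd_measurable)
  show ?thesis
    using assms by (intro noise.integrable_const_bound[of _ B]) (auto intro!: AE_I2 bddD orbit_space)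
qed

text \<open>The Feynman--Kac form of the Markov property: conditioning on the first step.\<close>

lemma tilted_koop_pow:
  assumes "bdd B \<phi>" "bdd A H" "u \<in> space M"
  shows "(\<integral>\<omega>. exp (\<Sum>j=1..n. H (orbit F u j \<omega>)) * \<phi> (orbit F u n \<omega>) \<partial>\<Omega>)
    = ((\<lambda>\<psi>. koop (\<lambda>v. exp (H v) * \<psi> v)) ^^ n) \<phi> u"
  using assms(3)
proof (induction n arbitrary: u)
  case 0
  then show ?case by (simp add: noise.P.prob_space)
next
  case (Suc n)
  have [measurable]: "\<phi> \<in> borel_measurable M" "H \<in> borel_measurable M" "u \<in> space M"
    using assms Suc.prems by (auto intro: bdd_measurable)
  define G where "G u n \<omega> = exp (\<Sum>j=1..n. H (orbit F u j \<omega>)) * \<phi> (orbit F u n \<omega>)" for u n \<omega>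
  have G_meas [measurable]: "G u n \<in> borel_measurable \<Omega>" if "u \<in> space M" for u n
  proof -
    have [measurable]: "u \<in> space M" by (rule that)
    show ?thesis unfolding G_def by measurable
  qed
  \<comment> \<open>Only integrability is at stake, so the exponential growth in \<open>n\<close>
    does no harm.\<close>
  have G_bound: "\<bar>G u n \<omega>\<bar> \<le> exp (real n * A) * B" if "u \<in> space M" "\<omega> \<in> space \<Omega>" for u n \<omega>
  proof -
    have "H (orbit F u j \<omega>) \<le> A" for j
      using bddD[OF assms(2) orbit_space[OF that], of j] by linarith
    then have "(\<Sum>j=1..n. H (orbit F u j \<omega>)) \<le> (\<Sum>j=1..n. A)"
      by (intro sum_mono)
    then have "exp (\<Sum>j=1..n. H (orbit F u j \<omega>)) \<le> exp (real n * A)"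
      by simp
    then show ?thesis
      using mult_mono[OF _ bddD[OF assms(1) orbit_space[OF that, of n]]] by (simp add: G_def abs_mult)
  qed
  have G_Suc: "G u (Suc n) (case_nat w \<omega>) = exp (H (F w u)) * G (F w u) n \<omega>" for w \<omega>
  proof -
    have "(\<Sum>j=1..Suc n. H (orbit F u j (case_nat w \<omega>)))
        = H (F w u) + (\<Sum>j=1..n. H (orbit F u (Suc j) (case_nat w \<omega>)))"
      by (subst sum_head_Suc) simp
    then show ?thesis
      by (simp add: G_def orbit_case_nat exp_add del: orbit.simps(2))
  qed
  interpret P: pair_prob_space \<mu> \<Omega> ..
  have case_meas: "(\<lambda>(w, \<omega>). case_nat w \<omega>) \<in> \<mu> \<Otimes>\<^sub>M \<Omega> \<rightarrow>\<^sub>M \<Omega>"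
    by measurable
  have "integrable (\<mu> \<Otimes>\<^sub>M \<Omega>) (\<lambda>x. G u (Suc n) (case x of (w, \<omega>) \<Rightarrow> case_nat w \<omega>))"
  proof (rule P.integrable_const_bound)
    show "(\<lambda>x. G u (Suc n) (case x of (w, \<omega>) \<Rightarrow> case_nat w \<omega>)) \<in> borel_measurable (\<mu> \<Otimes>\<^sub>M \<Omega>)"
      using measurable_compose[OF case_meas G_meas[OF Suc.prems, of "Suc n"]] .
    show "AE x in \<mu> \<Otimes>\<^sub>M \<Omega>. norm (G u (Suc n) (case x of (w, \<omega>) \<Rightarrow> case_nat w \<omega>)) \<le> exp (real (Suc n) * A) * B"
      unfolding real_norm_def by (intro AE_I2 G_bound[OF Suc.prems] measurable_space[OF case_meas])
  qed
  from P.integral_fst'[OF this]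
  have int_fst: "(\<integral>x. G u (Suc n) (case x of (w, \<omega>) \<Rightarrow> case_nat w \<omega>) \<partial>(\<mu> \<Otimes>\<^sub>M \<Omega>))
      = (\<integral>w. \<integral>\<omega>. G u (Suc n) (case_nat w \<omega>) \<partial>\<Omega> \<partial>\<mu>)"
    by simp
  \<comment> \<open>Prepending an independent coordinate preserves the product measure, so the first
    noise can be integrated separately.\<close>
  have "(\<integral>\<omega>. G u (Suc n) \<omega> \<partial>\<Omega>) = (\<integral>\<omega>. G u (Suc n) \<omega> \<partial>(distr (\<mu> \<Otimes>\<^sub>M \<Omega>) \<Omega> (\<lambda>(w, \<omega>). case_nat w \<omega>)))"
    by (simp only: noise.PiM_iter)
  also have "\<dots> = (\<integral>x. G u (Suc n) (case x of (w, \<omega>) \<Rightarrow> case_nat w \<omega>) \<partial>(\<mu> \<Otimes>\<^sub>M \<Omega>))"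
    using case_meas G_meas[OF Suc.prems] by (rule integral_distr)
  also have "\<dots> = (\<integral>w. \<integral>\<omega>. G u (Suc n) (case_nat w \<omega>) \<partial>\<Omega> \<partial>\<mu>)"
    unfolding int_fst by simp
  also have "\<dots> = (\<integral>w. exp (H (F w u)) * (\<integral>\<omega>. G (F w u) n \<omega> \<partial>\<Omega>) \<partial>\<mu>)"
    by (simp add: G_Suc)
  also have "\<dots> = koop (\<lambda>v. exp (H v) * ((\<lambda>\<psi>. koop (\<lambda>v. exp (H v) * \<psi> v)) ^^ n) \<phi> v) u"
    unfolding koop_def[of _ u] using Suc.IH Suc.prems
    by (intro Bochner_Integration.integral_cong) (auto simp: G_def step_space)
  finally show ?case
    by (simp add: G_def)
qed

lemma koop_pow:
  assumes "bdd B \<phi>" "u \<in> space M"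
  shows "(koop ^^ n) \<phi> u = (\<integral>\<omega>. \<phi> (orbit F u n \<omega>) \<partial>\<Omega>)"
  using tilted_koop_pow[OF assms(1) _ assms(2), of 0 "\<lambda>_. 0" n] by (simp add: bdd_def)

end

section \<open>Concentration from mixing in a weighted norm\<close>

lemma abs_exp_minus_quadratic:
  fixes s :: real
  assumes "\<bar>s\<bar> \<le> 1"
  shows "\<bar>exp s - 1 - s\<bar> \<le> s\<^sup>2"
proof (cases "s \<ge> 0")
  case True
  then show ?thesis
    using exp_bound[of s] exp_ge_add_one_self[of s] assms by linarith
next
  case False
  define x where "x = - s"
  have x: "0 \<le> x" "x \<le> 1"
    using False assms by (auto simp: x_def)
  \<comment> \<open>For negative \<open>s\<close> the claim is exp (-x) \<le> 1 - x + x^2.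
    Multiplying by exp x and bounding exp x below by its quadratic Taylor polynomial leaves this
    polynomial inequality.\<close>
  have "1 \<le> (1 + x + x\<^sup>2 / 2) * (1 - x + x\<^sup>2)"
  proof -
    have "(1 + x + x\<^sup>2 / 2) * (1 - x + x\<^sup>2) = 1 + x ^ 2 / 2 + x ^ 3 / 2 + x ^ 4 / 2"
      by (simp add: field_simps eval_nat_numeral)
    then show ?thesis using x by simp
  qed
  also have "\<dots> \<le> exp x * (1 - x + x\<^sup>2)"
    using exp_lower_Taylor_quadratic[OF x(1)] x by (intro mult_right_mono) auto
  finally have "exp s \<le> 1 + s + s\<^sup>2"
    by (simp add: x_def exp_minus field_simps)
  then show ?thesis
    using exp_ge_add_one_self[of s] zero_le_power2[of s] by linarith
qed

lemma abs_exp_minus_linear: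
  fixes s :: real
  assumes "\<bar>s\<bar> \<le> 1"
  shows "\<bar>exp s - 1\<bar> \<le> 2 * \<bar>s\<bar>"
proof -
  have "s\<^sup>2 \<le> \<bar>s\<bar>"
    using assms mult_left_le[of "\<bar>s\<bar>" "\<bar>s\<bar>"] by (simp add: power2_eq_square)
  then show ?thesis
    using abs_exp_minus_quadratic[OF assms] by linarith
qed

context random_map
begin

lemma bdd_const: "bdd \<bar>c\<bar> (\<lambda>_. c)"
  by (simp add: bdd_def)

lemma bdd_add: "bdd B \<phi> \<Longrightarrow> bdd C \<psi> \<Longrightarrow> bdd (B + C) (\<lambda>u. \<phi> u + \<psi> u)"
  by (auto simp: bdd_def intro: order_trans[OF abs_triangle_ineq] add_mono)

lemma bdd_diff: "bdd B \<phi> \<Longrightarrow> bdd C \<psi> \<Longrightarrow> bdd (B + C) (\<lambda>u. \<phi> u - \<psi> u)"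
  by (auto simp: bdd_def intro: order_trans[OF abs_triangle_ineq4] add_mono)

lemma bdd_mult: "bdd B \<phi> \<Longrightarrow> bdd C \<psi> \<Longrightarrow> bdd (B * C) (\<lambda>u. \<phi> u * \<psi> u)"
  by (auto simp: bdd_def abs_mult intro!: mult_mono elim: order_trans[OF abs_ge_zero, rotated])

lemma bdd_abs: "bdd B \<phi> \<Longrightarrow> bdd B (\<lambda>u. \<bar>\<phi> u\<bar>)"
  by (auto simp: bdd_def)

lemma bdd_exp: "bdd B \<phi> \<Longrightarrow> bdd (exp B) (\<lambda>u. exp (\<phi> u))"
  by (auto simp: bdd_def abs_le_iff)

lemma bdd_tilted:
  assumes "bdd B \<phi>" "bdd A H"
  shows "bdd (exp A ^ n * B) (((\<lambda>\<psi>. koop (\<lambda>v. exp (H v) * \<psi> v)) ^^ n) \<phi>)"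
proof (induction n)
  case (Suc n)
  then show ?case
    using bdd_koop[OF bdd_mult[OF bdd_exp[OF assms(2)] Suc]] by (simp add: mult.assoc)
qed (use assms in simp)

lemma orbit_sum_bound:
  assumes "bdd A H" "u \<in> space M" "\<omega> \<in> space \<Omega>"
  shows "\<bar>\<Sum>j=1..n. H (orbit F u j \<omega>)\<bar> \<le> real n * A"
proof -
  have "\<bar>\<Sum>j=1..n. H (orbit F u j \<omega>)\<bar> \<le> (\<Sum>j=1..n. A)"
    by (intro order_trans[OF sum_abs] sum_mono bddD[OF assms(1)] orbit_space assms)
  then show ?thesis by simp
qed

lemma orbit_meas_at:
  assumes "bdd B \<phi>" "u \<in> space M"
  shows "(\<lambda>\<omega>. \<phi> (orbit F u n \<omega>)) \<in> borel_measurable \<Omega>"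
  using integrable_orbit[OF assms] by simp

end

text \<open>Common setting of both processes: \<open>W\<close> and \<open>K\<close> are 1 for the
  projective process, \<open>1 + weight\<close> and \<open>2 + 2 * C'\<close> for the two-point
  motion. \<open>K\<close> stands for a bound on the mean of \<open>W\<close>, but is tested against
  bounded functions only, so that nothing about the measurability of \<open>W\<close> has to be
  assumed. The bound \<open>B\<close> serves integrability, while the estimates depend on \<beta>.
  The rate 1/8 leaves room for the coupling errors of a tilted block.\<close>

locale weighted_mixing = random_map \<mu> M F
  for \<mu> :: "'w measure" and M :: "'a measure" and F :: "'w \<Rightarrow> 'a \<Rightarrow> 'a" +
  fixes \<nu> :: "'a measure" and W :: "'a \<Rightarrow> real" and N :: nat and K :: real
  assumes prob_limit: "prob_space \<nu>"
    and sets_limit [measurable_cong]: "sets \<nu> = sets M"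
    and weight_ge_1: "u \<in> space M \<Longrightarrow> 1 \<le> W u"
    and block_pos: "1 \<le> N"
    and K_ge_1: "1 \<le> K"
    and invariant: "bdd B \<phi> \<Longrightarrow> (\<integral>u. koop \<phi> u \<partial>\<nu>) = (\<integral>u. \<phi> u \<partial>\<nu>)"
    and contraction: "bdd B \<phi> \<Longrightarrow> 0 \<le> \<beta> \<Longrightarrow> (\<And>v. v \<in> space M \<Longrightarrow> \<bar>\<phi> v\<bar> \<le> \<beta> * W v) \<Longrightarrow>
        u \<in> space M \<Longrightarrow> \<bar>(koop ^^ N) \<phi> u - (\<integral>v. \<phi> v \<partial>\<nu>)\<bar> \<le> \<beta> / 8 * W u"
    and weight_mean: "bdd B \<phi> \<Longrightarrow> 0 \<le> \<beta> \<Longrightarrow> (\<And>v. v \<in> space M \<Longrightarrow> \<bar>\<phi> v\<bar> \<le> \<beta> * W v) \<Longrightarrow>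
        (\<integral>v. \<bar>\<phi> v\<bar> \<partial>\<nu>) \<le> \<beta> * K"
begin

interpretation \<nu>: prob_space \<nu> by (rule prob_limit)

lemma space_limit: "space \<nu> = space M"
  by (rule sets_eq_imp_space_eq[OF sets_limit])

lemma integrable_limit: "bdd B \<phi> \<Longrightarrow> integrable \<nu> \<phi>"
  by (intro \<nu>.integrable_const_bound[of _ B]) (auto simp: bdd_def space_limit measurable_cong_sets[OF sets_limit refl])

lemma invariant_pow: "bdd B \<phi> \<Longrightarrow> (\<integral>u. (koop ^^ n) \<phi> u \<partial>\<nu>) = (\<integral>u. \<phi> u \<partial>\<nu>)"
proof (induction n)
  case (Suc n)
  then show ?case using invariant[OF bdd_koop_pow[OF Suc.prems, of n]] by simp
qed simp

text \<open>Here \<open>H\<close> already carries the Chernoff parameter and is so small that its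
  sum over a block of \<open>N\<close> steps is at most \<open>x\<close>. The smallness of
  \<open>x\<close> relative to \<open>K\<close> keeps the coupling errors below the \<beta>/8 left
  by contraction.\<close>

context
  fixes H :: "'a \<Rightarrow> real" and x :: real
  assumes H: "bdd (x / real N) H" and H_mean: "(\<integral>u. H u \<partial>\<nu>) = 0"
    and x: "0 \<le> x" "x * (2 * K + 1) \<le> 1 / 16"
begin

definition tilt :: "('a \<Rightarrow> real) \<Rightarrow> 'a \<Rightarrow> real" where
  "tilt \<psi> = ((\<lambda>\<psi>. koop (\<lambda>v. exp (H v) * \<psi> v)) ^^ N) \<psi>"

lemma x_le: "x \<le> 1 / 16"
proof -
  have "x * 1 \<le> x * (2 * K + 1)"
    using x K_ge_1 by (intro mult_left_mono) auto
  then show ?thesis using x by simp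
qed

lemma tilt_eq:
  "bdd B \<phi> \<Longrightarrow> u \<in> space M \<Longrightarrow>
    tilt \<phi> u = (\<integral>\<omega>. exp (\<Sum>j=1..N. H (orbit F u j \<omega>)) * \<phi> (orbit F u N \<omega>) \<partial>\<Omega>)"
  unfolding tilt_def by (rule tilted_koop_pow[OF _ H, symmetric])

lemma bdd_tilt: "bdd B \<phi> \<Longrightarrow> bdd (exp (x / real N) ^ N * B) (tilt \<phi>)"
  unfolding tilt_def by (rule bdd_tilted[OF _ H])

lemma block_sum_bound:
  "u \<in> space M \<Longrightarrow> \<omega> \<in> space \<Omega> \<Longrightarrow> \<bar>\<Sum>j=1..N. H (orbit F u j \<omega>)\<bar> \<le> x"
  using orbit_sum_bound[OF H, of u \<omega> N] block_pos by simp

lemma sum_meas [measurable]: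
  "u \<in> space M \<Longrightarrow> (\<lambda>\<omega>. \<Sum>j=1..N. H (orbit F u j \<omega>)) \<in> borel_measurable \<Omega>"
  by (intro borel_measurable_sum orbit_meas_at[OF H])

lemma integrable_bdd:
  fixes f :: "(nat \<Rightarrow> 'w) \<Rightarrow> real"
  assumes "f \<in> borel_measurable \<Omega>" "\<And>\<omega>. \<omega> \<in> space \<Omega> \<Longrightarrow> \<bar>f \<omega>\<bar> \<le> B"
  shows "integrable \<Omega> f"
  using assms by (intro noise.integrable_const_bound[of _ B]) auto

lemma abs_integral_le:
  fixes f :: "(nat \<Rightarrow> 'w) \<Rightarrow> real"
  assumes "f \<in> borel_measurable \<Omega>" "\<And>\<omega>. \<omega> \<in> space \<Omega> \<Longrightarrow> \<bar>f \<omega>\<bar> \<le> g \<omega>" "integrable \<Omega> g"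
  shows "\<bar>\<integral>\<omega>. f \<omega> \<partial>\<Omega>\<bar> \<le> (\<integral>\<omega>. g \<omega> \<partial>\<Omega>)"
proof -
  have "integrable \<Omega> f"
    using assms by (intro Bochner_Integration.integrable_bound[OF assms(3)] AE_I2) force+
  then have "(\<integral>\<omega>. \<bar>f \<omega>\<bar> \<partial>\<Omega>) \<le> (\<integral>\<omega>. g \<omega> \<partial>\<Omega>)"
    using assms by (intro integral_mono) auto
  then show ?thesis
    using integral_abs_bound[of \<Omega> f] by linarith
qed

text \<open>Splitting \<open>h = a + b\<close> with \<open>a\<close> its mean and \<open>b\<close> of mean zero, one tilted block sends the
  constant part to itself up to \<open>O(x\<^sup>2)\<close> in the mean (the linear term vanishes since \<open>H\<close> has mean
  zero) and \<open>O(x)\<close> pointwise, and it contracts the mean-zero part.\<close>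

lemma tilt_one:
  assumes "u \<in> space M"
  shows "\<bar>tilt (\<lambda>_. 1) u - 1\<bar> \<le> 2 * x"
    and "\<bar>tilt (\<lambda>_. 1) u - 1 - (\<Sum>j=1..N. (koop ^^ j) H u)\<bar> \<le> x\<^sup>2"
proof -
  define S where "S \<omega> = (\<Sum>j=1..N. H (orbit F u j \<omega>))" for \<omega>
  have S: "\<bar>S \<omega>\<bar> \<le> x" if "\<omega> \<in> space \<Omega>" for \<omega>
    unfolding S_def using assms that by (rule block_sum_bound)
  have S1: "\<bar>S \<omega>\<bar> \<le> 1" if "\<omega> \<in> space \<Omega>" for \<omega>
    using S[OF that] x_le by linarith
  have [measurable]: "S \<in> borel_measurable \<Omega>"
    unfolding S_def using assms by measurable
  have t: "tilt (\<lambda>_. 1) u = (\<integral>\<omega>. exp (S \<omega>) \<partial>\<Omega>)"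
    using tilt_eq[OF bdd_const assms] by (simp add: S_def)
  have intS: "integrable \<Omega> S"
    by (rule integrable_bdd[OF _ S]) auto
  have intE: "integrable \<Omega> (\<lambda>\<omega>. exp (S \<omega>))"
  proof (rule integrable_bdd)
    show "\<bar>exp (S \<omega>)\<bar> \<le> exp 1" if "\<omega> \<in> space \<Omega>" for \<omega>
      using S1[OF that] by auto
  qed simp
  have sumS: "(\<integral>\<omega>. S \<omega> \<partial>\<Omega>) = (\<Sum>j=1..N. (koop ^^ j) H u)"
    unfolding S_def using integrable_orbit[OF H assms]
    by (subst Bochner_Integration.integral_sum) (auto simp: koop_pow[OF H assms])
  have "\<bar>\<integral>\<omega>. exp (S \<omega>) - 1 \<partial>\<Omega>\<bar> \<le> (\<integral>\<omega>. 2 * x \<partial>\<Omega>)"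
  proof (rule abs_integral_le)
    show "\<bar>exp (S \<omega>) - 1\<bar> \<le> 2 * x" if "\<omega> \<in> space \<Omega>" for \<omega>
      using abs_exp_minus_linear[OF S1[OF that]] S[OF that] by linarith
  qed auto
  then show "\<bar>tilt (\<lambda>_. 1) u - 1\<bar> \<le> 2 * x"
    using intE by (simp add: t noise.P.prob_space)
  have "\<bar>\<integral>\<omega>. exp (S \<omega>) - 1 - S \<omega> \<partial>\<Omega>\<bar> \<le> (\<integral>\<omega>. x\<^sup>2 \<partial>\<Omega>)"
  proof (rule abs_integral_le)
    show "\<bar>exp (S \<omega>) - 1 - S \<omega>\<bar> \<le> x\<^sup>2" if "\<omega> \<in> space \<Omega>" for \<omega>
    proof -
      have "(S \<omega>)\<^sup>2 \<le> x\<^sup>2"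
        using S[OF that] x(1) by (simp add: abs_le_square_iff[symmetric])
      then show ?thesis
        using abs_exp_minus_quadratic[OF S1[OF that]] by linarith
    qed
  qed auto
  then show "\<bar>tilt (\<lambda>_. 1) u - 1 - (\<Sum>j=1..N. (koop ^^ j) H u)\<bar> \<le> x\<^sup>2"
    using intE intS by (simp add: t sumS noise.P.prob_space)
qed

lemma tilt_one_mean: "\<bar>(\<integral>u. tilt (\<lambda>_. 1) u \<partial>\<nu>) - 1\<bar> \<le> x\<^sup>2"
proof -
  have b: "bdd (real N * (x / real N)) (\<lambda>u. \<Sum>j=1..N. (koop ^^ j) H u)"
  proof -
    have "bdd (real n * (x / real N)) (\<lambda>u. \<Sum>j=1..n. (koop ^^ j) H u)" for n
    proof (induction n)
      case (Suc n)
      then show ?case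
        using bdd_add[OF Suc bdd_koop_pow[OF H, of "Suc n"]] by (simp add: algebra_simps add_divide_distrib)
    qed (simp add: bdd_def)
    then show ?thesis .
  qed
  have "(\<integral>u. (\<Sum>j=1..N. (koop ^^ j) H u) \<partial>\<nu>) = (\<Sum>j=1..N. \<integral>u. (koop ^^ j) H u \<partial>\<nu>)"
    using integrable_limit[OF bdd_koop_pow[OF H]] by (subst Bochner_Integration.integral_sum) auto
  also have "\<dots> = 0"
    using invariant_pow[OF H] H_mean by simp
  finally have z: "(\<integral>u. (\<Sum>j=1..N. (koop ^^ j) H u) \<partial>\<nu>) = 0" .
  have t: "integrable \<nu> (tilt (\<lambda>_. 1))"
    by (rule integrable_limit[OF bdd_tilt[OF bdd_const]])
  have i: "integrable \<nu> (\<lambda>u. tilt (\<lambda>_. 1) u - 1 - (\<Sum>j=1..N. (koop ^^ j) H u))"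
    using t integrable_limit[OF b] by simp
  have "(\<integral>u. tilt (\<lambda>_. 1) u \<partial>\<nu>) - 1 = (\<integral>u. tilt (\<lambda>_. 1) u - 1 - (\<Sum>j=1..N. (koop ^^ j) H u) \<partial>\<nu>)"
    using t integrable_limit[OF b] by (simp add: z[simplified] \<nu>.prob_space)
  also have "\<bar>\<dots>\<bar> \<le> (\<integral>u. \<bar>tilt (\<lambda>_. 1) u - 1 - (\<Sum>j=1..N. (koop ^^ j) H u)\<bar> \<partial>\<nu>)"
    by (rule integral_abs_bound)
  also have "\<dots> \<le> (\<integral>u. x\<^sup>2 \<partial>\<nu>)"
    using i tilt_one(2) by (intro integral_mono) (auto simp: space_limit)
  finally show ?thesis by (simp add: \<nu>.prob_space)
qed

text \<open>Apart from the tilted constant and the untilted image of \<open>b\<close>, only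
  \<open>d\<close> remains, the expectation of (exp S - 1) b along the block. It is at most 2 x
  times the image of |b|, hence has mean at most 2 x K \<beta> by invariance and
  \<open>weight_mean\<close>. In the deviation bound, 4 x a comes from tilting the constant,
  \<beta>/8 from contraction, and another \<beta>/8 from \<open>d\<close> and its mean.\<close>

lemma tilt_step:
  assumes h: "bdd B h" and a: "(\<integral>u. h u \<partial>\<nu>) = a" "0 \<le> a"
    and \<beta>: "0 \<le> \<beta>" "\<And>u. u \<in> space M \<Longrightarrow> \<bar>h u - a\<bar> \<le> \<beta> * W u"
  defines "a' \<equiv> (\<integral>u. tilt h u \<partial>\<nu>)"
  shows "a' \<le> (1 + x\<^sup>2) * a + 2 * x * K * \<beta>"
    and "u \<in> space M \<Longrightarrow> \<bar>tilt h u - a'\<bar> \<le> (4 * x * a + \<beta> / 4) * W u"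
proof -
  define b where "b u = h u - a" for u
  define d where "d u = tilt h u - a * tilt (\<lambda>_. 1) u - (koop ^^ N) b u" for u
  have bdd_b: "bdd (B + \<bar>a\<bar>) b"
    unfolding b_def by (intro bdd_diff h bdd_const)
  have b_W: "\<bar>b u\<bar> \<le> \<beta> * W u" if "u \<in> space M" for u
    using \<beta>(2)[OF that] by (simp add: b_def)
  have b_mean: "(\<integral>u. b u \<partial>\<nu>) = 0"
    using integrable_limit[OF h] a by (simp add: b_def \<nu>.prob_space)
  have bdd_absb: "bdd (B + \<bar>a\<bar>) (\<lambda>u. \<bar>b u\<bar>)"
    by (rule bdd_abs[OF bdd_b])
  have d_koop: "\<bar>d u\<bar> \<le> 2 * x * (koop ^^ N) (\<lambda>u. \<bar>b u\<bar>) u" if u: "u \<in> space M" for u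
  proof -
    define S where "S \<omega> = (\<Sum>j=1..N. H (orbit F u j \<omega>))" for \<omega>
    have S: "\<bar>S \<omega>\<bar> \<le> x" if "\<omega> \<in> space \<Omega>" for \<omega>
      unfolding S_def using u that by (rule block_sum_bound)
    have S1: "\<bar>S \<omega>\<bar> \<le> 1" if "\<omega> \<in> space \<Omega>" for \<omega>
      using S[OF that] x_le by linarith
    have [measurable]: "S \<in> borel_measurable \<Omega>"
      unfolding S_def using u by measurable
    have [measurable]: "(\<lambda>\<omega>. h (orbit F u N \<omega>)) \<in> borel_measurable \<Omega>"
        "(\<lambda>\<omega>. b (orbit F u N \<omega>)) \<in> borel_measurable \<Omega>"
      by (rule orbit_meas_at[OF h u] orbit_meas_at[OF bdd_b u])+
    have expS: "\<bar>exp (S \<omega>)\<bar> \<le> exp 1" if "\<omega> \<in> space \<Omega>" for \<omega>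
      using S1[OF that] by auto
    have i1: "integrable \<Omega> (\<lambda>\<omega>. exp (S \<omega>) * h (orbit F u N \<omega>))"
      using bddD[OF h orbit_space[OF u]] expS
      by (intro integrable_bdd[of _ "exp 1 * B"]) (auto simp: abs_mult intro!: mult_mono)
    have i2: "integrable \<Omega> (\<lambda>\<omega>. exp (S \<omega>))"
      using expS by (intro integrable_bdd[of _ "exp 1"]) auto
    have i3: "integrable \<Omega> (\<lambda>\<omega>. b (orbit F u N \<omega>))"
      by (rule integrable_orbit[OF bdd_b u])
    have "d u = (\<integral>\<omega>. exp (S \<omega>) * h (orbit F u N \<omega>) \<partial>\<Omega>) - a * (\<integral>\<omega>. exp (S \<omega>) \<partial>\<Omega>)
        - (\<integral>\<omega>. b (orbit F u N \<omega>) \<partial>\<Omega>)"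
      using tilt_eq[OF h u] tilt_eq[OF bdd_const u, of 1] koop_pow[OF bdd_b u, of N]
      by (simp add: d_def S_def)
    also have "\<dots> = (\<integral>\<omega>. exp (S \<omega>) * h (orbit F u N \<omega>) - a * exp (S \<omega>) - b (orbit F u N \<omega>) \<partial>\<Omega>)"
      using i1 i2 i3 by simp
    also have "\<dots> = (\<integral>\<omega>. (exp (S \<omega>) - 1) * b (orbit F u N \<omega>) \<partial>\<Omega>)"
      by (intro Bochner_Integration.integral_cong) (auto simp: b_def algebra_simps)
    also have "\<bar>\<dots>\<bar> \<le> (\<integral>\<omega>. 2 * x * \<bar>b (orbit F u N \<omega>)\<bar> \<partial>\<Omega>)"
    proof (rule abs_integral_le)
      fix \<omega> assume "\<omega> \<in> space \<Omega>"
      then have "\<bar>exp (S \<omega>) - 1\<bar> \<le> 2 * x"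
        using abs_exp_minus_linear[OF S1] S by fastforce
      then show "\<bar>(exp (S \<omega>) - 1) * b (orbit F u N \<omega>)\<bar> \<le> 2 * x * \<bar>b (orbit F u N \<omega>)\<bar>"
        by (simp add: abs_mult mult_right_mono)
    qed (use i3 in auto)
    also have "\<dots> = 2 * x * (koop ^^ N) (\<lambda>u. \<bar>b u\<bar>) u"
      using koop_pow[OF bdd_absb u, of N] by simp
    finally show ?thesis .
  qed
  have d_mean: "\<bar>\<integral>u. d u \<partial>\<nu>\<bar> \<le> 2 * x * (\<beta> * K)"
  proof -
    have id: "integrable \<nu> d"
      unfolding d_def using integrable_limit[OF bdd_tilt[OF h]] integrable_limit[OF bdd_tilt[OF bdd_const]]
        integrable_limit[OF bdd_koop_pow[OF bdd_b]] by simp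
    have "\<bar>\<integral>u. d u \<partial>\<nu>\<bar> \<le> (\<integral>u. \<bar>d u\<bar> \<partial>\<nu>)"
      by (rule integral_abs_bound)
    also have "\<dots> \<le> (\<integral>u. 2 * x * (koop ^^ N) (\<lambda>u. \<bar>b u\<bar>) u \<partial>\<nu>)"
      using id integrable_limit[OF bdd_koop_pow[OF bdd_absb]] d_koop
      by (intro integral_mono) (auto simp: space_limit)
    also have "\<dots> = 2 * x * (\<integral>u. \<bar>b u\<bar> \<partial>\<nu>)"
      using invariant_pow[OF bdd_absb, of N] by simp
    also have "\<dots> \<le> 2 * x * (\<beta> * K)"
      using weight_mean[OF bdd_b \<beta>(1) b_W] x(1) by (intro mult_left_mono) auto
    finally show ?thesis .
  qed
  have d_W: "\<bar>d u\<bar> \<le> 2 * x * \<beta> * (K + 1 / 8) * W u" if u: "u \<in> space M" for u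
  proof -
    \<comment> \<open>The mean of |b| need not vanish, so contraction bounds only the deviation from
      it; the mean itself costs \<beta> K.\<close>
    have "\<bar>(koop ^^ N) (\<lambda>u. \<bar>b u\<bar>) u - (\<integral>u. \<bar>b u\<bar> \<partial>\<nu>)\<bar> \<le> \<beta> / 8 * W u"
      by (rule contraction[OF bdd_absb \<beta>(1) _ u]) (simp only: abs_idempotent b_W)
    then have "(koop ^^ N) (\<lambda>u. \<bar>b u\<bar>) u \<le> (\<integral>u. \<bar>b u\<bar> \<partial>\<nu>) + \<beta> / 8 * W u"
      by linarith
    also have "\<dots> \<le> \<beta> * K * W u + \<beta> / 8 * W u"
    proof -
      have "\<beta> * K * 1 \<le> \<beta> * K * W u"
        using weight_ge_1[OF u] \<beta>(1) K_ge_1 by (intro mult_left_mono) auto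
      then show ?thesis
        using weight_mean[OF bdd_b \<beta>(1) b_W] by simp
    qed
    finally have "2 * x * (koop ^^ N) (\<lambda>u. \<bar>b u\<bar>) u \<le> 2 * x * (\<beta> * K * W u + \<beta> / 8 * W u)"
      using x(1) by (intro mult_left_mono) auto
    then show ?thesis
      using d_koop[OF u] by (simp add: algebra_simps)
  qed
  have a'_eq: "a' = a * (\<integral>u. tilt (\<lambda>_. 1) u \<partial>\<nu>) + (\<integral>u. d u \<partial>\<nu>)"
    using integrable_limit[OF bdd_tilt[OF h]] integrable_limit[OF bdd_tilt[OF bdd_const]]
      integrable_limit[OF bdd_koop_pow[OF bdd_b]] invariant_pow[OF bdd_b, of N]
    by (simp add: d_def a'_def b_mean)
  have "(\<integral>u. tilt (\<lambda>_. 1) u \<partial>\<nu>) \<le> 1 + x\<^sup>2"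
    using tilt_one_mean by linarith
  then have "a * (\<integral>u. tilt (\<lambda>_. 1) u \<partial>\<nu>) \<le> a * (1 + x\<^sup>2)"
    using a(2) by (rule mult_left_mono)
  then show "a' \<le> (1 + x\<^sup>2) * a + 2 * x * K * \<beta>"
    unfolding a'_eq using d_mean by (simp add: algebra_simps)
  show "\<bar>tilt h u - a'\<bar> \<le> (4 * x * a + \<beta> / 4) * W u" if u: "u \<in> space M"
  proof -
    have W: "1 \<le> W u" using weight_ge_1[OF u] .
    have "\<bar>(\<integral>u. tilt (\<lambda>_. 1) u \<partial>\<nu>) - 1\<bar> \<le> 2 * x"
    proof -
      have "x\<^sup>2 \<le> x"
        using x x_le mult_left_le[of x x] by (simp add: power2_eq_square)
      then show ?thesis using tilt_one_mean x by linarith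
    qed
    then have e: "\<bar>tilt (\<lambda>_. 1) u - (\<integral>u. tilt (\<lambda>_. 1) u \<partial>\<nu>)\<bar> \<le> 4 * x"
      using tilt_one(1)[OF u] by linarith
    have e': "\<bar>a * (tilt (\<lambda>_. 1) u - (\<integral>u. tilt (\<lambda>_. 1) u \<partial>\<nu>))\<bar> \<le> 4 * x * a * W u"
    proof -
      have "\<bar>a * (tilt (\<lambda>_. 1) u - (\<integral>u. tilt (\<lambda>_. 1) u \<partial>\<nu>))\<bar> \<le> a * (4 * x)"
        using e a(2) by (simp add: abs_mult mult_left_mono)
      also have "\<dots> \<le> a * (4 * x) * W u"
        using mult_left_mono[OF W, of "a * (4 * x)"] a(2) x(1) by simp
      finally show ?thesis by (simp add: algebra_simps)
    qed
    have f: "\<bar>(koop ^^ N) b u\<bar> \<le> \<beta> / 8 * W u"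
      using contraction[OF bdd_b \<beta>(1) b_W u] b_mean by simp
    have g: "\<bar>\<integral>u. d u \<partial>\<nu>\<bar> \<le> 2 * x * \<beta> * K * W u"
    proof -
      have "2 * x * \<beta> * K * 1 \<le> 2 * x * \<beta> * K * W u"
        using W x(1) \<beta>(1) K_ge_1 by (intro mult_left_mono) auto
      then show ?thesis using d_mean by (simp add: algebra_simps)
    qed
    have split: "tilt h u - a' = a * (tilt (\<lambda>_. 1) u - (\<integral>u. tilt (\<lambda>_. 1) u \<partial>\<nu>)) + (koop ^^ N) b u
        + d u - (\<integral>u. d u \<partial>\<nu>)"
      unfolding a'_eq d_def[of u] by (simp add: algebra_simps)
    \<comment> \<open>Here x (2 K + 1) \<le> 1/16 is spent, in the form 4 x K + x/4 \<le>
      1/8.\<close>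
    have k: "2 * x * \<beta> * (K + 1 / 8) * W u + 2 * x * \<beta> * K * W u \<le> \<beta> / 8 * W u"
    proof -
      have "2 * x * \<beta> * (K + 1 / 8) * W u + 2 * x * \<beta> * K * W u
          = (2 * (x * (2 * K)) + x / 4) * (\<beta> * W u)"
        by (simp add: algebra_simps)
      also have "\<dots> \<le> (1 / 8) * (\<beta> * W u)"
        using x W \<beta>(1) by (intro mult_right_mono) (auto simp: algebra_simps)
      finally show ?thesis by simp
    qed
    have "\<bar>tilt h u - a'\<bar> \<le> 4 * x * a * W u + \<beta> / 8 * W u + 2 * x * \<beta> * (K + 1 / 8) * W u
        + 2 * x * \<beta> * K * W u"
      unfolding split using e' f g d_W[OF u] by linarith
    also have "\<dots> \<le> 4 * x * a * W u + \<beta> / 8 * W u + \<beta> / 8 * W u"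
      using k by linarith
    also have "\<dots> = (4 * x * a + \<beta> / 4) * W u"
      by (simp add: algebra_simps)
    finally show ?thesis .
  qed
qed

text \<open>Induction on mean and deviation together: the mean stays below \<open>E j\<close>, the
  deviation below 8 x \<open>E j\<close> W. The factor 8 is stable, since a block turns it into at
  most 4 + 8/4. The mean then grows by the relative amount x^2 + 2 x K * 8 x per block, which is the
  exponent.\<close>

lemma tilt_pow_bound:
  assumes "u \<in> space M"
  shows "(tilt ^^ j) (\<lambda>_. 1) u \<le> 2 * W u * exp ((1 + 16 * K) * x\<^sup>2 * real j)"
proof -
  define E where "E j = exp ((1 + 16 * K) * x\<^sup>2 * real j)" for j
  have E_Suc: "(1 + (1 + 16 * K) * x\<^sup>2) * E j \<le> E (Suc j)" for j
  proof -
    have "(1 + (1 + 16 * K) * x\<^sup>2) * E j \<le> exp ((1 + 16 * K) * x\<^sup>2) * E j"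
      by (intro mult_right_mono exp_ge_add_one_self) (simp add: E_def)
    also have "\<dots> = E (Suc j)"
      by (simp add: E_def exp_add[symmetric] algebra_simps)
    finally show ?thesis .
  qed
  have E_mono: "E j \<le> E (Suc j)" for j
    using K_ge_1 by (simp add: E_def mult_left_mono)
  have E_pos: "0 \<le> E j" for j
    by (simp add: E_def)
  have "\<exists>B a. bdd B ((tilt ^^ j) (\<lambda>_. 1)) \<and> (\<integral>u. (tilt ^^ j) (\<lambda>_. 1) u \<partial>\<nu>) = a \<and> 0 \<le> a \<and> a \<le> E j
     \<and> (\<forall>u\<in>space M. 0 \<le> (tilt ^^ j) (\<lambda>_. 1) u \<and> \<bar>(tilt ^^ j) (\<lambda>_. 1) u - a\<bar> \<le> 8 * x * E j * W u)"
  proof (induction j)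
    case 0
    have "0 \<le> 8 * x * W u" if "u \<in> space M" for u
      using x(1) weight_ge_1[OF that] by simp
    then show ?case
      using bdd_const[of 1] by (auto simp: E_def \<nu>.prob_space)
  next
    case (Suc j)
    define h where "h = (tilt ^^ j) (\<lambda>_. 1)"
    define a' where "a' = (\<integral>u. tilt h u \<partial>\<nu>)"
    from Suc obtain B a where B: "bdd B h" and a: "(\<integral>u. h u \<partial>\<nu>) = a" "0 \<le> a" "a \<le> E j"
      and h: "\<And>u. u \<in> space M \<Longrightarrow> 0 \<le> h u" "\<And>u. u \<in> space M \<Longrightarrow> \<bar>h u - a\<bar> \<le> 8 * x * E j * W u"
      unfolding h_def by blast
    have \<beta>: "0 \<le> 8 * x * E j" using x(1) E_pos by simp
    note step = tilt_step[OF B a(1,2) \<beta> h(2), folded a'_def]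
    have pos: "0 \<le> tilt h u" if "u \<in> space M" for u
      unfolding tilt_eq[OF B that]
      using that h(1) by (intro integral_nonneg_AE AE_I2 mult_nonneg_nonneg) (auto intro: orbit_space)
    have "0 \<le> a'"
      unfolding a'_def using pos by (intro integral_nonneg_AE AE_I2) (simp add: space_limit)
    moreover have "a' \<le> E (Suc j)"
    proof -
      have "a' \<le> (1 + x\<^sup>2) * E j + 2 * x * K * (8 * x * E j)"
        using step(1) mult_left_mono[OF a(3), of "1 + x\<^sup>2"] by simp
      also have "\<dots> = (1 + (1 + 16 * K) * x\<^sup>2) * E j"
        by (simp add: algebra_simps power2_eq_square)
      finally show ?thesis using E_Suc[of j] by linarith
    qed
    moreover have "\<bar>tilt h u - a'\<bar> \<le> 8 * x * E (Suc j) * W u" if u: "u \<in> space M" for u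
    proof -
      have "\<bar>tilt h u - a'\<bar> \<le> (4 * x * a + 8 * x * E j / 4) * W u"
        by (rule step(2)[OF _ u])
      also have "\<dots> \<le> (8 * x * E (Suc j)) * W u"
      proof (rule mult_right_mono)
        have "4 * x * a \<le> 4 * x * E (Suc j)"
          using a(3) E_mono[of j] x(1) by (intro mult_left_mono) auto
        moreover have "2 * x * E j \<le> 4 * x * E (Suc j)"
          using E_mono[of j] x(1) E_pos[of j] by (intro mult_mono) auto
        ultimately show "4 * x * a + 8 * x * E j / 4 \<le> 8 * x * E (Suc j)"
          by simp
        show "0 \<le> W u" using weight_ge_1[OF u] by simp
      qed
      finally show ?thesis .
    qed
    moreover have "(tilt ^^ Suc j) (\<lambda>_. 1) = tilt h"
      by (simp add: h_def)
    ultimately show ?case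
      using bdd_tilt[OF B] pos by (auto simp: a'_def)
  qed
  then obtain a where "a \<le> E j" "\<bar>(tilt ^^ j) (\<lambda>_. 1) u - a\<bar> \<le> 8 * x * E j * W u"
    using assms by blast
  then have "(tilt ^^ j) (\<lambda>_. 1) u \<le> E j + 8 * x * E j * W u"
    by linarith
  also have "\<dots> \<le> E j * W u + 1 * E j * W u"
  proof (intro add_mono mult_right_mono)
    show "E j \<le> E j * W u"
      using mult_left_mono[OF weight_ge_1[OF assms] E_pos[of j]] by simp
  qed (use x_le E_pos weight_ge_1[OF assms] in auto)
  finally show ?thesis by (simp add: E_def)
qed

text \<open>Whole blocks are handled by \<open>tilt\<close>. The steps left over, at most
  \<open>N\<close>, add at most x \<le> 1 to the exponent, hence a factor exp 1 \<le> 3, which turns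
  2 into 6.\<close>

lemma mgf_bound:
  assumes "u \<in> space M"
  shows "(\<integral>\<omega>. exp (\<Sum>j=1..n. H (orbit F u j \<omega>)) \<partial>\<Omega>) \<le> 6 * W u * exp ((1 + 16 * K) * x\<^sup>2 * real n)"
proof -
  define T where "T = (\<lambda>\<psi>. koop (\<lambda>v. exp (H v) * \<psi> v))"
  define q where "q = n div N"
  have T_pow: "(T ^^ k) (\<lambda>_. 1) u = (\<integral>\<omega>. exp (\<Sum>j=1..k. H (orbit F u j \<omega>)) \<partial>\<Omega>)" for k
    using tilted_koop_pow[OF bdd_const H assms, of k 1] by (simp add: T_def)
  have "tilt = T ^^ N"
    by (auto simp: tilt_def T_def fun_eq_iff)
  then have tilt_pow: "(T ^^ (N * q)) = tilt ^^ q"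
    by (simp add: funpow_mult)
  have n: "N * q \<le> n" "n \<le> N * q + N"
    using block_pos mod_less_divisor[of N n] mult_div_mod_eq[of N n] unfolding q_def by linarith+
  have int: "integrable \<Omega> (\<lambda>\<omega>. exp (\<Sum>j=1..k. H (orbit F u j \<omega>)))" for k
  proof (rule integrable_bdd)
    show "(\<lambda>\<omega>. exp (\<Sum>j=1..k. H (orbit F u j \<omega>))) \<in> borel_measurable \<Omega>"
      by (rule measurable_compose[OF borel_measurable_sum[OF orbit_meas_at[OF H assms]] borel_measurable_exp])
    show "\<bar>exp (\<Sum>j=1..k. H (orbit F u j \<omega>))\<bar> \<le> exp (real k * (x / real N))" if "\<omega> \<in> space \<Omega>" for \<omega>
      using orbit_sum_bound[OF H assms that, of k] by (simp add: abs_le_iff)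
  qed
  have "(\<integral>\<omega>. exp (\<Sum>j=1..n. H (orbit F u j \<omega>)) \<partial>\<Omega>)
      \<le> (\<integral>\<omega>. 3 * exp (\<Sum>j=1..N*q. H (orbit F u j \<omega>)) \<partial>\<Omega>)"
  proof (rule integral_mono)
    fix \<omega> assume \<omega>: "\<omega> \<in> space \<Omega>"
    have "(\<Sum>j=1..n. H (orbit F u j \<omega>))
        = (\<Sum>j=1..N*q. H (orbit F u j \<omega>)) + (\<Sum>j=N*q+1..n. H (orbit F u j \<omega>))"
      using sum.ub_add_nat[of 1 "N*q" "\<lambda>j. H (orbit F u j \<omega>)" "n - N*q"]
      by (simp only: le_add2 le_add_diff_inverse[OF n(1)])
    moreover have "(\<Sum>j=N*q+1..n. H (orbit F u j \<omega>)) \<le> 1"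
    proof -
      have "H (orbit F u j \<omega>) \<le> x / real N" for j
        using bddD[OF H orbit_space[OF assms \<omega>], of j] by linarith
      then have "(\<Sum>j=N*q+1..n. H (orbit F u j \<omega>)) \<le> (\<Sum>j=N*q+1..n. x / real N)"
        by (rule sum_mono)
      also have "\<dots> = real (n - N*q) * (x / real N)"
        by simp
      also have "\<dots> \<le> real N * (x / real N)"
      proof (rule mult_right_mono)
        show "real (n - N * q) \<le> real N" using n(2) by linarith
      qed (use x(1) in simp)
      finally show ?thesis using block_pos x_le by simp
    qed
    ultimately have "exp (\<Sum>j=1..n. H (orbit F u j \<omega>)) \<le> exp (1 + (\<Sum>j=1..N*q. H (orbit F u j \<omega>)))"
      by simp
    also have "\<dots> = exp 1 * exp (\<Sum>j=1..N*q. H (orbit F u j \<omega>))"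
      by (rule exp_add)
    also have "\<dots> \<le> 3 * exp (\<Sum>j=1..N*q. H (orbit F u j \<omega>))"
      using exp_le by (intro mult_right_mono) auto
    finally show "exp (\<Sum>j=1..n. H (orbit F u j \<omega>)) \<le> 3 * exp (\<Sum>j=1..N*q. H (orbit F u j \<omega>))" .
  qed (use int in auto)
  also have "\<dots> = 3 * (tilt ^^ q) (\<lambda>_. 1) u"
    by (simp only: Bochner_Integration.integral_mult_right_zero T_pow[symmetric] tilt_pow)
  also have "\<dots> \<le> 3 * (2 * W u * exp ((1 + 16 * K) * x\<^sup>2 * real q))"
    using tilt_pow_bound[OF assms, of q] by simp
  also have "\<dots> \<le> 3 * (2 * W u * exp ((1 + 16 * K) * x\<^sup>2 * real n))"
  proof -
    have "real q \<le> real n" by (simp add: q_def)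
    then have "(1 + 16 * K) * x\<^sup>2 * real q \<le> (1 + 16 * K) * x\<^sup>2 * real n"
      using K_ge_1 by (intro mult_left_mono) auto
    then show ?thesis using weight_ge_1[OF assms] by simp
  qed
  finally show ?thesis by simp
qed

end

text \<open>Chernoff with parameter \<theta> = \<kappa> \<epsilon>, so that one block has x =
  \<theta> N. The first condition on \<kappa>, together with \<epsilon> \<le> 1, gives the smallness
  of \<open>x\<close>; the second makes the quadratic term at most half of the linear one, which
  leaves \<kappa>/2.\<close>

lemma upper_tail:
  assumes H: "bdd 1 H" and H_mean: "(\<integral>u. H u \<partial>\<nu>) = 0" and u: "u \<in> space M" and "1 \<le> n"
    and \<kappa>: "\<kappa> > 0" "\<kappa> * (real N * (2 * K + 1)) \<le> 1 / 16" "\<kappa> * (2 * (1 + 16 * K) * (real N)\<^sup>2) \<le> 1"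
    and \<epsilon>: "0 < \<epsilon>" "\<epsilon> \<le> 1"
  shows "measure \<Omega> {\<omega> \<in> space \<Omega>. (\<Sum>j=1..n. H (orbit F u j \<omega>)) / real n \<ge> \<epsilon>}
    \<le> 6 * W u * exp (- (\<kappa> / 2) * real n * \<epsilon>\<^sup>2)"
proof -
  define \<theta> where "\<theta> = \<kappa> * \<epsilon>"
  have \<theta>: "\<theta> > 0" using \<kappa>(1) \<epsilon>(1) by (simp add: \<theta>_def)
  have N: "real N > 0" using block_pos by simp
  have bH: "bdd (\<theta> * real N / real N) (\<lambda>u. \<theta> * H u)"
    using bdd_mult[OF bdd_const[of \<theta>] H] \<theta> N by simp
  have small: "\<theta> * real N * (2 * K + 1) \<le> 1 / 16"
  proof -
    have "\<theta> * real N * (2 * K + 1) = \<epsilon> * (\<kappa> * (real N * (2 * K + 1)))"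
      by (simp add: \<theta>_def)
    also have "\<dots> \<le> 1 * (1 / 16)"
      using \<epsilon> \<kappa> K_ge_1 by (intro mult_mono) auto
    finally show ?thesis by simp
  qed
  have mgf: "(\<integral>\<omega>. exp (\<Sum>j=1..n. \<theta> * H (orbit F u j \<omega>)) \<partial>\<Omega>)
      \<le> 6 * W u * exp ((1 + 16 * K) * (\<theta> * real N)\<^sup>2 * real n)"
    using \<theta> N H_mean small by (intro mgf_bound[OF bH _ _ _ u]) auto
  have meas [measurable]: "(\<lambda>\<omega>. \<Sum>j=1..n. H (orbit F u j \<omega>)) \<in> borel_measurable \<Omega>"
    by (intro borel_measurable_sum orbit_meas_at[OF H u])
  have int: "integrable \<Omega> (\<lambda>\<omega>. exp (\<theta> * (\<Sum>j=1..n. H (orbit F u j \<omega>))))"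
  proof (intro noise.integrable_const_bound[of _ "exp (\<theta> * real n)"] AE_I2)
    show "norm (exp (\<theta> * (\<Sum>j=1..n. H (orbit F u j \<omega>)))) \<le> exp (\<theta> * real n)" if "\<omega> \<in> space \<Omega>" for \<omega>
      using orbit_sum_bound[OF H u that, of n] \<theta> by (simp add: abs_le_iff)
  qed (rule measurable_compose[OF borel_measurable_times[OF borel_measurable_const meas] borel_measurable_exp])
  have "{\<omega> \<in> space \<Omega>. (\<Sum>j=1..n. H (orbit F u j \<omega>)) / real n \<ge> \<epsilon>}
      = {\<omega> \<in> space \<Omega>. (\<Sum>j=1..n. H (orbit F u j \<omega>)) \<ge> real n * \<epsilon>}"
    using \<open>1 \<le> n\<close> by (auto simp: field_simps)
  also have "measure \<Omega> \<dots> \<le> exp (- \<theta> * (real n * \<epsilon>))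
      * (\<integral>\<omega>\<in>space \<Omega>. exp (\<theta> * (\<Sum>j=1..n. H (orbit F u j \<omega>))) \<partial>\<Omega>)"
    using \<theta> by (rule noise.P.Chernoff_ineq_ge)
      (unfold set_integrable_def, rule integrable_mult_indicator[OF sets.top int], rule sets.top)
  also have "(\<integral>\<omega>\<in>space \<Omega>. exp (\<theta> * (\<Sum>j=1..n. H (orbit F u j \<omega>))) \<partial>\<Omega>)
      = (\<integral>\<omega>. exp (\<Sum>j=1..n. \<theta> * H (orbit F u j \<omega>)) \<partial>\<Omega>)"
    by (subst set_integral_space[OF int]) (simp only: sum_distrib_left)
  also have "exp (- \<theta> * (real n * \<epsilon>)) * \<dots>
      \<le> exp (- \<theta> * (real n * \<epsilon>)) * (6 * W u * exp ((1 + 16 * K) * (\<theta> * real N)\<^sup>2 * real n))"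
    by (intro mult_left_mono mgf) auto
  also have "\<dots> = 6 * W u * exp (- \<theta> * (real n * \<epsilon>) + (1 + 16 * K) * (\<theta> * real N)\<^sup>2 * real n)"
    by (simp only: exp_add mult_ac)
  also have "\<dots> \<le> 6 * W u * exp (- (\<kappa> / 2) * real n * \<epsilon>\<^sup>2)"
  proof -
    have \<theta>_eq: "- \<theta> * (real n * \<epsilon>) = 2 * (- (\<kappa> / 2) * real n * \<epsilon>\<^sup>2)"
      by (simp add: \<theta>_def power2_eq_square)
    have "(1 + 16 * K) * (\<theta> * real N)\<^sup>2 * real n
        = (\<kappa> * (2 * (1 + 16 * K) * (real N)\<^sup>2)) * (\<kappa> / 2 * real n * \<epsilon>\<^sup>2)"
      by (simp add: \<theta>_def power2_eq_square)
    also have "\<dots> \<le> 1 * (\<kappa> / 2 * real n * \<epsilon>\<^sup>2)"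
      using \<kappa> by (intro mult_right_mono) auto
    finally have "- \<theta> * (real n * \<epsilon>) + (1 + 16 * K) * (\<theta> * real N)\<^sup>2 * real n \<le> - (\<kappa> / 2) * real n * \<epsilon>\<^sup>2"
      using \<theta>_eq by linarith
    then show ?thesis using weight_ge_1[OF u] by simp
  qed
  finally show ?thesis .
qed

text \<open>\<open>upper_tail\<close> is applied to (H - m) / (2 B) and its negative, both bounded
  by 1, with threshold \<epsilon> / (2 B). Squaring the 2 turns \<kappa>/2 into \<kappa>/8, and the
  two signs turn 6 into 12.\<close>

theorem concentration:
  assumes H: "H \<in> borel_measurable M" "\<And>u. u \<in> space M \<Longrightarrow> \<bar>H u\<bar> \<le> B"
    and u: "u \<in> space M" and n: "1 \<le> n" and \<epsilon>: "0 < \<epsilon>"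
    and \<kappa>: "\<kappa> > 0" "\<kappa> * (real N * (2 * K + 1)) \<le> 1 / 16" "\<kappa> * (2 * (1 + 16 * K) * (real N)\<^sup>2) \<le> 1"
  shows "measure \<Omega> {\<omega> \<in> space \<Omega>. \<bar>(\<Sum>j=1..n. H (orbit F u j \<omega>)) / real n - (\<integral>v. H v \<partial>\<nu>)\<bar> \<ge> \<epsilon>}
    \<le> 12 * W u * exp (- (\<kappa> / 8) * real n * (\<epsilon>\<^sup>2 / B\<^sup>2))"
proof (cases "B = 0")
  \<comment> \<open>Division by zero makes the exponent 0, so the right-hand side is at least
    12.\<close>
  case True
  have "measure \<Omega> {\<omega> \<in> space \<Omega>. \<bar>(\<Sum>j=1..n. H (orbit F u j \<omega>)) / real n - (\<integral>v. H v \<partial>\<nu>)\<bar> \<ge> \<epsilon>} \<le> 1"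
    by (rule noise.P.prob_le_1)
  also have "1 \<le> 12 * W u * exp (- (\<kappa> / 8) * real n * (\<epsilon>\<^sup>2 / B\<^sup>2))"
    using True weight_ge_1[OF u] by simp
  finally show ?thesis .
next
  case False
  have "B \<ge> 0" using H(2)[OF u] by linarith
  with False have B: "B > 0" by simp
  define m where "m = (\<integral>v. H v \<partial>\<nu>)"
  have bH: "bdd B H" using H by (simp add: bdd_def)
  have m_le: "\<bar>m\<bar> \<le> B"
  proof -
    have "\<bar>m\<bar> \<le> (\<integral>v. \<bar>H v\<bar> \<partial>\<nu>)" unfolding m_def by (rule integral_abs_bound)
    also have "\<dots> \<le> (\<integral>v. B \<partial>\<nu>)"
      using integrable_limit[OF bH] H(2) by (intro integral_mono) (auto simp: space_limit)
    finally show ?thesis by (simp add: \<nu>.prob_space)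
  qed
  define G where "G s v = s * (H v - m) / (2 * B)" for s v
  have G: "bdd 1 (G s)" "(\<integral>v. G s v \<partial>\<nu>) = 0" if "\<bar>s\<bar> = 1" for s
  proof -
    have "\<bar>G s v\<bar> \<le> 1" if "v \<in> space M" for v
    proof -
      have "\<bar>H v - m\<bar> \<le> 2 * B" using H(2)[OF that] m_le by linarith
      then show ?thesis using B \<open>\<bar>s\<bar> = 1\<close> by (simp add: G_def abs_mult)
    qed
    moreover have "G s \<in> borel_measurable M"
      unfolding G_def using H(1) by measurable
    ultimately show "bdd 1 (G s)" by (simp add: bdd_def)
    have "(\<integral>v. G s v \<partial>\<nu>) = s * (\<integral>v. H v - m \<partial>\<nu>) / (2 * B)"
      unfolding G_def by simp
    also have "(\<integral>v. H v - m \<partial>\<nu>) = 0"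
      using integrable_limit[OF bH] by (simp add: m_def \<nu>.prob_space)
    finally show "(\<integral>v. G s v \<partial>\<nu>) = 0" by simp
  qed
  define \<epsilon>' where "\<epsilon>' = \<epsilon> / (2 * B)"
  define A where "A s = {\<omega> \<in> space \<Omega>. (\<Sum>j=1..n. G s (orbit F u j \<omega>)) / real n \<ge> \<epsilon>'}" for s
  have mean_G: "(\<Sum>j=1..n. G s (orbit F u j \<omega>)) / real n
      = s * ((\<Sum>j=1..n. H (orbit F u j \<omega>)) / real n - m) / (2 * B)" for s \<omega>
  proof -
    have "(\<Sum>j=1..n. G s (orbit F u j \<omega>)) = s * (\<Sum>j=1..n. H (orbit F u j \<omega>) - m) / (2 * B)"
      unfolding G_def by (simp only: sum_divide_distrib[symmetric] sum_distrib_left[symmetric])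
    also have "(\<Sum>j=1..n. H (orbit F u j \<omega>) - m) = (\<Sum>j=1..n. H (orbit F u j \<omega>)) - real n * m"
      by (simp add: sum_subtractf)
    also have "s * \<dots> / (2 * B) / real n = s * (((\<Sum>j=1..n. H (orbit F u j \<omega>)) - real n * m) / real n) / (2 * B)"
      by simp
    also have "((\<Sum>j=1..n. H (orbit F u j \<omega>)) - real n * m) / real n = (\<Sum>j=1..n. H (orbit F u j \<omega>)) / real n - m"
      using n by (simp add: diff_divide_distrib)
    finally show ?thesis .
  qed
  have A_sets: "A s \<in> sets \<Omega>" if "\<bar>s\<bar> = 1" for s
  proof -
    have [measurable]: "(\<lambda>\<omega>. \<Sum>j=1..n. G s (orbit F u j \<omega>)) \<in> borel_measurable \<Omega>"
      by (intro borel_measurable_sum orbit_meas_at[OF G(1)[OF that] u])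
    show ?thesis unfolding A_def by measurable
  qed
  have A_bound: "measure \<Omega> (A s) \<le> 6 * W u * exp (- (\<kappa> / 2) * real n * \<epsilon>'\<^sup>2)" if s: "\<bar>s\<bar> = 1" for s
  proof (cases "\<epsilon>' \<le> 1")
    case True
    show ?thesis unfolding A_def
      by (rule upper_tail[OF G[OF s] u n \<kappa> _ True]) (use \<epsilon> B in \<open>simp add: \<epsilon>'_def\<close>)
  next
    \<comment> \<open>A mean of values in [-1, 1] cannot reach a threshold above 1.\<close>
    case False
    have "A s = {}"
    proof -
      have "(\<Sum>j=1..n. G s (orbit F u j \<omega>)) / real n \<le> 1" if "\<omega> \<in> space \<Omega>" for \<omega>
        using orbit_sum_bound[OF G(1)[OF s] u that, of n] n by (simp only: divide_le_eq) simp
      with False show ?thesis unfolding A_def by fastforce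
    qed
    then show ?thesis using weight_ge_1[OF u] by simp
  qed
  have "{\<omega> \<in> space \<Omega>. \<bar>(\<Sum>j=1..n. H (orbit F u j \<omega>)) / real n - m\<bar> \<ge> \<epsilon>} \<subseteq> A 1 \<union> A (- 1)"
  proof
    fix \<omega> assume "\<omega> \<in> {\<omega> \<in> space \<Omega>. \<bar>(\<Sum>j=1..n. H (orbit F u j \<omega>)) / real n - m\<bar> \<ge> \<epsilon>}"
    then have \<omega>: "\<omega> \<in> space \<Omega>"
      and dev: "\<bar>(\<Sum>j=1..n. H (orbit F u j \<omega>)) / real n - m\<bar> \<ge> \<epsilon>"
      by blast+
    from dev have "\<exists>s\<in>{1, - 1}. \<epsilon> \<le> s * ((\<Sum>j=1..n. H (orbit F u j \<omega>)) / real n - m)"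
      by (auto simp: abs_if split: if_splits)
    then obtain s where s: "s \<in> {1, - 1}" "\<epsilon> \<le> s * ((\<Sum>j=1..n. H (orbit F u j \<omega>)) / real n - m)"
      by blast
    have "\<epsilon>' \<le> s * ((\<Sum>j=1..n. H (orbit F u j \<omega>)) / real n - m) / (2 * B)"
      unfolding \<epsilon>'_def using B by (intro divide_right_mono s(2)) simp
    then have "\<omega> \<in> A s"
      unfolding A_def mean_G using \<omega> by blast
    then show "\<omega> \<in> A 1 \<union> A (- 1)"
      using s(1) by blast
  qed
  then have "measure \<Omega> {\<omega> \<in> space \<Omega>. \<bar>(\<Sum>j=1..n. H (orbit F u j \<omega>)) / real n - m\<bar> \<ge> \<epsilon>}
      \<le> measure \<Omega> (A 1 \<union> A (- 1))"
    using A_sets by (intro noise.P.finite_measure_mono) auto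
  also have "\<dots> \<le> measure \<Omega> (A 1) + measure \<Omega> (A (- 1))"
    using A_sets by (intro measure_Un_le) auto
  also have "\<dots> \<le> 2 * (6 * W u * exp (- (\<kappa> / 2) * real n * \<epsilon>'\<^sup>2))"
    using A_bound[of 1] A_bound[of "- 1"] by simp
  finally show ?thesis
    by (simp add: m_def \<epsilon>'_def power_divide power_mult_distrib)
qed

end

section \<open>Doeblin minorization\<close>

context random_map
begin

text \<open>\<open>koop\<close> on extended nonnegative functions: the minorization can then be
  computed by monotonicity and Tonelli for arbitrary measurable test functions.\<close>

definition nkoop :: "('a \<Rightarrow> ennreal) \<Rightarrow> 'a \<Rightarrow> ennreal" where
  "nkoop \<phi> u = (\<integral>\<^sup>+w. \<phi> (F w u) \<partial>\<mu>)"

lemma nkoop_cong: "u \<in> space M \<Longrightarrow> (\<And>v. v \<in> space M \<Longrightarrow> \<phi> v = \<psi> v) \<Longrightarrow> nkoop \<phi> u = nkoop \<psi> u"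
  unfolding nkoop_def by (intro nn_integral_cong) (auto intro: step_space)

lemma ennreal_koop_pow:
  assumes "bdd B \<phi>" "\<And>u. u \<in> space M \<Longrightarrow> 0 \<le> \<phi> u" "u \<in> space M"
  shows "ennreal ((koop ^^ n) \<phi> u) = (nkoop ^^ n) (\<lambda>v. ennreal (\<phi> v)) u \<and> 0 \<le> (koop ^^ n) \<phi> u"
  using assms(3)
proof (induction n arbitrary: u)
  case 0
  then show ?case using assms(2) by simp
next
  case (Suc n)
  have nonneg: "0 \<le> (koop ^^ n) \<phi> (F w u)" if "w \<in> space \<mu>" for w
    using Suc.IH[OF step_space[OF that Suc.prems]] by simp
  have "ennreal (koop ((koop ^^ n) \<phi>) u) = (\<integral>\<^sup>+w. ennreal ((koop ^^ n) \<phi> (F w u)) \<partial>\<mu>)"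
    unfolding koop_def[of "(koop ^^ n) \<phi>"]
    using integrable_step[OF bdd_koop_pow[OF assms(1)] Suc.prems] nonneg
    by (intro nn_integral_eq_integral[symmetric] AE_I2)
  also have "\<dots> = nkoop ((nkoop ^^ n) (\<lambda>v. ennreal (\<phi> v))) u"
    unfolding nkoop_def[of "(nkoop ^^ n) (\<lambda>v. ennreal (\<phi> v))"]
    using Suc.IH Suc.prems by (intro nn_integral_cong) (auto intro: step_space)
  finally have "ennreal ((koop ^^ Suc n) \<phi> u) = (nkoop ^^ Suc n) (\<lambda>v. ennreal (\<phi> v)) u"
    by simp
  moreover have "0 \<le> koop ((koop ^^ n) \<phi>) u"
    unfolding koop_def[of "(koop ^^ n) \<phi>"] using nonneg by (intro integral_nonneg_AE AE_I2)
  ultimately show ?case by simp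
qed

lemma koop_pow_affine:
  assumes "bdd B \<phi>" "u \<in> space M"
  shows "(koop ^^ n) (\<lambda>v. a + c * \<phi> v) u = a + c * (koop ^^ n) \<phi> u"
proof -
  have "bdd (\<bar>a\<bar> + \<bar>c\<bar> * B) (\<lambda>v. a + c * \<phi> v)"
    using bdd_add[OF bdd_const bdd_mult[OF bdd_const assms(1)]] .
  from koop_pow[OF this assms(2), of n] koop_pow[OF assms, of n] integrable_orbit[OF assms, of n]
  show ?thesis by (simp add: noise.P.prob_space)
qed

definition stationary :: "'a measure \<Rightarrow> bool" where
  "stationary \<nu> \<longleftrightarrow> prob_space \<nu> \<and> sets \<nu> = sets M \<and>
    (\<forall>A\<in>sets M. emeasure \<nu> A = (\<integral>\<^sup>+u. emeasure \<mu> {w \<in> space \<mu>. F w u \<in> A} \<partial>\<nu>))"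

text \<open>Stationarity on sets says that \<nu> is the image of the product of noise and \<nu>
  under one step; Fubini carries this over to functions.\<close>

lemma stationary_integral:
  assumes \<nu>: "stationary \<nu>" and \<phi>: "bdd B \<phi>"
  shows "(\<integral>u. koop \<phi> u \<partial>\<nu>) = (\<integral>u. \<phi> u \<partial>\<nu>)"
proof -
  have [measurable_cong]: "sets \<nu> = sets M" and "prob_space \<nu>"
    using \<nu> by (auto simp: stationary_def)
  interpret \<nu>: prob_space \<nu> by fact
  interpret P: pair_prob_space \<mu> \<nu> ..
  have sp: "space \<nu> = space M" by (rule sets_eq_imp_space_eq) fact
  have step: "(\<lambda>(w, u). F w u) \<in> \<mu> \<Otimes>\<^sub>M \<nu> \<rightarrow>\<^sub>M M"
    using measurable_step by (simp cong: measurable_cong_sets)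
  have "\<nu> = distr (\<mu> \<Otimes>\<^sub>M \<nu>) M (\<lambda>(w, u). F w u)"
  proof (rule measure_eqI)
    fix A assume "A \<in> sets \<nu>"
    then have A: "A \<in> sets M" by (simp add: \<open>sets \<nu> = sets M\<close>)
    have "emeasure (distr (\<mu> \<Otimes>\<^sub>M \<nu>) M (\<lambda>(w, u). F w u)) A
        = emeasure (\<mu> \<Otimes>\<^sub>M \<nu>) ((\<lambda>(w, u). F w u) -` A \<inter> space (\<mu> \<Otimes>\<^sub>M \<nu>))"
      using step A by (rule emeasure_distr)
    also have "\<dots> = (\<integral>\<^sup>+u. emeasure \<mu> ((\<lambda>w. (w, u)) -` ((\<lambda>(w, u). F w u) -` A \<inter> space (\<mu> \<Otimes>\<^sub>M \<nu>))) \<partial>\<nu>)"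
      using measurable_sets[OF step A] by (rule P.emeasure_pair_measure_alt2)
    also have "\<dots> = (\<integral>\<^sup>+u. emeasure \<mu> {w \<in> space \<mu>. F w u \<in> A} \<partial>\<nu>)"
      by (intro nn_integral_cong arg_cong[where f = "emeasure \<mu>"]) (auto simp: space_pair_measure)
    finally show "emeasure \<nu> A = emeasure (distr (\<mu> \<Otimes>\<^sub>M \<nu>) M (\<lambda>(w, u). F w u)) A"
      using \<nu> A by (simp add: stationary_def)
  qed (simp add: \<open>sets \<nu> = sets M\<close>)
  then have "(\<integral>u. \<phi> u \<partial>\<nu>) = (\<integral>u. \<phi> u \<partial>distr (\<mu> \<Otimes>\<^sub>M \<nu>) M (\<lambda>(w, u). F w u))"
    by simp
  also have "\<dots> = (\<integral>x. \<phi> ((\<lambda>(w, u). F w u) x) \<partial>(\<mu> \<Otimes>\<^sub>M \<nu>))"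
    using step bdd_measurable[OF \<phi>] by (rule integral_distr)
  also have "\<dots> = (\<integral>(w, u). \<phi> (F w u) \<partial>(\<mu> \<Otimes>\<^sub>M \<nu>))"
    by (simp add: case_prod_beta')
  also have "\<dots> = (\<integral>u. \<integral>w. \<phi> (F w u) \<partial>\<mu> \<partial>\<nu>)"
  proof (rule P.integral_snd[symmetric])
    have m: "(\<lambda>x. \<phi> ((\<lambda>(w, u). F w u) x)) \<in> borel_measurable (\<mu> \<Otimes>\<^sub>M \<nu>)"
      using step bdd_measurable[OF \<phi>] by (rule measurable_compose)
    show "integrable (\<mu> \<Otimes>\<^sub>M \<nu>) (\<lambda>(w, u). \<phi> (F w u))"
    proof (rule P.integrable_const_bound[of _ B])
      show "AE x in \<mu> \<Otimes>\<^sub>M \<nu>. norm (case x of (w, u) \<Rightarrow> \<phi> (F w u)) \<le> B"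
        by (intro AE_I2) (auto simp: space_pair_measure sp intro!: bddD[OF \<phi>] step_space)
    qed (use m in \<open>simp add: case_prod_beta'\<close>)
  qed
  finally show ?thesis by (simp add: koop_def)
qed

end

text \<open>\<open>R\<close> stands for integration against the minorizing measure. The argument
  uses it through additivity and its total mass \<eta>, so it is kept as a functional and never has
  to be shown to come from a measure.\<close>

locale doeblin = random_map \<mu> M F
  for \<mu> :: "'w measure" and M :: "'a measure" and F :: "'w \<Rightarrow> 'a \<Rightarrow> 'a" +
  fixes k :: nat and R :: "('a \<Rightarrow> ennreal) \<Rightarrow> ennreal" and \<eta> :: real
  assumes k_pos: "1 \<le> k" and eta: "0 < \<eta>" "\<eta> < 1" and nonempty: "space M \<noteq> {}"
    and minorization: "\<phi> \<in> borel_measurable M \<Longrightarrow> u \<in> space M \<Longrightarrow> R \<phi> \<le> (nkoop ^^ k) \<phi> u"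
    and R_add: "\<phi> \<in> borel_measurable M \<Longrightarrow> \<psi> \<in> borel_measurable M \<Longrightarrow> R (\<lambda>u. \<phi> u + \<psi> u) = R \<phi> + R \<psi>"
    and R_one: "R (\<lambda>_. 1) = ennreal \<eta>"
begin

text \<open>Minorize \<phi> at \<open>u'\<close> and 1 - \<phi> at \<open>u\<close>. When both
  bounds are added, the left sides combine to R 1 = \<eta>.\<close>

lemma overlap:
  assumes \<phi>: "bdd B \<phi>" "\<And>v. v \<in> space M \<Longrightarrow> 0 \<le> \<phi> v" "\<And>v. v \<in> space M \<Longrightarrow> \<phi> v \<le> 1"
    and u: "u \<in> space M" "u' \<in> space M"
  shows "(koop ^^ k) \<phi> u - (koop ^^ k) \<phi> u' \<le> 1 - \<eta>"
proof -
  have [measurable]: "\<phi> \<in> borel_measurable M" using \<phi>(1) by (rule bdd_measurable)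
  define \<psi> where "\<psi> = (\<lambda>v. 1 + (- 1) * \<phi> v)"
  have \<psi>: "bdd (\<bar>1\<bar> + \<bar>-1\<bar> * B) \<psi>"
    unfolding \<psi>_def by (intro bdd_add bdd_mult bdd_const \<phi>(1))
  have \<psi>_nonneg: "0 \<le> \<psi> v" if "v \<in> space M" for v
    using \<phi>(3)[OF that] by (simp add: \<psi>_def)
  \<comment> \<open>Clamping makes \<phi>' and \<psi>' sum to 1 on the whole type and not just on
    the space, as \<open>R_one\<close> requires.\<close>
  define g where "g v = min 1 (max 0 (\<phi> v))" for v
  have g: "g v = \<phi> v" if "v \<in> space M" for v
    using \<phi>(2,3)[OF that] by (simp add: g_def)
  define \<phi>' \<psi>' where "\<phi>' v = ennreal (g v)" and "\<psi>' v = ennreal (1 - g v)" for v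
  have [measurable]: "\<phi>' \<in> borel_measurable M" "\<psi>' \<in> borel_measurable M"
    unfolding \<phi>'_def[abs_def] \<psi>'_def[abs_def] g_def by measurable
  have pow_cong: "(nkoop ^^ n) \<alpha> v = (nkoop ^^ n) \<beta> v" if "v \<in> space M" "\<And>v. v \<in> space M \<Longrightarrow> \<alpha> v = \<beta> v" for n v \<alpha> \<beta>
    using that by (induction n arbitrary: v) (auto intro: nkoop_cong)
  have "R \<phi>' \<le> (nkoop ^^ k) \<phi>' u'"
    using u by (intro minorization) auto
  also have "\<dots> = (nkoop ^^ k) (\<lambda>v. ennreal (\<phi> v)) u'"
    using u by (intro pow_cong) (auto simp: \<phi>'_def g)
  also have "\<dots> = ennreal ((koop ^^ k) \<phi> u')"
    using ennreal_koop_pow[OF \<phi>(1,2) u(2)] by simp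
  finally have 1: "R \<phi>' \<le> ennreal ((koop ^^ k) \<phi> u')" .
  have "R \<psi>' \<le> (nkoop ^^ k) \<psi>' u"
    using u by (intro minorization) auto
  also have "\<dots> = (nkoop ^^ k) (\<lambda>v. ennreal (\<psi> v)) u"
    using u by (intro pow_cong) (auto simp: \<psi>'_def \<psi>_def g)
  also have "\<dots> = ennreal ((koop ^^ k) \<psi> u)"
    using ennreal_koop_pow[OF \<psi> \<psi>_nonneg u(1)] by simp
  also have "(koop ^^ k) \<psi> u = 1 - (koop ^^ k) \<phi> u"
    unfolding \<psi>_def koop_pow_affine[OF \<phi>(1) u(1)] by simp
  finally have 2: "R \<psi>' \<le> ennreal (1 - (koop ^^ k) \<phi> u)" .
  have nn: "0 \<le> (koop ^^ k) \<phi> u'" "0 \<le> 1 - (koop ^^ k) \<phi> u"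
    using ennreal_koop_pow[OF \<phi>(1,2) u(2), of k] ennreal_koop_pow[OF \<psi> \<psi>_nonneg u(1), of k]
    unfolding \<psi>_def koop_pow_affine[OF \<phi>(1) u(1)] by simp_all
  have "\<phi>' v + \<psi>' v = 1" for v
    by (simp add: \<phi>'_def \<psi>'_def g_def ennreal_plus[symmetric] del: ennreal_plus)
  then have "ennreal \<eta> = R \<phi>' + R \<psi>'"
    using R_add[of \<phi>' \<psi>'] R_one by simp
  also have "\<dots> \<le> ennreal ((koop ^^ k) \<phi> u') + ennreal (1 - (koop ^^ k) \<phi> u)"
    using 1 2 by (rule add_mono)
  finally have "\<eta> \<le> (koop ^^ k) \<phi> u' + (1 - (koop ^^ k) \<phi> u)"
    using nn by (simp add: ennreal_plus[symmetric] del: ennreal_plus)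
  then show ?thesis by simp
qed

section \<open>Decay of oscillations under the Markov operator\<close>

definition osc :: "real \<Rightarrow> ('a \<Rightarrow> real) \<Rightarrow> bool" where
  "osc D \<phi> \<longleftrightarrow> (\<forall>u\<in>space M. \<forall>u'\<in>space M. \<phi> u - \<phi> u' \<le> D)"

text \<open>An affine map carries the range of \<phi> into [0, 1], where \<open>overlap\<close>
  applies.\<close>

lemma osc_koop_block:
  assumes \<phi>: "bdd B \<phi>" and osc: "osc D \<phi>" and D: "0 < D"
  shows "osc ((1 - \<eta>) * D) ((koop ^^ k) \<phi>)"
  unfolding osc_def
proof (intro ballI)
  fix u u' assume u: "u \<in> space M" "u' \<in> space M"
  define a where "a = (INF v\<in>space M. \<phi> v)"
  have below: "bdd_below (\<phi> ` space M)"
  proof (rule bdd_belowI2[of _ "- B"])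
    show "- B \<le> \<phi> v" if "v \<in> space M" for v
      using bddD[OF \<phi> that] by linarith
  qed
  have lower: "a \<le> \<phi> v" if "v \<in> space M" for v
    unfolding a_def using below that by (rule cINF_lower)
  have upper: "\<phi> v \<le> a + D" if "v \<in> space M" for v
  proof -
    have "\<phi> v - D \<le> a"
      unfolding a_def
    proof (rule cINF_greatest[OF nonempty])
      fix v' assume "v' \<in> space M"
      with osc that have "\<phi> v - \<phi> v' \<le> D" by (auto simp: osc_def)
      then show "\<phi> v - D \<le> \<phi> v'" by simp
    qed
    then show ?thesis by simp
  qed
  define p where "p = (\<lambda>v. - a / D + (1 / D) * \<phi> v)"
  have p: "bdd (\<bar>- a / D\<bar> + \<bar>1 / D\<bar> * B) p"
    unfolding p_def by (intro bdd_add bdd_mult bdd_const \<phi>)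
  have "(koop ^^ k) p u - (koop ^^ k) p u' \<le> 1 - \<eta>"
  proof (rule overlap[OF p _ _ u])
    show "0 \<le> p v" "p v \<le> 1" if "v \<in> space M" for v
      using lower[OF that] upper[OF that] D by (auto simp: p_def field_simps)
  qed
  then have "1 / D * ((koop ^^ k) \<phi> u - (koop ^^ k) \<phi> u') \<le> 1 - \<eta>"
    unfolding p_def koop_pow_affine[OF \<phi> u(1)] koop_pow_affine[OF \<phi> u(2)] by (simp add: diff_divide_distrib)
  then show "(koop ^^ k) \<phi> u - (koop ^^ k) \<phi> u' \<le> (1 - \<eta>) * D"
    using D by (simp add: field_simps)
qed

lemma average_le:
  assumes \<phi>: "bdd B \<phi>" and u: "u \<in> space M" and le: "\<And>v. v \<in> space M \<Longrightarrow> \<phi> v \<le> c"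
  shows "(koop ^^ n) \<phi> u \<le> c"
proof -
  have "(koop ^^ n) \<phi> u \<le> (\<integral>\<omega>. c \<partial>\<Omega>)"
    unfolding koop_pow[OF \<phi> u]
    by (intro integral_mono integrable_orbit[OF \<phi> u]) (auto intro: le orbit_space u)
  then show ?thesis by (simp add: noise.P.prob_space)
qed

lemma average_ge:
  assumes \<phi>: "bdd B \<phi>" and u: "u \<in> space M" and le: "\<And>v. v \<in> space M \<Longrightarrow> c \<le> \<phi> v"
  shows "c \<le> (koop ^^ n) \<phi> u"
proof -
  have "(\<integral>\<omega>. c \<partial>\<Omega>) \<le> (koop ^^ n) \<phi> u"
    unfolding koop_pow[OF \<phi> u]
    by (intro integral_mono integrable_orbit[OF \<phi> u]) (auto intro: le orbit_space u)
  then show ?thesis by (simp add: noise.P.prob_space)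
qed

lemma osc_koop:
  assumes \<phi>: "bdd B \<phi>" and osc: "osc D \<phi>"
  shows "osc D ((koop ^^ n) \<phi>)"
  unfolding osc_def
proof (intro ballI)
  fix u u' assume u: "u \<in> space M" "u' \<in> space M"
  have "(koop ^^ n) \<phi> u \<le> D + \<phi> v" if "v \<in> space M" for v
    using osc that by (intro average_le[OF \<phi> u(1)]) (auto simp: osc_def algebra_simps)
  then have "(koop ^^ n) \<phi> u - D \<le> (koop ^^ n) \<phi> u'"
    by (intro average_ge[OF \<phi> u(2)]) (simp add: algebra_simps)
  then show "(koop ^^ n) \<phi> u - (koop ^^ n) \<phi> u' \<le> D" by simp
qed

definition rate :: "nat \<Rightarrow> real" where
  "rate n = (1 - \<eta>) ^ (n div k)"

lemma rate_pos: "0 < rate n"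
  using eta by (simp add: rate_def)

lemma rate_tendsto: "rate \<longlonglongrightarrow> 0"
proof -
  have "filterlim (\<lambda>n. n div k) at_top sequentially"
    unfolding filterlim_at_top
  proof
    fix Z show "\<forall>\<^sub>F n in sequentially. Z \<le> n div k"
      using eventually_ge_at_top[of "Z * k"]
      by eventually_elim (use k_pos in \<open>simp add: less_eq_div_iff_mult_less_eq\<close>)
  qed
  moreover have "(\<lambda>n. (1 - \<eta>) ^ n) \<longlonglongrightarrow> 0"
    using eta by (intro LIMSEQ_power_zero) auto
  ultimately show ?thesis
    unfolding rate_def[abs_def] by (rule filterlim_compose[rotated])
qed

text \<open>Only complete blocks of \<open>k\<close> steps contract; the remaining steps average and
  so never increase the oscillation.\<close>

lemma osc_rate:
  assumes \<phi>: "bdd B \<phi>" and osc: "osc 1 \<phi>"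
  shows "osc (rate n) ((koop ^^ n) \<phi>)"
proof -
  have "osc ((1 - \<eta>) ^ j) ((koop ^^ (k * j)) \<phi>)" for j
  proof (induction j)
    case (Suc j)
    have "osc ((1 - \<eta>) * (1 - \<eta>) ^ j) ((koop ^^ k) ((koop ^^ (k * j)) \<phi>))"
      using eta by (intro osc_koop_block[OF bdd_koop_pow[OF \<phi>] Suc]) simp
    then show ?case by (simp add: funpow_add)
  qed (simp add: osc)
  from osc_koop[OF bdd_koop_pow[OF \<phi>] this, of "n div k" "n mod k"]
  have "osc (rate n) ((koop ^^ (n mod k)) ((koop ^^ (k * (n div k))) \<phi>))"
    by (simp add: rate_def)
  then show ?thesis
    by (metis comp_apply funpow_add mod_mult_div_eq)
qed

text \<open>The later iterate at \<open>u\<close> averages values of the \<open>n\<close>-th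
  iterate, and these differ by at most \<open>rate n\<close>. The bound is uniform in
  \<open>i\<close> and in the starting points.\<close>

lemma koop_pow_later:
  assumes \<phi>: "bdd B \<phi>" and osc: "osc 1 \<phi>" and u: "u \<in> space M" "u' \<in> space M"
  shows "\<bar>(koop ^^ (i + n)) \<phi> u - (koop ^^ n) \<phi> u'\<bar> \<le> rate n"
proof -
  have b: "bdd B ((koop ^^ n) \<phi>)" by (rule bdd_koop_pow[OF \<phi>])
  have o: "(koop ^^ n) \<phi> v \<le> (koop ^^ n) \<phi> u' + rate n" "(koop ^^ n) \<phi> u' - rate n \<le> (koop ^^ n) \<phi> v"
    if "v \<in> space M" for v
    using osc_rate[OF \<phi> osc, of n] that u(2) by (auto simp: osc_def algebra_simps)
  have "(koop ^^ i) ((koop ^^ n) \<phi>) u \<le> (koop ^^ n) \<phi> u' + rate n"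
    by (rule average_le[OF b u(1) o(1)])
  moreover have "(koop ^^ n) \<phi> u' - rate n \<le> (koop ^^ i) ((koop ^^ n) \<phi>) u"
    by (rule average_ge[OF b u(1) o(2)])
  ultimately show ?thesis by (simp add: funpow_add abs_le_iff)
qed

lemma bdd_indicator: "A \<in> sets M \<Longrightarrow> bdd 1 (indicator A)"
  by (auto simp: bdd_def indicator_def)

lemma osc_indicator: "osc 1 (indicator A)"
  by (auto simp: osc_def indicator_def)

section \<open>The stationary measure as a setwise limit of laws\<close>

definition law :: "'a \<Rightarrow> nat \<Rightarrow> 'a measure" where
  "law u n = distr \<Omega> M (orbit F u n)"

lemma orbit_at_measurable: "u \<in> space M \<Longrightarrow> orbit F u n \<in> \<Omega> \<rightarrow>\<^sub>M M"
  using orbit_measurable[of "\<lambda>_. u" \<Omega> "\<lambda>\<omega>. \<omega>" n] by simp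

lemma prob_law: "u \<in> space M \<Longrightarrow> prob_space (law u n)"
  unfolding law_def by (intro noise.P.prob_space_distr orbit_at_measurable)

lemma sets_law [simp]: "sets (law u n) = sets M"
  by (simp add: law_def)

lemma integral_law: "bdd B \<phi> \<Longrightarrow> u \<in> space M \<Longrightarrow> (\<integral>v. \<phi> v \<partial>law u n) = (koop ^^ n) \<phi> u"
  unfolding law_def
  by (subst integral_distr) (auto intro: orbit_at_measurable bdd_measurable simp: koop_pow)

lemma measure_law: "A \<in> sets M \<Longrightarrow> u \<in> space M \<Longrightarrow> measure (law u n) A = (koop ^^ n) (indicator A) u"
  using integral_law[OF bdd_indicator, of A u n] sets.sets_into_space[of A M]
    sets_eq_imp_space_eq[OF sets_law, of u n]
  by (simp add: Int_absorb2)

definition base :: 'a where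
  "base = (SOME u. u \<in> space M)"

lemma base: "base \<in> space M"
  unfolding base_def using nonempty by (simp add: some_in_eq)

text \<open>Convergence that is uniform in the set and in the starting point replaces compactness:
  the stationary measure is found set by set, along the orbit of one fixed start.\<close>

definition limit_value :: "'a set \<Rightarrow> real" where
  "limit_value A = lim (\<lambda>n. (koop ^^ n) (indicator A) base)"

lemma limit_value_tendsto:
  assumes A: "A \<in> sets M"
  shows "(\<lambda>n. (koop ^^ n) (indicator A) base) \<longlonglongrightarrow> limit_value A"
proof -
  let ?c = "\<lambda>n. (koop ^^ n) (indicator A) base"
  have le: "\<bar>?c m - ?c n\<bar> \<le> rate n" if "n \<le> m" for m n
    using koop_pow_later[OF bdd_indicator[OF A] osc_indicator base base, of "m - n" n] that by simp
  have "Cauchy ?c"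
  proof (rule CauchyI)
    fix e :: real assume e: "0 < e"
    then obtain n where n: "rate n < e / 2"
      using order_tendstoD(2)[OF rate_tendsto, of "e / 2"] by (auto dest: eventually_happens)
    have "norm (?c m - ?c m') < e" if "m \<ge> n" "m' \<ge> n" for m m'
      using le[OF that(1)] le[OF that(2)] n unfolding real_norm_def by linarith
    then show "\<exists>n. \<forall>m\<ge>n. \<forall>m'\<ge>n. norm (?c m - ?c m') < e" by blast
  qed
  then show ?thesis
    unfolding limit_value_def by (simp add: Cauchy_convergent_iff convergent_LIMSEQ_iff)
qed

lemma limit_value_bound:
  assumes A: "A \<in> sets M" and u: "u \<in> space M"
  shows "\<bar>measure (law u n) A - limit_value A\<bar> \<le> rate n"
proof -
  have "(\<lambda>i. \<bar>(koop ^^ (i + n)) (indicator A) base - (koop ^^ n) (indicator A) u\<bar>)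
      \<longlonglongrightarrow> \<bar>limit_value A - (koop ^^ n) (indicator A) u\<bar>"
    by (intro tendsto_intros LIMSEQ_ignore_initial_segment limit_value_tendsto A)
  then have "\<bar>limit_value A - (koop ^^ n) (indicator A) u\<bar> \<le> rate n"
    by (rule LIMSEQ_le_const2)
      (use koop_pow_later[OF bdd_indicator[OF A] osc_indicator base u] in blast)
  then show ?thesis by (simp add: measure_law[OF A u])
qed

lemma limit_value_nonneg: "A \<in> sets M \<Longrightarrow> 0 \<le> limit_value A"
  using limit_value_tendsto[of A] by (rule LIMSEQ_le_const) (auto simp: measure_law[OF _ base, symmetric])

definition limit_measure :: "'a measure" where
  "limit_measure = measure_of (space M) (sets M) (\<lambda>A. ennreal (limit_value A))"

lemma sets_limit_measure [simp]: "sets limit_measure = sets M"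
  by (simp add: limit_measure_def)

lemma limit_value_additive:
  assumes "A \<in> sets M" "B \<in> sets M" "A \<inter> B = {}"
  shows "limit_value (A \<union> B) = limit_value A + limit_value B"
proof (rule LIMSEQ_unique)
  show "(\<lambda>n. (koop ^^ n) (indicator (A \<union> B)) base) \<longlonglongrightarrow> limit_value (A \<union> B)"
    using assms by (intro limit_value_tendsto) auto
  have "(koop ^^ n) (indicator (A \<union> B)) base = (koop ^^ n) (indicator A) base + (koop ^^ n) (indicator B) base" for n
  proof -
    interpret base: prob_space "law base n" by (rule prob_law[OF base])
    show ?thesis
      using base.finite_measure_Union[of A B] assms by (simp add: measure_law[OF _ base, symmetric])
  qed
  then show "(\<lambda>n. (koop ^^ n) (indicator (A \<union> B)) base) \<longlonglongrightarrow> limit_value A + limit_value B"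
    using tendsto_add[OF limit_value_tendsto limit_value_tendsto] assms by simp
qed

text \<open>Countable additivity reduces to continuity at the empty set. Since the laws converge
  uniformly over all sets, one \<open>n\<close> can be fixed first, and continuity of that single
  law does the rest.\<close>

lemma emeasure_limit_measure:
  assumes "A \<in> sets M"
  shows "emeasure limit_measure A = ennreal (limit_value A)"
  unfolding limit_measure_def
proof (rule emeasure_measure_of_sigma)
  have "limit_value {} = 0"
    using limit_value_additive[of "{}" "{}"] by simp
  then show pos: "positive (sets M) (\<lambda>A. ennreal (limit_value A))"
    by (simp add: positive_def)
  show "countably_additive (sets M) (\<lambda>A. ennreal (limit_value A))"
  proof (rule sets.empty_continuous_imp_countably_additive[OF pos])
    show "additive (sets M) (\<lambda>A. ennreal (limit_value A))"
      by (auto simp: additive_def limit_value_additive limit_value_nonneg)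
    show "\<forall>A\<in>sets M. ennreal (limit_value A) \<noteq> \<infinity>" by simp
    fix A :: "nat \<Rightarrow> 'a set"
    assume A: "range A \<subseteq> sets M" "decseq A" "(\<Inter>i. A i) = {}"
    have "(\<lambda>i. limit_value (A i)) \<longlonglongrightarrow> 0"
    proof (rule LIMSEQ_I)
      fix e :: real assume e: "0 < e"
      then obtain n where n: "rate n < e / 2"
        using order_tendstoD(2)[OF rate_tendsto, of "e / 2"] by (auto dest: eventually_happens)
      interpret base: prob_space "law base n" by (rule prob_law[OF base])
      have "(\<lambda>i. measure (law base n) (A i)) \<longlonglongrightarrow> measure (law base n) (\<Inter>i. A i)"
        using A by (intro base.finite_Lim_measure_decseq) auto
      then have "(\<lambda>i. measure (law base n) (A i)) \<longlonglongrightarrow> 0"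
        by (simp add: A(3))
      then have "\<forall>\<^sub>F i in sequentially. measure (law base n) (A i) < e / 2"
        using e by (intro order_tendstoD(2)) auto
      then obtain i\<^sub>0 where i\<^sub>0: "\<And>i. i \<ge> i\<^sub>0 \<Longrightarrow> measure (law base n) (A i) < e / 2"
        by (auto simp: eventually_sequentially)
      have "norm (limit_value (A i) - 0) < e" if "i \<ge> i\<^sub>0" for i
      proof -
        have "A i \<in> sets M" using A(1) by auto
        from limit_value_bound[OF this base, of n] limit_value_nonneg[OF this] i\<^sub>0[OF that] n
        show ?thesis by simp
      qed
      then show "\<exists>i\<^sub>0. \<forall>i\<ge>i\<^sub>0. norm (limit_value (A i) - 0) < e" by blast
    qed
    then show "(\<lambda>i. ennreal (limit_value (A i))) \<longlonglongrightarrow> 0"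
      using tendsto_ennrealI by fastforce
  qed
qed (use assms in \<open>simp_all add: sets.sigma_algebra_axioms\<close>)

lemma prob_limit_measure: "prob_space limit_measure"
proof
  have "(\<lambda>n. (koop ^^ n) (indicator (space M)) base) \<longlonglongrightarrow> 1"
  proof -
    have "(koop ^^ n) (indicator (space M)) base = 1" for n
      using prob_space.prob_space[OF prob_law[OF base, of n]]
      by (simp add: measure_law[OF _ base, symmetric] sets_eq_imp_space_eq[OF sets_law])
    then show ?thesis by simp
  qed
  then have "limit_value (space M) = 1"
    using LIMSEQ_unique limit_value_tendsto[of "space M"] by blast
  moreover have "space limit_measure = space M" by (rule sets_eq_imp_space_eq) simp
  ultimately show "emeasure limit_measure (space limit_measure) = 1"
    by (simp add: emeasure_limit_measure)
qed

text \<open>The layer cake formula turns a uniform bound over sets into one over \<open>[0,1]\<close>-valued functions.\<close>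

lemma layer_cake_le:
  assumes \<nu>: "prob_space \<nu>" "sets \<nu> = sets M" and \<nu>': "prob_space \<nu>'" "sets \<nu>' = sets M"
    and le: "\<And>A. A \<in> sets M \<Longrightarrow> measure \<nu> A \<le> measure \<nu>' A + r" and "0 \<le> r"
    and p: "p \<in> borel_measurable M" "\<And>v. v \<in> space M \<Longrightarrow> 0 \<le> p v" "\<And>v. v \<in> space M \<Longrightarrow> p v \<le> (1::real)"
  shows "(\<integral>v. p v \<partial>\<nu>) \<le> (\<integral>v. p v \<partial>\<nu>') + r"
proof -
  \<comment> \<open>Both integrals are written over the same levels in [0, 1], so a bound on
    superlevel sets is integrated over a set of measure one and costs exactly
    \<open>r\<close>.\<close>
  have layers: "ennreal (\<integral>v. p v \<partial>\<kappa>) = (\<integral>\<^sup>+t. emeasure \<kappa> {v \<in> space M. t < p v} * indicator {0..1} t \<partial>lborel)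
      \<and> (\<lambda>t. emeasure \<kappa> {v \<in> space M. t < p v}) \<in> borel_measurable borel"
    if \<kappa>: "prob_space \<kappa>" "sets \<kappa> = sets M" for \<kappa>
  proof -
    interpret \<kappa>: prob_space \<kappa> by fact
    interpret P: pair_sigma_finite lborel \<kappa> ..
    have [measurable_cong]: "sets \<kappa> = sets M" by fact
    have sp: "space \<kappa> = space M" by (rule sets_eq_imp_space_eq) fact
    have [measurable]: "p \<in> borel_measurable \<kappa>"
      using p(1) \<kappa>(2) by (simp cong: measurable_cong_sets)
    have em: "emeasure \<kappa> {v \<in> space M. t < p v} = (\<integral>\<^sup>+v. indicator {t<..} (p v) \<partial>\<kappa>)" for t
    proof -
      have "(\<integral>\<^sup>+v. indicator {t<..} (p v) \<partial>\<kappa>) = (\<integral>\<^sup>+v. indicator {v \<in> space \<kappa>. t < p v} v \<partial>\<kappa>)"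
        by (intro nn_integral_cong) (simp add: indicator_def)
      also have "\<dots> = emeasure \<kappa> {v \<in> space \<kappa>. t < p v}"
        by (rule nn_integral_indicator) measurable
      finally show ?thesis by (simp add: sp)
    qed
    have int: "integrable \<kappa> p"
      using p by (intro \<kappa>.integrable_const_bound[of _ 1] AE_I2) (auto simp: sp)
    have "ennreal (\<integral>v. p v \<partial>\<kappa>) = (\<integral>\<^sup>+v. ennreal (p v) \<partial>\<kappa>)"
      using int p(2) by (intro nn_integral_eq_integral[symmetric] AE_I2) (auto simp: sp)
    also have "\<dots> = (\<integral>\<^sup>+v. \<integral>\<^sup>+t. indicator {t<..} (p v) * indicator {0..1} t \<partial>lborel \<partial>\<kappa>)"
    proof (intro nn_integral_cong)
      fix v assume "v \<in> space \<kappa>"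
      then have "0 \<le> p v" "p v \<le> 1" using p by (auto simp: sp)
      then have "(\<integral>\<^sup>+t. indicator {t<..} (p v) * indicator {0..1} t \<partial>lborel) = (\<integral>\<^sup>+t. indicator {0..<p v} t \<partial>lborel)"
        by (intro nn_integral_cong) (auto simp: indicator_def)
      then show "ennreal (p v) = (\<integral>\<^sup>+t. indicator {t<..} (p v) * indicator {0..1} t \<partial>lborel)"
        using \<open>0 \<le> p v\<close> by simp
    qed
    also have "\<dots> = (\<integral>\<^sup>+t. \<integral>\<^sup>+v. indicator {t<..} (p v) * indicator {0..1} t \<partial>\<kappa> \<partial>lborel)"
      by (rule P.Fubini') (unfold indicator_def greaterThan_iff, measurable)
    also have "\<dots> = (\<integral>\<^sup>+t. emeasure \<kappa> {v \<in> space M. t < p v} * indicator {0..1} t \<partial>lborel)"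
      unfolding em by (intro nn_integral_cong nn_integral_multc) measurable
    finally have 1: "ennreal (\<integral>v. p v \<partial>\<kappa>) = (\<integral>\<^sup>+t. emeasure \<kappa> {v \<in> space M. t < p v} * indicator {0..1} t \<partial>lborel)" .
    have "(\<lambda>t. \<integral>\<^sup>+v. indicator {t<..} (p v) \<partial>\<kappa>) \<in> borel_measurable borel"
      unfolding indicator_def greaterThan_iff by measurable
    with 1 show ?thesis unfolding em by simp
  qed
  interpret \<nu>: prob_space \<nu> by fact
  interpret \<nu>': prob_space \<nu>' by fact
  have [measurable]: "(\<lambda>t. emeasure \<nu>' {v \<in> space M. t < p v}) \<in> borel_measurable borel"
    using layers[OF \<nu>'] by simp
  have pn: "0 \<le> (\<integral>v. p v \<partial>\<nu>')"
    using p(2) sets_eq_imp_space_eq[OF \<nu>'(2)] by (intro integral_nonneg_AE AE_I2) simp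
  have "ennreal (\<integral>v. p v \<partial>\<nu>) = (\<integral>\<^sup>+t. emeasure \<nu> {v \<in> space M. t < p v} * indicator {0..1} t \<partial>lborel)"
    using layers[OF \<nu>] by simp
  also have "\<dots> \<le> (\<integral>\<^sup>+t. emeasure \<nu>' {v \<in> space M. t < p v} * indicator {0..1} t + ennreal r * indicator {0..1} t \<partial>lborel)"
  proof (intro nn_integral_mono)
    fix t :: real
    have A: "{v \<in> space M. t < p v} \<in> sets M" using p(1) by measurable
    have "emeasure \<nu> {v \<in> space M. t < p v} \<le> emeasure \<nu>' {v \<in> space M. t < p v} + ennreal r"
      using le[OF A] \<open>0 \<le> r\<close>
      by (simp add: \<nu>.emeasure_eq_measure \<nu>'.emeasure_eq_measure ennreal_plus[symmetric] del: ennreal_plus)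
    then show "emeasure \<nu> {v \<in> space M. t < p v} * indicator {0..1} t
        \<le> emeasure \<nu>' {v \<in> space M. t < p v} * indicator {0..1} t + ennreal r * indicator {0..1} t"
      by (simp add: indicator_def)
  qed
  also have "\<dots> = ennreal (\<integral>v. p v \<partial>\<nu>') + ennreal r"
    using layers[OF \<nu>'] by (subst nn_integral_add) (auto simp: nn_integral_cmult)
  finally have "ennreal (\<integral>v. p v \<partial>\<nu>) \<le> ennreal ((\<integral>v. p v \<partial>\<nu>') + r)"
    using pn \<open>0 \<le> r\<close> by simp
  then show ?thesis
    using pn \<open>0 \<le> r\<close> by (subst (asm) ennreal_le_iff) auto
qed

text \<open>1/2 + \<phi> / (2 B) has values in [0, 1], so the layer cake bound applies in both
  directions; undoing the scaling costs the factor 2 B.\<close>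

lemma limit_measure_bound:
  assumes \<phi>: "bdd B \<phi>" and B: "0 < B" and u: "u \<in> space M"
  shows "\<bar>(koop ^^ n) \<phi> u - (\<integral>v. \<phi> v \<partial>limit_measure)\<bar> \<le> 2 * B * rate n"
proof -
  interpret lim: prob_space limit_measure by (rule prob_limit_measure)
  interpret law: prob_space "law u n" by (rule prob_law[OF u])
  define p where "p = (\<lambda>v. 1 / 2 + 1 / (2 * B) * \<phi> v)"
  have p: "0 \<le> p v" "p v \<le> 1" if "v \<in> space M" for v
    using bddD[OF \<phi> that] B by (auto simp: p_def field_simps abs_le_iff)
  have pm: "p \<in> borel_measurable M"
    unfolding p_def using bdd_measurable[OF \<phi>] by measurable
  have bp: "bdd 1 p" using p pm by (auto simp: bdd_def)
  have close: "\<bar>measure (law u n) A - measure limit_measure A\<bar> \<le> rate n" if "A \<in> sets M" for A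
    using limit_value_bound[OF that u, of n] emeasure_limit_measure[OF that] limit_value_nonneg[OF that]
    by (simp add: measure_def)
  have le1: "measure (law u n) A \<le> measure limit_measure A + rate n"
    and le2: "measure limit_measure A \<le> measure (law u n) A + rate n" if "A \<in> sets M" for A
    using close[OF that] by linarith+
  have "(\<integral>v. p v \<partial>law u n) \<le> (\<integral>v. p v \<partial>limit_measure) + rate n"
    by (rule layer_cake_le[OF prob_law[OF u] sets_law prob_limit_measure sets_limit_measure le1 _ pm p])
      (use rate_pos in \<open>auto intro: less_imp_le\<close>)
  moreover have "(\<integral>v. p v \<partial>limit_measure) \<le> (\<integral>v. p v \<partial>law u n) + rate n"
    by (rule layer_cake_le[OF prob_limit_measure sets_limit_measure prob_law[OF u] sets_law le2 _ pm p])
      (use rate_pos in \<open>auto intro: less_imp_le\<close>)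
  ultimately have "\<bar>(koop ^^ n) p u - (\<integral>v. p v \<partial>limit_measure)\<bar> \<le> rate n"
    unfolding integral_law[OF bp u] by linarith
  moreover have "(koop ^^ n) p u = 1 / 2 + 1 / (2 * B) * (koop ^^ n) \<phi> u"
    unfolding p_def by (rule koop_pow_affine[OF \<phi> u])
  moreover have "(\<integral>v. p v \<partial>limit_measure) = 1 / 2 + 1 / (2 * B) * (\<integral>v. \<phi> v \<partial>limit_measure)"
  proof -
    have "integrable limit_measure \<phi>"
      using \<phi> sets_eq_imp_space_eq[OF sets_limit_measure]
      by (intro lim.integrable_const_bound[of _ B] AE_I2) (auto simp: bdd_def cong: measurable_cong_sets)
    then show ?thesis by (simp add: p_def lim.prob_space)
  qed
  ultimately have "\<bar>1 / (2 * B) * ((koop ^^ n) \<phi> u - (\<integral>v. \<phi> v \<partial>limit_measure))\<bar> \<le> rate n"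
    by (simp add: algebra_simps)
  then show ?thesis
    using B by (simp add: abs_mult field_simps)
qed

text \<open>Iterates of the one-step probability of \<open>A\<close> tend to the limit value of
  \<open>A\<close>, by an index shift, and also to the integral of that probability, by
  \<open>limit_measure_bound\<close>.\<close>

lemma stationary_limit_measure: "stationary limit_measure"
  unfolding stationary_def
proof (intro conjI ballI)
  interpret lim: prob_space limit_measure by (rule prob_limit_measure)
  have sp: "space limit_measure = space M" by (rule sets_eq_imp_space_eq) simp
  fix A assume A: "A \<in> sets M"
  have [measurable]: "A \<in> sets M" by (rule A)
  let ?p = "koop (indicator A)"
  have bp: "bdd 1 ?p" by (rule bdd_koop[OF bdd_indicator[OF A]])
  have "(\<lambda>n. (koop ^^ n) ?p base) \<longlonglongrightarrow> (\<integral>v. ?p v \<partial>limit_measure)"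
  proof (rule LIM_zero_cancel, rule Lim_null_comparison)
    show "\<forall>\<^sub>F n in sequentially. norm ((koop ^^ n) ?p base - (\<integral>v. ?p v \<partial>limit_measure)) \<le> 2 * 1 * rate n"
      using limit_measure_bound[OF bp _ base] by (intro always_eventually) auto
    show "(\<lambda>n. 2 * 1 * rate n) \<longlonglongrightarrow> 0"
      using tendsto_mult_left[OF rate_tendsto, of 2] by simp
  qed
  moreover have "(\<lambda>n. (koop ^^ n) ?p base) \<longlonglongrightarrow> limit_value A"
    using LIMSEQ_Suc[OF limit_value_tendsto[OF A]] by (simp add: funpow_swap1)
  ultimately have eq: "(\<integral>v. ?p v \<partial>limit_measure) = limit_value A"
    by (rule LIMSEQ_unique)
  have pv: "ennreal (?p v) = emeasure \<mu> {w \<in> space \<mu>. F w v \<in> A} \<and> 0 \<le> ?p v" if v: "v \<in> space M" for v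
  proof -
    have "{w \<in> space \<mu>. F w v \<in> A} \<in> sets \<mu>"
      using measurable_sets[OF measurable_step_at[OF v] A] by (simp add: vimage_def Int_def conj_commute)
    then have "measure \<mu> {w \<in> space \<mu>. F w v \<in> A} = (\<integral>w. indicator {w \<in> space \<mu>. F w v \<in> A} w \<partial>\<mu>)"
      by (simp add: Int_absorb2)
    also have "\<dots> = ?p v"
      unfolding koop_def by (intro Bochner_Integration.integral_cong) (auto simp: indicator_def)
    finally have "?p v = measure \<mu> {w \<in> space \<mu>. F w v \<in> A}" ..
    then show ?thesis by (simp add: emeasure_eq_measure)
  qed
  have "emeasure limit_measure A = ennreal (\<integral>v. ?p v \<partial>limit_measure)"
    by (simp add: eq emeasure_limit_measure[OF A])
  also have "\<dots> = (\<integral>\<^sup>+v. ennreal (?p v) \<partial>limit_measure)"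
    using bp pv sp
    by (intro nn_integral_eq_integral[symmetric] AE_I2 lim.integrable_const_bound[of _ 1])
      (auto simp: bdd_def cong: measurable_cong_sets)
  also have "\<dots> = (\<integral>\<^sup>+v. emeasure \<mu> {w \<in> space \<mu>. F w v \<in> A} \<partial>limit_measure)"
    using pv sp by (intro nn_integral_cong) auto
  finally show "emeasure limit_measure A = (\<integral>\<^sup>+v. emeasure \<mu> {w \<in> space \<mu>. F w v \<in> A} \<partial>limit_measure)" .
qed (simp_all add: prob_limit_measure)

text \<open>A stationary \<nu> gives \<open>A\<close> the \<nu>-mean of its \<open>n\<close>-step
  probability, for every \<open>n\<close>, and that probability is within \<open>rate n\<close> of
  the limit value whatever the start.\<close>

lemma stationary_unique:
  assumes \<nu>: "stationary \<nu>"
  shows "\<nu> = limit_measure"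
proof (rule measure_eqI)
  have s: "sets \<nu> = sets M" and "prob_space \<nu>" using \<nu> by (auto simp: stationary_def)
  interpret \<nu>: prob_space \<nu> by fact
  have sp: "space \<nu> = space M" by (rule sets_eq_imp_space_eq[OF s])
  show "sets \<nu> = sets limit_measure" by (simp add: s)
  fix A assume "A \<in> sets \<nu>"
  then have A: "A \<in> sets M" by (simp add: s)
  have b: "bdd 1 ((koop ^^ n) (indicator A))" for n by (rule bdd_koop_pow[OF bdd_indicator[OF A]])
  have i: "integrable \<nu> ((koop ^^ n) (indicator A))" for n
    using b[of n] by (intro \<nu>.integrable_const_bound[of _ 1] AE_I2) (auto simp: bdd_def sp s cong: measurable_cong_sets)
  have inv: "(\<integral>v. (koop ^^ n) (indicator A) v \<partial>\<nu>) = measure \<nu> A" for n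
  proof (induction n)
    case 0
    then show ?case using sets.sets_into_space[OF A] by (simp add: sp Int_absorb2)
  next
    case (Suc n)
    then show ?case using stationary_integral[OF \<nu> b[of n]] by simp
  qed
  have "\<bar>measure \<nu> A - limit_value A\<bar> \<le> rate n" for n
  proof -
    have "measure \<nu> A - limit_value A = (\<integral>v. (koop ^^ n) (indicator A) v - limit_value A \<partial>\<nu>)"
      using i[of n] by (simp add: inv \<nu>.prob_space)
    also have "\<bar>\<dots>\<bar> \<le> (\<integral>v. \<bar>(koop ^^ n) (indicator A) v - limit_value A\<bar> \<partial>\<nu>)"
      by (rule integral_abs_bound)
    also have "\<dots> \<le> (\<integral>v. rate n \<partial>\<nu>)"
      using i[of n] limit_value_bound[OF A, of _ n]
      by (intro integral_mono) (auto simp: sp measure_law[OF A])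
    finally show ?thesis by (simp add: \<nu>.prob_space)
  qed
  then have "\<bar>measure \<nu> A - limit_value A\<bar> \<le> 0"
    by (intro LIMSEQ_le_const[OF rate_tendsto]) blast
  then show "emeasure \<nu> A = emeasure limit_measure A"
    by (simp add: emeasure_limit_measure[OF A] \<nu>.emeasure_eq_measure)
qed

lemma ex1_stationary: "\<exists>!\<nu>. stationary \<nu>"
  using stationary_limit_measure stationary_unique by blast

text \<open>\<open>limit_measure_bound\<close> loses a factor 2, so the rate 1/8 of the weighted
  setting asks for 1/16 here.\<close>

lemma weighted_mixing_doeblin:
  assumes \<nu>: "stationary \<nu>" and j: "1 \<le> j" "(1 - \<eta>) ^ j \<le> 1 / 16"
  shows "weighted_mixing \<mu> M F \<nu> (\<lambda>_. 1) (k * j) 1"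
proof -
  have "\<nu> = limit_measure" by (rule stationary_unique[OF \<nu>])
  interpret \<nu>: prob_space \<nu> using \<nu> by (simp add: stationary_def)
  have s: "sets \<nu> = sets M" using \<nu> by (simp add: stationary_def)
  have sp: "space \<nu> = space M" by (rule sets_eq_imp_space_eq[OF s])
  have r: "rate (k * j) \<le> 1 / 16"
    using j(2) k_pos by (simp add: rate_def)
  show ?thesis
  proof (intro weighted_mixing.intro weighted_mixing_axioms.intro)
    show "random_map \<mu> M F" by unfold_locales
    show "prob_space \<nu>" by unfold_locales
    show "1 \<le> k * j" using k_pos j(1) by simp
    show "(\<integral>u. koop \<phi> u \<partial>\<nu>) = (\<integral>u. \<phi> u \<partial>\<nu>)" if "bdd B \<phi>" for B \<phi>
      by (rule stationary_integral[OF \<nu> that])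
    fix B \<beta> \<phi> assume \<phi>: "bdd B \<phi>" and \<beta>: "0 \<le> \<beta>" and le: "\<And>v. v \<in> space M \<Longrightarrow> \<bar>\<phi> v\<bar> \<le> \<beta> * 1"
    have b: "bdd \<beta> \<phi>" using \<phi> le by (simp add: bdd_def)
    show "\<bar>(koop ^^ (k * j)) \<phi> u - (\<integral>v. \<phi> v \<partial>\<nu>)\<bar> \<le> \<beta> / 8 * 1" if u: "u \<in> space M" for u
    proof (cases "\<beta> = 0")
      \<comment> \<open>Treated apart because \<open>limit_measure_bound\<close> is stated for a
        positive bound.\<close>
      case True
      then have z: "\<phi> v = 0" if "v \<in> space M" for v using le[OF that] by simp
      have "(koop ^^ (k * j)) \<phi> u = 0"
        unfolding koop_pow[OF \<phi> u] using z orbit_space[OF u] by (intro integral_eq_zero_AE AE_I2) auto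
      moreover have "(\<integral>v. \<phi> v \<partial>\<nu>) = 0"
        using z by (intro integral_eq_zero_AE AE_I2) (simp add: sp)
      ultimately show ?thesis using True by simp
    next
      case False
      then have "0 < \<beta>" using \<beta> by simp
      from limit_measure_bound[OF b this u, of "k * j"]
      have "\<bar>(koop ^^ (k * j)) \<phi> u - (\<integral>v. \<phi> v \<partial>\<nu>)\<bar> \<le> 2 * \<beta> * rate (k * j)"
        by (simp add: \<open>\<nu> = limit_measure\<close>)
      also have "\<dots> \<le> 2 * \<beta> * (1 / 16)"
        using r \<beta> by (intro mult_left_mono) auto
      finally show ?thesis by simp
    qed
    have "(\<integral>v. \<bar>\<phi> v\<bar> \<partial>\<nu>) \<le> (\<integral>v. \<beta> \<partial>\<nu>)"
      using \<phi> le \<beta> by (intro integral_mono \<nu>.integrable_const_bound[of _ \<beta>] AE_I2)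
        (auto simp: bdd_def sp s cong: measurable_cong_sets)
    then show "(\<integral>v. \<bar>\<phi> v\<bar> \<partial>\<nu>) \<le> \<beta> * 1" by (simp add: \<nu>.prob_space)
  qed (auto simp: s)
qed

end

section \<open>The two-point motion\<close>

definition noise_law :: "real \<Rightarrow> real \<Rightarrow> real measure" where
  "noise_law L \<delta> = uniform_measure lborel {- noise_size L \<delta> .. noise_size L \<delta>}"

lemma noise_eq: "noise L \<delta> = PiM UNIV (\<lambda>_. noise_law L \<delta>)"
  by (simp add: noise_def noise_law_def)

lemma sets_noise_law [simp, measurable_cong]: "sets (noise_law L \<delta>) = sets borel"
  by (simp add: noise_law_def)

lemma space_noise_law [simp]: "space (noise_law L \<delta>) = UNIV"
  by (simp add: noise_law_def)

lemma prob_space_noise_law: "L > 0 \<Longrightarrow> prob_space (noise_law L \<delta>)"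
  unfolding noise_law_def noise_size_def by (intro prob_space_uniform_measure) auto

lemma integral_noise_component:
  fixes f :: "real \<Rightarrow> real"
  assumes "L > 0" "f \<in> borel_measurable borel"
  shows "(\<integral>\<omega>. f (\<omega> 0) \<partial>noise L \<delta>) = (\<integral>w. f w \<partial>noise_law L \<delta>)"
proof -
  have "distr (noise L \<delta>) (noise_law L \<delta>) (\<lambda>\<omega>. \<omega> 0) = noise_law L \<delta>"
    unfolding noise_eq using prob_space_noise_law[OF assms(1)] by (intro distr_PiM_component) auto
  moreover have "(\<integral>w. f w \<partial>distr (noise L \<delta>) (noise_law L \<delta>) (\<lambda>\<omega>. \<omega> 0)) = (\<integral>\<omega>. f (\<omega> 0) \<partial>noise L \<delta>)"
    using assms(2) unfolding noise_eq by (intro integral_distr) (auto simp: measurable_cong_sets[OF sets_noise_law refl])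
  ultimately show ?thesis by simp
qed

section \<open>Measurability and injectivity of the torus map\<close>

lemma frac_measurable [measurable]: "(frac :: real \<Rightarrow> real) \<in> borel_measurable borel"
  unfolding frac_def[abs_def] by measurable

lemma mod1_measurable [measurable]: "mod1 \<in> borel \<rightarrow>\<^sub>M borel"
  unfolding mod1_def[abs_def] borel_prod[symmetric] by measurable

lemma mod1_in_torus: "mod1 z \<in> torus"
  by (simp add: mod1_def torus_def frac_ge_0 frac_lt_1)

lemma mod1_torus: "z \<in> torus \<Longrightarrow> mod1 z = z"
  by (auto simp: mod1_def torus_def frac_eq)

lemma torus_map_measurable [measurable (raw)]:
  assumes [measurable]: "f \<in> borel_measurable N" and g: "g \<in> N \<rightarrow>\<^sub>M (borel :: point measure)"
  shows "(\<lambda>x. torus_map L (f x) (g x)) \<in> N \<rightarrow>\<^sub>M borel"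
proof -
  have [measurable]: "g \<in> N \<rightarrow>\<^sub>M borel \<Otimes>\<^sub>M borel"
    using g by (simp only: borel_prod)
  have "(\<lambda>x. lift_map L (f x) (g x)) \<in> N \<rightarrow>\<^sub>M borel \<Otimes>\<^sub>M borel"
    unfolding lift_map_def by measurable
  then show ?thesis
    unfolding torus_map_def borel_prod by (rule measurable_compose[OF _ mod1_measurable])
qed

lemma torus_map_in_torus: "torus_map L w z \<in> torus"
  by (simp add: torus_map_def mod1_in_torus)

lemma frac_eq_frac_iff: "frac x = frac y \<longleftrightarrow> x - y \<in> \<int>" for x y :: real
proof
  assume "frac x = frac y"
  then have "x - y = of_int (\<lfloor>x\<rfloor> - \<lfloor>y\<rfloor>)" by (simp add: frac_def algebra_simps)
  then show "x - y \<in> \<int>" by (metis Ints_of_int)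
next
  assume "x - y \<in> \<int>"
  then obtain k where "x = y + of_int k" by (auto elim!: Ints_cases simp: algebra_simps)
  then show "frac x = frac y" by (simp add: frac_def)
qed

lemma unit_interval_eqI: "x \<in> {0..<1} \<Longrightarrow> y \<in> {0..<1} \<Longrightarrow> x - y \<in> \<int> \<Longrightarrow> x = y" for x y :: real
  by (metis atLeastLessThan_iff frac_eq frac_eq_frac_iff)

text \<open>The second image coordinate determines \<open>x\<close> modulo 1, and then the first
  determines \<open>y\<close>. Distinct points therefore stay distinct, and the two-point motion
  never meets the diagonal.\<close>

lemma inj_on_torus_map: "inj_on (torus_map L w) torus"
proof (rule inj_onI)
  fix z z' assume z: "z \<in> torus" "z' \<in> torus" and eq: "torus_map L w z = torus_map L w z'"
  have "fst z = fst z'"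
    using z eq by (intro unit_interval_eqI)
      (auto simp: torus_map_def mod1_def lift_map_def torus_def frac_eq_frac_iff)
  moreover have "snd z' - snd z \<in> \<int>"
    using eq calculation by (auto simp: torus_map_def mod1_def lift_map_def frac_eq_frac_iff)
  then have "snd z' = snd z"
    using z by (intro unit_interval_eqI) (auto simp: torus_def)
  ultimately show "z = z'" by (simp add: prod_eq_iff)
qed

lemma torus_dist_less_iff: "torus_dist z z' < a \<longleftrightarrow> (\<exists>i j :: int. norm (z - z' + (of_int i, of_int j)) < a)"
  unfolding torus_dist_def
  by (subst cInf_less_iff) (auto intro!: bdd_belowI[of _ 0])

lemma torus_dist_ge:
  assumes "\<And>i j :: int. a \<le> norm (z - z' + (of_int i, of_int j))"
  shows "a \<le> torus_dist z z'"
  using assms torus_dist_less_iff[of z z' a] by (meson not_less)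

lemma space_pair: "space pair_measure_offdiag = torus \<times> torus - Id"
  by (auto simp: pair_measure_offdiag_def space_restrict_space space_pair_measure torus_measure_def)

lemma pair_measurable_borel: "(\<lambda>p. p) \<in> pair_measure_offdiag \<rightarrow>\<^sub>M borel"
proof -
  have "(\<lambda>p. p) \<in> torus_measure \<Otimes>\<^sub>M torus_measure \<rightarrow>\<^sub>M borel \<Otimes>\<^sub>M borel"
    unfolding torus_measure_def
    by (intro measurable_pair) (auto simp: comp_def intro!: measurable_compose[OF measurable_fst] measurable_compose[OF measurable_snd] measurable_restrict_space1)
  then show ?thesis
    unfolding pair_measure_offdiag_def borel_prod by (rule measurable_restrict_space1)
qed

lemma pair_step_measurable:
  assumes "sets \<mu> = sets borel"
  shows "(\<lambda>(w, p). pair_step L w p) \<in> \<mu> \<Otimes>\<^sub>M pair_measure_offdiag \<rightarrow>\<^sub>M pair_measure_offdiag"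
proof -
  note [measurable_cong] = assms
  note [measurable] = pair_measurable_borel
  have c: "(\<lambda>x. torus_map L (fst x) (h (snd x))) \<in> \<mu> \<Otimes>\<^sub>M pair_measure_offdiag \<rightarrow>\<^sub>M torus_measure"
    if "h \<in> borel \<rightarrow>\<^sub>M borel" for h
    unfolding torus_measure_def
  proof (rule measurable_restrict_space2)
    have "(\<lambda>x. snd x) \<in> \<mu> \<Otimes>\<^sub>M pair_measure_offdiag \<rightarrow>\<^sub>M borel"
      using measurable_compose[OF measurable_snd pair_measurable_borel] by simp
    note [measurable] = measurable_compose[OF this that]
    show "(\<lambda>x. torus_map L (fst x) (h (snd x))) \<in> \<mu> \<Otimes>\<^sub>M pair_measure_offdiag \<rightarrow>\<^sub>M lborel"
      by measurable
  qed (auto simp: torus_map_def mod1_in_torus)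
  have fs: "fst \<in> (borel :: (point \<times> point) measure) \<rightarrow>\<^sub>M borel" "snd \<in> (borel :: (point \<times> point) measure) \<rightarrow>\<^sub>M borel"
    unfolding borel_prod[symmetric] by (rule measurable_fst measurable_snd)+
  have "(\<lambda>x. pair_step L (fst x) (snd x)) \<in> \<mu> \<Otimes>\<^sub>M pair_measure_offdiag \<rightarrow>\<^sub>M pair_measure_offdiag"
    unfolding pair_measure_offdiag_def
  proof (rule measurable_restrict_space2)
    show "(\<lambda>x. pair_step L (fst x) (snd x)) \<in> \<mu> \<Otimes>\<^sub>M restrict_space (torus_measure \<Otimes>\<^sub>M torus_measure) (torus \<times> torus - Id) \<rightarrow>\<^sub>M torus_measure \<Otimes>\<^sub>M torus_measure"
      using c[OF fs(1)] c[OF fs(2)] unfolding pair_step_def pair_measure_offdiag_def by (rule measurable_Pair)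
    have f1: "pair_step L w p \<in> torus \<times> torus - Id" if "p \<in> torus \<times> torus - Id" for w p
      using that inj_on_torus_map[of L w] by (auto simp: pair_step_def torus_map_in_torus dest: inj_onD)
    have f2: "snd x \<in> torus \<times> torus - Id"
      if "x \<in> space (\<mu> \<Otimes>\<^sub>M restrict_space (torus_measure \<Otimes>\<^sub>M torus_measure) (torus \<times> torus - Id))" for x
      using that unfolding space_pair_measure space_pair[unfolded pair_measure_offdiag_def] by force
    show "(\<lambda>x. pair_step L (fst x) (snd x)) \<in> space (\<mu> \<Otimes>\<^sub>M restrict_space (torus_measure \<Otimes>\<^sub>M torus_measure) (torus \<times> torus - Id)) \<rightarrow> torus \<times> torus - Id"
      by (intro funcsetI f1 f2)
  qed
  then show ?thesis by (simp add: case_prod_beta')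
qed

lemma pair_process_eq_orbit: "pair_process L p n \<omega> = orbit (pair_step L) p n \<omega>"
  by (induction n) auto

lemma random_map_pair: "L > 0 \<Longrightarrow> random_map (noise_law L \<delta>) pair_measure_offdiag (pair_step L)"
  by (intro random_map.intro random_map_axioms.intro prob_space_noise_law pair_step_measurable) simp_all

text \<open>Two points on a common vertical circle at distance \<open>1/2\<close> stay at distance at least \<open>1/2\<close>
  under one step, whatever the noise. This gives a pair at which the weight and its image under the
  transition operator are both controlled.\<close>

definition base_pair :: "point \<times> point" where
  "base_pair = ((0, 0), (0, 1 / 2))"

lemma base_pair_space: "base_pair \<in> space pair_measure_offdiag"
  by (simp add: base_pair_def space_pair torus_def)

lemma half_int_bound: "1 / 2 \<le> \<bar>1 / 2 + real_of_int k\<bar>" for k :: int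
proof (cases "k \<ge> 0")
  case False
  then have "of_int k \<le> (- 1 :: real)" by linarith
  then show ?thesis by linarith
qed simp

lemma base_pair_dist: "1 / 2 \<le> torus_dist (fst base_pair) (snd base_pair)"
proof (rule torus_dist_ge)
  fix i j :: int
  have "1 / 2 \<le> \<bar>snd (fst base_pair - snd base_pair + (of_int i, of_int j))\<bar>"
    using half_int_bound[of "j - 1"] by (simp add: base_pair_def)
  also have "\<dots> \<le> norm (fst base_pair - snd base_pair + (of_int i, of_int j))"
    by (metis norm_snd_le real_norm_def prod.collapse)
  finally show "1 / 2 \<le> norm (fst base_pair - snd base_pair + (of_int i, of_int j))" .
qed

lemma base_pair_step_dist: 
  "1 / 2 \<le> torus_dist (fst (pair_step L w base_pair)) (snd (pair_step L w base_pair))" (is "_ \<le> torus_dist ?z ?z'")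
proof (rule torus_dist_ge)
  fix i j :: int
  let ?a = "L * cos (2 * pi * w)"
  have "fst (?z - ?z' + (of_int i, of_int j)) = 1 / 2 + of_int (\<lfloor>?a - 1 / 2\<rfloor> - \<lfloor>?a\<rfloor> + i)"
    by (simp add: pair_step_def base_pair_def torus_map_def lift_map_def mod1_def frac_def)
  then have "1 / 2 \<le> \<bar>fst (?z - ?z' + (of_int i, of_int j))\<bar>"
    using half_int_bound by metis
  also have "\<dots> \<le> norm (?z - ?z' + (of_int i, of_int j))"
    by (metis norm_fst_le real_norm_def prod.collapse)
  finally show "1 / 2 \<le> norm (?z - ?z' + (of_int i, of_int j))" .
qed

lemma weight_far:
  assumes "L > 2" "t \<ge> 1" "1 / 2 \<le> torus_dist (fst p) (snd p)"
  shows "weight \<epsilon>\<^sub>0 t L p = 1"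
proof -
  have "L powr (- real t) \<le> L powr (- 1)"
    using assms by (intro powr_mono) auto
  also have "\<dots> < 1 / 2"
    using assms by (simp add: powr_minus_divide field_simps)
  finally show ?thesis
    using assms(3) by (simp add: weight_def)
qed

lemma weight_nonneg: "0 \<le> weight \<epsilon>\<^sub>0 t L p"
  by (simp add: weight_def)

text \<open>Turns estimates with a geometric factor, valid for every \<open>n\<close>, into
  identities: this is how exact properties of the limit measure are read off from mixing.\<close>

lemma tendsto_geometric_zero:
  fixes a :: real
  assumes "0 < \<gamma>" "\<gamma> < 1" "\<And>n. n \<ge> 1 \<Longrightarrow> \<bar>a\<bar> \<le> B * \<gamma> ^ n"
  shows "a = 0"
proof -
  have "(\<lambda>n. B * \<gamma> ^ n) \<longlonglongrightarrow> B * 0"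
    using assms by (intro tendsto_intros LIMSEQ_power_zero) auto
  then have "\<bar>a\<bar> \<le> B * 0"
    by (rule LIMSEQ_le_const) (use assms(3) in blast)
  then show ?thesis by simp
qed

text \<open>Total mass one and invariance of the product measure are extracted from the mixing
  hypothesis itself, evaluated at \<open>base_pair\<close> for all \<open>n\<close>. For
  \<open>weight_mean\<close>, one step from that pair bounds the mean of |\<phi>| by 2 \<beta> plus
  the mixing error 2 C' \<beta>, since \<open>1 + weight\<close> equals 2 at the pair and at its
  image.\<close>

lemma weighted_mixing_pair:
  assumes L: "L > 2" and t: "t \<ge> 1" and C': "C' > 0" and \<gamma>: "0 < \<gamma>" "\<gamma> < 1"
    and mix: "\<And>n \<phi>. n \<ge> 1 \<Longrightarrow> \<phi> \<in> borel_measurable pair_measure_offdiag \<Longrightarrow>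
        weight_norm \<epsilon>\<^sub>0 t L \<phi> < \<infinity> \<Longrightarrow>
        weight_norm \<epsilon>\<^sub>0 t L (\<lambda>p. (koopman2 L \<delta> ^^ n) \<phi> p - (\<integral>q. \<phi> q \<partial>pair_measure_offdiag))
          \<le> ennreal (C' * \<gamma> ^ n) * weight_norm \<epsilon>\<^sub>0 t L \<phi>"
    and N: "N \<ge> 1" "C' * \<gamma> ^ N \<le> 1 / 8"
  shows "weighted_mixing (noise_law L \<delta>) pair_measure_offdiag (pair_step L) pair_measure_offdiag
    (\<lambda>p. 1 + weight \<epsilon>\<^sub>0 t L p) N (2 + 2 * C')"
proof -
  let ?M = pair_measure_offdiag
  let ?W = "\<lambda>p. 1 + weight \<epsilon>\<^sub>0 t L p"
  interpret random_map "noise_law L \<delta>" ?M "pair_step L"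
    using L by (intro random_map_pair) simp
  have W_pos: "0 < ?W p" for p
    using weight_nonneg[of \<epsilon>\<^sub>0 t L p] by linarith
  have W_base: "?W base_pair = 2" "?W (pair_step L w base_pair) = 2" for w
    using weight_far[OF L t base_pair_dist] weight_far[OF L t base_pair_step_dist] by simp_all
  \<comment> \<open>\<open>koopman2\<close> integrates over whole noise sequences,
    \<open>koop\<close> over a single coordinate. They are compared on the space and for bounded
    measurable functions.\<close>
  have koopman: "(koopman2 L \<delta> ^^ n) \<phi> u = (koop ^^ n) \<phi> u" if \<phi>: "bdd B \<phi>" and u: "u \<in> space ?M" for n B \<phi> u
    using u
  proof (induction n arbitrary: u)
    case (Suc n)
    let ?\<psi> = "(koop ^^ n) \<phi>"
    have \<psi>: "bdd B ?\<psi>" by (rule bdd_koop_pow[OF \<phi>])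
    have "(koopman2 L \<delta> ^^ Suc n) \<phi> u = (\<integral>\<omega>. ?\<psi> (pair_step L (\<omega> 0) u) \<partial>noise L \<delta>)"
      unfolding funpow.simps comp_def koopman2_def[of _ _ "(koopman2 L \<delta> ^^ n) \<phi>"]
      using step_space[OF _ Suc.prems] by (intro Bochner_Integration.integral_cong) (auto intro!: Suc.IH)
    also have "\<dots> = (\<integral>w. ?\<psi> (pair_step L w u) \<partial>noise_law L \<delta>)"
      using L measurable_compose[OF measurable_step_at[OF Suc.prems] bdd_measurable[OF \<psi>]]
      by (intro integral_noise_component) (auto simp: measurable_cong_sets[OF sets_noise_law refl])
    finally show ?case
      by (simp only: funpow.simps comp_def koop_def[of "(koop ^^ n) \<phi>" u])
  qed simp
  have mixing: "\<bar>(koop ^^ n) \<phi> u - (\<integral>q. \<phi> q \<partial>?M)\<bar> \<le> C' * \<gamma> ^ n * \<beta> * ?W u"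
    if n: "n \<ge> 1" and \<phi>: "bdd B \<phi>" and \<beta>: "0 \<le> \<beta>" "\<And>v. v \<in> space ?M \<Longrightarrow> \<bar>\<phi> v\<bar> \<le> \<beta> * ?W v"
      and u: "u \<in> space ?M" for n B \<phi> \<beta> u
  proof -
    have "weight_norm \<epsilon>\<^sub>0 t L \<phi> \<le> ennreal \<beta>"
      unfolding weight_norm_def using \<beta> W_pos by (intro SUP_least ennreal_leI) (simp add: divide_le_eq)
    then have le: "ennreal (C' * \<gamma> ^ n) * weight_norm \<epsilon>\<^sub>0 t L \<phi> \<le> ennreal (C' * \<gamma> ^ n * \<beta>)"
      and fin: "weight_norm \<epsilon>\<^sub>0 t L \<phi> < \<infinity>"
      using C' \<gamma> \<beta>(1) by (auto simp: ennreal_mult intro: mult_left_mono le_less_trans)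
    have "ennreal (\<bar>(koop ^^ n) \<phi> u - (\<integral>q. \<phi> q \<partial>?M)\<bar> / ?W u)
        = ennreal (\<bar>(koopman2 L \<delta> ^^ n) \<phi> u - (\<integral>q. \<phi> q \<partial>?M)\<bar> / ?W u)"
      by (simp add: koopman[OF \<phi> u])
    also have "\<dots> \<le> weight_norm \<epsilon>\<^sub>0 t L (\<lambda>p. (koopman2 L \<delta> ^^ n) \<phi> p - (\<integral>q. \<phi> q \<partial>?M))"
      unfolding weight_norm_def using u by (intro SUP_upper)
    also have "\<dots> \<le> ennreal (C' * \<gamma> ^ n * \<beta>)"
      using mix[OF n bdd_measurable[OF \<phi>] fin] le by (rule order_trans)
    finally have "\<bar>(koop ^^ n) \<phi> u - (\<integral>q. \<phi> q \<partial>?M)\<bar> / ?W u \<le> C' * \<gamma> ^ n * \<beta>"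
      using C' \<gamma> \<beta>(1) by (subst (asm) ennreal_le_iff) auto
    then show ?thesis using W_pos[of u] by (simp add: divide_le_eq)
  qed
  have W_one: "\<bar>\<phi> v\<bar> \<le> B * ?W v" if "bdd B \<phi>" "v \<in> space ?M" for B \<phi> v
  proof -
    have "\<bar>\<phi> v\<bar> \<le> B" by (rule bddD[OF that])
    moreover have "0 \<le> B" using calculation by linarith
    ultimately show ?thesis
      using mult_left_mono[of 1 "?W v" B] weight_nonneg[of \<epsilon>\<^sub>0 t L v] by simp
  qed
  have B_nonneg: "0 \<le> B" if "bdd B \<phi>" for B \<phi>
    using bddD[OF that base_pair_space] by linarith
  \<comment> \<open>The constant 1 is fixed by the operator, so mixing compares 1 with the total
    mass.\<close>
  have "1 - (\<integral>q. 1 \<partial>?M) = (0 :: real)"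
  proof (rule tendsto_geometric_zero[OF \<gamma>])
    fix n :: nat assume n: "1 \<le> n"
    have one: "bdd 1 (\<lambda>_. 1)" by (simp add: bdd_def)
    have "(koop ^^ n) (\<lambda>_. 1) base_pair = 1" for n
      using koop_pow[OF one base_pair_space, of n] noise.P.prob_space by simp
    then show "\<bar>1 - (\<integral>q. 1 \<partial>?M)\<bar> \<le> C' * 2 * \<gamma> ^ n"
      using mixing[OF n one _ W_one[OF one] base_pair_space] by (simp add: W_base mult_ac)
  qed
  then have m1: "measure ?M (space ?M) = 1" by simp
  have prob: "prob_space ?M"
  proof
    show "emeasure ?M (space ?M) = 1"
      using m1 by (metis emeasure_eq_ennreal_measure ennreal_1 ennreal_top_neq_one measure_eq_emeasure_eq_ennreal
          enn2real_top measure_def zero_neq_one)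
  qed
  show ?thesis
  proof (intro weighted_mixing.intro weighted_mixing_axioms.intro)
    show "random_map (noise_law L \<delta>) ?M (pair_step L)" by unfold_locales
    show "prob_space ?M" by (rule prob)
    show "1 \<le> ?W u" for u by (simp add: weight_nonneg)
    show "(\<integral>u. koop \<phi> u \<partial>?M) = (\<integral>u. \<phi> u \<partial>?M)" if \<phi>: "bdd B \<phi>" for B \<phi>
    proof -
      have "(\<integral>u. koop \<phi> u \<partial>?M) - (\<integral>u. \<phi> u \<partial>?M) = 0"
      proof (rule tendsto_geometric_zero[OF \<gamma>])
        fix n :: nat assume n: "1 \<le> n"
        have "\<bar>(koop ^^ n) (koop \<phi>) base_pair - (\<integral>q. koop \<phi> q \<partial>?M)\<bar> \<le> C' * \<gamma> ^ n * B * 2"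
          using mixing[OF n bdd_koop[OF \<phi>] B_nonneg[OF \<phi>] W_one[OF bdd_koop[OF \<phi>]] base_pair_space]
          by (simp only: W_base)
        \<comment> \<open>The same number, now read as iterate \<open>Suc n\<close> of \<phi>; hence
          it is close to both integrals.\<close>
        moreover have "\<bar>(koop ^^ n) (koop \<phi>) base_pair - (\<integral>q. \<phi> q \<partial>?M)\<bar> \<le> C' * \<gamma> ^ Suc n * B * 2"
          using mixing[OF _ \<phi> B_nonneg[OF \<phi>] W_one[OF \<phi>] base_pair_space, of "Suc n"]
          unfolding W_base funpow_Suc_right comp_def by simp
        moreover have "C' * \<gamma> ^ Suc n * B * 2 \<le> C' * \<gamma> ^ n * B * 2"
          using C' \<gamma> B_nonneg[OF \<phi>] by (intro mult_right_mono mult_left_mono power_decreasing) auto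
        ultimately have "\<bar>(\<integral>u. koop \<phi> u \<partial>?M) - (\<integral>u. \<phi> u \<partial>?M)\<bar> \<le> C' * \<gamma> ^ n * B * 2 + C' * \<gamma> ^ n * B * 2"
          by linarith
        then show "\<bar>(\<integral>u. koop \<phi> u \<partial>?M) - (\<integral>u. \<phi> u \<partial>?M)\<bar> \<le> 4 * C' * B * \<gamma> ^ n"
          by (simp add: mult_ac)
      qed
      then show ?thesis by simp
    qed
    show "\<bar>(koop ^^ N) \<phi> u - (\<integral>q. \<phi> q \<partial>?M)\<bar> \<le> \<beta> / 8 * ?W u"
      if "bdd B \<phi>" "0 \<le> \<beta>" "\<And>v. v \<in> space ?M \<Longrightarrow> \<bar>\<phi> v\<bar> \<le> \<beta> * ?W v" "u \<in> space ?M" for B \<phi> \<beta> u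
    proof -
      have "C' * \<gamma> ^ N * \<beta> * ?W u \<le> 1 / 8 * \<beta> * ?W u"
        using N(2) that(2) W_pos[of u] by (intro mult_right_mono) auto
      then show ?thesis using mixing[OF N(1) that] by simp
    qed
    show "(\<integral>v. \<bar>\<phi> v\<bar> \<partial>?M) \<le> \<beta> * (2 + 2 * C')"
      if \<phi>: "bdd B \<phi>" and \<beta>: "0 \<le> \<beta>" "\<And>v. v \<in> space ?M \<Longrightarrow> \<bar>\<phi> v\<bar> \<le> \<beta> * ?W v" for B \<phi> \<beta>
    proof -
      have "koop (\<lambda>v. \<bar>\<phi> v\<bar>) base_pair \<le> (\<integral>w. \<beta> * 2 \<partial>noise_law L \<delta>)"
        unfolding koop_def using \<beta>(2)[OF step_space[OF _ base_pair_space]] W_base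
        by (intro integral_mono integrable_step[OF bdd_abs[OF \<phi>] base_pair_space]) auto
      then have "koop (\<lambda>v. \<bar>\<phi> v\<bar>) base_pair \<le> \<beta> * 2"
        using prob_space by simp
      moreover have "\<bar>(koop ^^ 1) (\<lambda>v. \<bar>\<phi> v\<bar>) base_pair - (\<integral>v. \<bar>\<phi> v\<bar> \<partial>?M)\<bar> \<le> C' * \<gamma> ^ 1 * \<beta> * 2"
        using mixing[OF _ bdd_abs[OF \<phi>] \<beta>(1) _ base_pair_space, of 1] \<beta>(2) by (simp only: W_base abs_idempotent)
      moreover have "C' * \<gamma> ^ 1 * \<beta> * 2 \<le> C' * 1 * \<beta> * 2"
        using C' \<gamma> \<beta>(1) by (intro mult_right_mono mult_left_mono) auto
      ultimately show ?thesis by (simp add: algebra_simps)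
    qed
  qed (use N C' in auto)
qed

section \<open>The circle and the forcing\<close>

text \<open>Closed arcs of the circle in real coordinates. Stated through the nearest integer,
  membership passes through sums and differences without reduction modulo 1.\<close>

definition near :: "real \<Rightarrow> real \<Rightarrow> bool" where
  "near h x \<longleftrightarrow> (\<exists>k::int. \<bar>x - of_int k\<bar> \<le> h)"

lemma near_measurable [measurable]: "Measurable.pred borel (near h)"
  unfolding near_def[abs_def] by measurable

lemma nearI: "\<bar>x\<bar> \<le> h \<Longrightarrow> near h x"
  unfolding near_def by (rule exI[of _ 0]) simp

lemma near_add: "near a x \<Longrightarrow> near b y \<Longrightarrow> near (a + b) (x + y)"
  unfolding near_def
proof (elim exE)
  fix k l :: int
  assume "\<bar>x - of_int k\<bar> \<le> a" "\<bar>y - of_int l\<bar> \<le> b"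
  then have "\<bar>x + y - of_int (k + l)\<bar> \<le> a + b" by (simp add: abs_if split: if_splits)
  then show "\<exists>k::int. \<bar>x + y - of_int k\<bar> \<le> a + b" ..
qed

lemma near_minus: "near h (- x) \<longleftrightarrow> near h x"
proof -
  have "near h (- x)" if "near h x" for x
  proof -
    from that obtain k :: int where "\<bar>x - of_int k\<bar> \<le> h" by (auto simp: near_def)
    then have "\<bar>- x - of_int (- k)\<bar> \<le> h" by (simp add: abs_if split: if_splits)
    then show ?thesis unfolding near_def ..
  qed
  from this[of x] this[of "- x"] show ?thesis by auto
qed

lemma near_mono: "near a x \<Longrightarrow> a \<le> b \<Longrightarrow> near b x"
  unfolding near_def by (meson order_trans)

lemma near_add_int [simp]: "near h (x + of_int k) \<longleftrightarrow> near h x"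
proof -
  have *: "near h (x + of_int k)" if "near h x" for x k
  proof -
    from that obtain l :: int where "\<bar>x - of_int l\<bar> \<le> h" by (auto simp: near_def)
    then show ?thesis unfolding near_def by (intro exI[of _ "l + k"]) simp
  qed
  from *[of x k] *[of "x + of_int k" "- k"] show ?thesis by auto
qed

lemma near_iff_abs:
  assumes "h < 1 / 2" "\<bar>x\<bar> \<le> 1 / 2"
  shows "near h x \<longleftrightarrow> \<bar>x\<bar> \<le> h"
proof
  assume "near h x"
  then obtain k :: int where k: "\<bar>x - of_int k\<bar> \<le> h" by (auto simp: near_def)
  have "\<bar>real_of_int k\<bar> < 1" using k assms by linarith
  then have "k = 0" by linarith
  with k show "\<bar>x\<bar> \<le> h" by simp
qed (rule nearI)

section \<open>Periodic integrands on the line and on the circle\<close>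

lemma nn_integral_shift:
  fixes \<phi> :: "real \<Rightarrow> ennreal"
  assumes "\<phi> \<in> borel_measurable borel"
  shows "(\<integral>\<^sup>+x. \<phi> (x + c) \<partial>lborel) = (\<integral>\<^sup>+x. \<phi> x \<partial>lborel)"
  using nn_integral_real_affine[of \<phi> 1 c] assms by (simp add: add.commute)

lemma periodic_of_int:
  fixes \<phi> :: "real \<Rightarrow> 'b"
  assumes "\<And>x. \<phi> (x + 1) = \<phi> x"
  shows "\<phi> (x + of_int k) = \<phi> x"
proof -
  have nat: "\<phi> (x + of_nat n) = \<phi> x" for n x
  proof (induction n)
    case (Suc n)
    then show ?case using assms[of "x + of_nat n"] by (simp add: add_ac)
  qed simp
  show ?thesis
    using nat[of x "nat k"] nat[of "x + of_int k" "nat (- k)"] by (cases "k \<ge> 0") auto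
qed

text \<open>Up to an integer translation the interval starts at some \<open>v\<close> in [0, 1), and
  its part beyond 1 moves back by one period.\<close>

lemma nn_integral_period:
  fixes \<phi> :: "real \<Rightarrow> ennreal"
  assumes [measurable]: "\<phi> \<in> borel_measurable borel" and per: "\<And>x. \<phi> (x + 1) = \<phi> x"
  shows "(\<integral>\<^sup>+x. \<phi> x * indicator {u..<u + 1} x \<partial>lborel) = (\<integral>\<^sup>+x. \<phi> x * indicator {0..<1} x \<partial>lborel)"
proof -
  define v where "v = frac u"
  have v: "0 \<le> v" "v < 1" "u = v + of_int \<lfloor>u\<rfloor>"
    by (auto simp: v_def frac_ge_0 frac_lt_1) (simp add: frac_def)
  have shift: "(\<integral>\<^sup>+x. \<phi> x * indicator {a + of_int k..<b + of_int k} x \<partial>lborel)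
      = (\<integral>\<^sup>+x. \<phi> x * indicator {a..<b} x \<partial>lborel)" for a b and k :: int
  proof -
    have "(\<integral>\<^sup>+x. \<phi> x * indicator {a + of_int k..<b + of_int k} x \<partial>lborel)
        = (\<integral>\<^sup>+x. \<phi> (x + of_int k) * indicator {a + of_int k..<b + of_int k} (x + of_int k) \<partial>lborel)"
      by (rule nn_integral_shift[symmetric]) measurable
    also have "\<dots> = (\<integral>\<^sup>+x. \<phi> x * indicator {a..<b} x \<partial>lborel)"
      by (intro nn_integral_cong) (simp add: periodic_of_int[of \<phi>, OF per] split: split_indicator)
    finally show ?thesis .
  qed
  have "(\<integral>\<^sup>+x. \<phi> x * indicator {u..<u + 1} x \<partial>lborel) = (\<integral>\<^sup>+x. \<phi> x * indicator {v..<v + 1} x \<partial>lborel)"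
    using shift[of v "\<lfloor>u\<rfloor>" "v + 1"] v(3) by (simp add: add_ac)
  also have "\<dots> = (\<integral>\<^sup>+x. \<phi> x * indicator {v..<1} x + \<phi> x * indicator {1..<v + 1} x \<partial>lborel)"
    using v(1,2) by (intro nn_integral_cong) (auto split: split_indicator)
  also have "\<dots> = (\<integral>\<^sup>+x. \<phi> x * indicator {v..<1} x \<partial>lborel) + (\<integral>\<^sup>+x. \<phi> x * indicator {0..<v} x \<partial>lborel)"
    using shift[of 0 1 v] by (subst nn_integral_add) auto
  also have "\<dots> = (\<integral>\<^sup>+x. \<phi> x * indicator {v..<1} x + \<phi> x * indicator {0..<v} x \<partial>lborel)"
    by (subst nn_integral_add) auto
  also have "\<dots> = (\<integral>\<^sup>+x. \<phi> x * indicator {0..<1} x \<partial>lborel)"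
    using v(1,2) by (intro nn_integral_cong) (auto split: split_indicator)
  finally show ?thesis .
qed

text \<open>An interval of length 2 h < 1 projects injectively to the circle, so it can be traded
  for an arc within a fundamental domain.\<close>

lemma nn_integral_window:
  fixes \<phi> :: "real \<Rightarrow> ennreal"
  assumes [measurable]: "\<phi> \<in> borel_measurable borel" and per: "\<And>x. \<phi> (x + 1) = \<phi> x" and h: "0 \<le> h" "h < 1 / 2"
  shows "(\<integral>\<^sup>+x. \<phi> x * indicator {p - h..p + h} x \<partial>lborel)
    = (\<integral>\<^sup>+x. \<phi> x * indicator {x. near h (x - p)} x * indicator {0..<1} x \<partial>lborel)"
proof -
  let ?\<psi> = "\<lambda>x. \<phi> x * indicator {x. near h (x - p)} x"
  have m: "?\<psi> \<in> borel_measurable borel" by measurable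
  have "near h (x + 1 - p) \<longleftrightarrow> near h (x - p)" for x
    using near_add_int[of h "x - p" 1] by (simp add: algebra_simps)
  then have "?\<psi> (x + 1) = ?\<psi> x" for x
    by (simp add: per indicator_def)
  from nn_integral_period[of ?\<psi>, OF m this, of "p - 1 / 2"]
  have "(\<integral>\<^sup>+x. ?\<psi> x * indicator {0..<1} x \<partial>lborel) = (\<integral>\<^sup>+x. ?\<psi> x * indicator {p - 1 / 2..<p + 1 / 2} x \<partial>lborel)"
    by (simp add: add.commute)
  also have "\<dots> = (\<integral>\<^sup>+x. \<phi> x * indicator {p - h..p + h} x \<partial>lborel)"
  proof (intro nn_integral_cong)
    fix x
    show "?\<psi> x * indicator {p - 1 / 2..<p + 1 / 2} x = \<phi> x * indicator {p - h..p + h} x"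
    proof (cases "x \<in> {p - 1 / 2..<p + 1 / 2}")
      case True
      then have "near h (x - p) \<longleftrightarrow> \<bar>x - p\<bar> \<le> h"
        by (intro near_iff_abs[OF h(2)] abs_leI) simp_all
      also have "\<dots> \<longleftrightarrow> x \<in> {p - h..p + h}" by auto
      finally show ?thesis using True by (simp add: indicator_def)
    next
      case False
      then have "x \<notin> {p - h..p + h}" using h by auto
      with False show ?thesis by simp
    qed
  qed
  finally show ?thesis ..
qed

lemma nn_integral_near:
  assumes "0 \<le> h" "h < 1 / 2"
  shows "(\<integral>\<^sup>+x. indicator {x. near h (x - p)} x * indicator {0..<1} x \<partial>lborel) = ennreal (2 * h)"
  using nn_integral_window[of "\<lambda>_. 1" h p] assms by simp

text \<open>The interval contains as many full periods as the integer part of B - A, which is at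
  least half of B - A because B - A \<ge> 1.\<close>

lemma nn_integral_periodic_ge:
  fixes \<phi> :: "real \<Rightarrow> ennreal"
  assumes [measurable]: "\<phi> \<in> borel_measurable borel" and per: "\<And>x. \<phi> (x + 1) = \<phi> x" and "1 \<le> B - A"
  shows "ennreal ((B - A) / 2) * (\<integral>\<^sup>+x. \<phi> x * indicator {0..<1} x \<partial>lborel)
    \<le> (\<integral>\<^sup>+x. \<phi> x * indicator {A..B} x \<partial>lborel)"
proof -
  let ?J = "\<integral>\<^sup>+x. \<phi> x * indicator {0..<1} x \<partial>lborel"
  have n: "of_nat n * ?J = (\<integral>\<^sup>+x. \<phi> x * indicator {A..<A + real n} x \<partial>lborel)" for n
  proof (induction n)
    case (Suc n)
    have "of_nat (Suc n) * ?J = of_nat n * ?J + ?J"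
      by (simp add: algebra_simps)
    also have "\<dots> = (\<integral>\<^sup>+x. \<phi> x * indicator {A..<A + real n} x \<partial>lborel)
        + (\<integral>\<^sup>+x. \<phi> x * indicator {A + real n..<A + real n + 1} x \<partial>lborel)"
      by (subst nn_integral_period[OF assms(1) per]) (simp add: Suc)
    also have "\<dots> = (\<integral>\<^sup>+x. \<phi> x * indicator {A..<A + real n} x + \<phi> x * indicator {A + real n..<A + real n + 1} x \<partial>lborel)"
      by (rule nn_integral_add[symmetric]) auto
    also have "\<dots> = (\<integral>\<^sup>+x. \<phi> x * indicator {A..<A + real (Suc n)} x \<partial>lborel)"
      by (intro nn_integral_cong) (auto split: split_indicator)
    finally show ?case .
  qed simp
  define n where "n = nat \<lfloor>B - A\<rfloor>"
  have n_le: "real n \<le> B - A" "(B - A) / 2 \<le> real n"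
  proof -
    have n: "real n = of_int \<lfloor>B - A\<rfloor>" using assms(3) by (simp add: n_def)
    then show "real n \<le> B - A" by simp
    have "1 \<le> real n" unfolding n using assms(3) by simp
    moreover have "B - A < real n + 1" unfolding n by linarith
    ultimately show "(B - A) / 2 \<le> real n" by (simp add: field_simps)
  qed
  have "ennreal ((B - A) / 2) * ?J \<le> of_nat n * ?J"
    using n_le(2) by (intro mult_right_mono) (auto simp: ennreal_of_nat_eq_real_of_nat intro: ennreal_leI)
  also have "\<dots> \<le> (\<integral>\<^sup>+x. \<phi> x * indicator {A..B} x \<partial>lborel)"
    unfolding n using n_le(1) by (intro nn_integral_mono) (auto split: split_indicator)
  finally show ?thesis .
qed

text \<open>Substitution followed by counting of periods: a monotone map of slope at most
  \<open>M\<close> that wraps at least once pushes Lebesgue measure to at least a multiple of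
  Lebesgue measure on the circle.\<close>

lemma nn_integral_pullback_ge:
  fixes \<phi> :: "real \<Rightarrow> ennreal" and g :: "real \<Rightarrow> real"
  assumes \<phi> [measurable]: "\<phi> \<in> borel_measurable borel" and per: "\<And>x. \<phi> (x + 1) = \<phi> x"
    and "\<alpha> < \<beta>" and g: "\<And>s. s \<in> {\<alpha>..\<beta>} \<Longrightarrow> (g has_real_derivative g' s) (at s)" "continuous_on {\<alpha>..\<beta>} g'"
    and bounds: "\<And>s. s \<in> {\<alpha>..\<beta>} \<Longrightarrow> 0 \<le> g' s" "\<And>s. s \<in> {\<alpha>..\<beta>} \<Longrightarrow> g' s \<le> M"
    and "1 \<le> g \<beta> - g \<alpha>" and gm [measurable]: "g \<in> borel_measurable borel"
  shows "ennreal ((g \<beta> - g \<alpha>) / 2) * (\<integral>\<^sup>+x. \<phi> x * indicator {0..<1} x \<partial>lborel)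
    \<le> ennreal M * (\<integral>\<^sup>+s. \<phi> (g s) * indicator {\<alpha>..\<beta>} s \<partial>lborel)"
proof -
  have "ennreal ((g \<beta> - g \<alpha>) / 2) * (\<integral>\<^sup>+x. \<phi> x * indicator {0..<1} x \<partial>lborel)
      \<le> (\<integral>\<^sup>+x. \<phi> x * indicator {g \<alpha>..g \<beta>} x \<partial>lborel)"
    by (intro nn_integral_periodic_ge assms)
  also have "\<dots> = (\<integral>\<^sup>+s. \<phi> (g s) * g' s * indicator {\<alpha>..\<beta>} s \<partial>lborel)"
    by (intro nn_integral_substitution_aux assms zero_le)
  also have "\<dots> \<le> (\<integral>\<^sup>+s. ennreal M * (\<phi> (g s) * indicator {\<alpha>..\<beta>} s) \<partial>lborel)"
    using bounds(2) by (intro nn_integral_mono)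
      (auto simp: mult.commute split: split_indicator intro!: mult_right_mono ennreal_leI)
  also have "\<dots> = ennreal M * (\<integral>\<^sup>+s. \<phi> (g s) * indicator {\<alpha>..\<beta>} s \<partial>lborel)"
    by (rule nn_integral_cmult) measurable
  finally show ?thesis .
qed

section \<open>The forcing, its slope and its critical points\<close>

lemma abs_sin_of_int: "\<bar>sin (pi * of_int m + \<theta>)\<bar> = \<bar>sin \<theta>\<bar>" for \<theta> :: real
  by (simp add: sin_add sin_npi_int cos_npi_int abs_mult)

lemma abs_cos_of_int: "\<bar>cos (pi * of_int m + \<theta>)\<bar> = \<bar>cos \<theta>\<bar>" for \<theta> :: real
  by (simp add: cos_add sin_npi_int cos_npi_int abs_mult)

lemma sin_ge_half:
  fixes x :: real
  assumes "0 \<le> x" "x \<le> pi / 3"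
  shows "x / 2 \<le> sin x"
proof (cases "x = 0")
  case False
  then have "0 < x" using assms by simp
  obtain z where z: "0 < z" "z < x" "sin x - sin 0 = (x - 0) * cos z"
    using MVT2[OF \<open>0 < x\<close>, of sin cos] by (auto intro: DERIV_sin)
  have "cos (pi / 3) \<le> cos z"
    using z assms by (intro cos_monotone_0_pi_le) auto
  then have "x * (1 / 2) \<le> x * cos z"
    using assms(1) by (intro mult_left_mono) (simp_all add: cos_60)
  then show ?thesis using z by simp
qed simp

text \<open>The zeros of sine and cosine of 2 pi s are the multiples of 1/4, and \<open>s\<close>
  keeps distance \<sigma>/8 from them. After reduction to one quarter both values are at least sin
  (pi \<sigma>/4) \<ge> pi \<sigma>/8 \<ge> 3 \<sigma>/8.\<close>

lemma quarter_gap: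
  fixes s \<sigma> :: real and k :: int
  assumes \<sigma>: "0 < \<sigma>" "\<sigma> \<le> 1 / 8"
    and s: "of_int k / 4 + \<sigma> / 8 \<le> s" "s \<le> (of_int k + 1) / 4 - \<sigma> / 8"
  shows "3 * \<sigma> / 8 \<le> \<bar>sin (2 * pi * s)\<bar>" "3 * \<sigma> / 8 \<le> \<bar>cos (2 * pi * s)\<bar>"
proof -
  define \<theta> where "\<theta> = 2 * pi * (s - of_int k / 4)"
  have "2 * pi * (\<sigma> / 8) \<le> \<theta>" "\<theta> \<le> 2 * pi * (1 / 4 - \<sigma> / 8)"
    unfolding \<theta>_def using s by (auto intro!: mult_left_mono simp: add_divide_distrib)
  then have \<theta>: "pi * \<sigma> / 4 \<le> \<theta>" "\<theta> \<le> pi / 2 - pi * \<sigma> / 4"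
    by (simp_all add: algebra_simps)
  have "3 * \<sigma> / 8 \<le> (pi * \<sigma> / 4) / 2"
    using pi_gt3 \<sigma>(1) by simp
  also have "\<dots> \<le> sin (pi * \<sigma> / 4)"
    using \<sigma> by (intro sin_ge_half) auto
  finally have base: "3 * \<sigma> / 8 \<le> sin (pi * \<sigma> / 4)" .
  have pos: "0 \<le> pi * \<sigma> / 4" using \<sigma> by simp
  have s1: "3 * \<sigma> / 8 \<le> sin \<theta>"
  proof -
    have "sin (pi * \<sigma> / 4) \<le> sin \<theta>"
      using \<theta> pos by (intro sin_monotone_2pi_le) linarith+
    then show ?thesis using base by simp
  qed
  have c1: "3 * \<sigma> / 8 \<le> cos \<theta>"
  proof -
    have "sin (pi * \<sigma> / 4) \<le> sin (pi / 2 - \<theta>)"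
      using \<theta> pos by (intro sin_monotone_2pi_le) linarith+
    then show ?thesis using base by (simp add: cos_sin_eq)
  qed
  have "3 * \<sigma> / 8 \<le> \<bar>sin (2 * pi * s)\<bar> \<and> 3 * \<sigma> / 8 \<le> \<bar>cos (2 * pi * s)\<bar>"
  proof (cases "even k")
    case True
    then obtain m where "k = 2 * m" by (rule evenE)
    then have eq: "2 * pi * s = pi * of_int m + \<theta>"
      by (simp add: \<theta>_def algebra_simps)
    show ?thesis
      unfolding eq abs_sin_of_int abs_cos_of_int using s1 c1 by auto
  next
    case False
    then obtain m where "k = 2 * m + 1" by (rule oddE)
    then have eq: "2 * pi * s = pi * of_int m + (\<theta> + pi / 2)"
      by (simp add: \<theta>_def algebra_simps add_divide_distrib)
    show ?thesis
      unfolding eq abs_sin_of_int abs_cos_of_int using s1 c1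
      by (simp add: sin_add cos_add abs_if)
  qed
  then show "3 * \<sigma> / 8 \<le> \<bar>sin (2 * pi * s)\<bar>" "3 * \<sigma> / 8 \<le> \<bar>cos (2 * pi * s)\<bar>"
    by auto
qed

definition forcing :: "real \<Rightarrow> real \<Rightarrow> real" where
  "forcing L s = L * cos (2 * pi * s)"

definition forcing_deriv :: "real \<Rightarrow> real \<Rightarrow> real" where
  "forcing_deriv L s = - (2 * pi * L * sin (2 * pi * s))"

lemma DERIV_forcing: "(forcing L has_real_derivative forcing_deriv L s) (at s)"
  unfolding forcing_def[abs_def] forcing_deriv_def by (auto intro!: derivative_eq_intros)

lemma DERIV_forcing_deriv: "(forcing_deriv L has_real_derivative - (4 * pi\<^sup>2 * L * cos (2 * pi * s))) (at s)"
  unfolding forcing_deriv_def[abs_def] by (auto intro!: derivative_eq_intros simp: power2_eq_square)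

lemma continuous_forcing_deriv: "continuous_on A (forcing_deriv L)"
  unfolding forcing_deriv_def[abs_def] by (intro continuous_intros)

lemma forcing_measurable [measurable]: "forcing L \<in> borel_measurable borel"
  unfolding forcing_def[abs_def] by measurable

lemma forcing_deriv_measurable [measurable]: "forcing_deriv L \<in> borel_measurable borel"
  unfolding forcing_deriv_def[abs_def] by measurable

lemma cos_period: "cos (2 * pi * (x + of_int k)) = cos (2 * pi * x)"
proof -
  have "2 * pi * (x + of_int k) = 2 * pi * x + pi * of_int (2 * k)" by (simp add: algebra_simps)
  then show ?thesis by (simp only: cos_add sin_npi_int cos_npi_int) simp
qed

lemma sin_period: "sin (2 * pi * (x + of_int k)) = sin (2 * pi * x)"
proof -
  have "2 * pi * (x + of_int k) = 2 * pi * x + pi * of_int (2 * k)" by (simp add: algebra_simps)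
  then show ?thesis by (simp only: sin_add sin_npi_int cos_npi_int) simp
qed

lemma forcing_period: "forcing L (x + of_int k) = forcing L x"
  by (simp add: forcing_def cos_period)

lemma forcing_deriv_period: "forcing_deriv L (x + of_int k) = forcing_deriv L x"
  by (simp add: forcing_deriv_def sin_period)

text \<open>As \<sigma> \<le> 1/8, moving from \<open>p\<close> towards the farther end of its
  quarter period leaves room for an interval of length \<sigma>/4 that avoids both ends by
  \<sigma>/8.\<close>

lemma subinterval_away:
  fixes p \<sigma> :: real
  assumes \<sigma>: "0 < \<sigma>" "\<sigma> \<le> 1 / 8"
  obtains \<alpha> and k :: int where "p - \<sigma> / 2 \<le> \<alpha>" "\<alpha> + \<sigma> / 4 \<le> p + \<sigma> / 2"
    "of_int k / 4 + \<sigma> / 8 \<le> \<alpha>" "\<alpha> + \<sigma> / 4 \<le> (of_int k + 1) / 4 - \<sigma> / 8"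
proof -
  define k where "k = \<lfloor>4 * p\<rfloor>"
  have k: "of_int k \<le> 4 * p" "4 * p < of_int k + 1"
    unfolding k_def by linarith+
  show thesis
  proof (cases "p \<le> of_int k / 4 + 1 / 8")
    case True
    show thesis
      by (rule that[of "p + \<sigma> / 8" k]) (use True k \<sigma> in \<open>simp_all add: field_simps\<close>)
  next
    case False
    show thesis
      by (rule that[of "p - 3 * \<sigma> / 8" k]) (use False k \<sigma> in \<open>simp_all add: field_simps\<close>)
  qed
qed

lemma constant_sign:
  fixes g :: "real \<Rightarrow> real"
  assumes "continuous_on {a..b} g" "\<And>x. x \<in> {a..b} \<Longrightarrow> g x \<noteq> 0" "a \<le> b"
  shows "(\<forall>x\<in>{a..b}. 0 < g x) \<or> (\<forall>x\<in>{a..b}. g x < 0)"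
proof (rule ccontr)
  assume "\<not> ?thesis"
  then obtain x y where xy: "x \<in> {a..b}" "y \<in> {a..b}" "g x \<le> 0" "0 \<le> g y"
    by (meson not_le)
  have "connected (g ` {a..b})"
    by (intro connected_continuous_image assms) simp
  then have "0 \<in> g ` {a..b}"
    by (rule connectedD_interval[OF _ imageI[OF xy(1)] imageI[OF xy(2)] xy(3,4)])
  then show False using assms(2) by auto
qed

lemma abs_diff_sin_le: "\<bar>sin x - sin y\<bar> \<le> \<bar>x - y\<bar>" for x y :: real
proof -
  have "sin x - sin y = 2 * sin ((x - y) / 2) * cos ((x + y) / 2)"
    by (rule sin_diff_sin)
  also have "\<bar>\<dots>\<bar> \<le> 2 * \<bar>sin ((x - y) / 2)\<bar> * 1"
    unfolding abs_mult by (intro mult_mono) auto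
  also have "\<dots> \<le> 2 * \<bar>(x - y) / 2\<bar>"
    using abs_sin_x_le_abs_x[of "(x - y) / 2"] by simp
  finally show ?thesis by simp
qed

text \<open>Every window of length \<open>\<sigma>\<close> contains a subinterval, of comparable length, on which \<open>f\<close> is
  monotone with bounded distortion and wraps at least once around the circle, so that the image of
  Lebesgue measure dominates a multiple of itself. The number \<open>\<tau>\<close> is a value of the slope to be
  avoided.\<close>

lemma good_interval:
  fixes L \<sigma> p \<tau> :: real
  assumes \<sigma>: "0 < \<sigma>" "\<sigma> \<le> 1 / 8" and L: "100 \<le> L * \<sigma>\<^sup>2"
  obtains \<alpha> \<beta> where "p - \<sigma> / 2 \<le> \<alpha>" "\<alpha> < \<beta>" "\<beta> \<le> p + \<sigma> / 2"
    "\<And>s. s \<in> {\<alpha>..\<beta>} \<Longrightarrow> 1 + 2 / \<sigma> \<le> \<bar>forcing_deriv L s\<bar>"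
    "\<And>s. s \<in> {\<alpha>..\<beta>} \<Longrightarrow> 1 \<le> \<bar>forcing_deriv L s - \<tau>\<bar>"
    "\<And>w h. 0 < h \<Longrightarrow> h < 1 / 2 \<Longrightarrow> ennreal (\<sigma> * h / 108)
       \<le> (\<integral>\<^sup>+s. indicator {s. near h (forcing L s - w)} s * indicator {\<alpha>..\<beta>} s \<partial>lborel)"
proof -
  obtain \<alpha>\<^sub>0 and k :: int where \<alpha>\<^sub>0: "p - \<sigma> / 2 \<le> \<alpha>\<^sub>0" "\<alpha>\<^sub>0 + \<sigma> / 4 \<le> p + \<sigma> / 2"
    "of_int k / 4 + \<sigma> / 8 \<le> \<alpha>\<^sub>0" "\<alpha>\<^sub>0 + \<sigma> / 4 \<le> (of_int k + 1) / 4 - \<sigma> / 8"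
    using subinterval_away[OF \<sigma>] .
  let ?I = "{\<alpha>\<^sub>0..\<alpha>\<^sub>0 + \<sigma> / 4}"
  have sc: "3 * \<sigma> / 8 \<le> \<bar>sin (2 * pi * s)\<bar>" "3 * \<sigma> / 8 \<le> \<bar>cos (2 * pi * s)\<bar>" if "s \<in> ?I" for s
    using that \<alpha>\<^sub>0 by (intro quarter_gap[OF \<sigma>, of k]; simp)+
  have L\<sigma>: "100 / \<sigma> \<le> L * \<sigma>"
    using L \<sigma> by (simp add: field_simps power2_eq_square)
  have Lpos: "0 < L"
    using L \<sigma> by (smt (verit) mult_nonpos_nonneg zero_le_power2)
  \<comment> \<open>|f'| is at least 2 pi L times 3 \<sigma>/8, with pi > 3.\<close>
  have df_ge: "(9 / 4) * L * \<sigma> \<le> \<bar>forcing_deriv L s\<bar>" if "s \<in> ?I" for s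
  proof -
    have "(9 / 4) * L * \<sigma> = (2 * 3 * L) * (3 * \<sigma> / 8)" by simp
    also have "\<dots> \<le> (2 * pi * L) * \<bar>sin (2 * pi * s)\<bar>"
      using pi_gt3 Lpos sc(1)[OF that] \<sigma> by (intro mult_mono) auto
    finally show ?thesis using Lpos by (simp add: forcing_deriv_def abs_mult)
  qed
  \<comment> \<open>The cosine is bounded below as well, so f' varies at rate at least 36 L * 3
    \<sigma>/8 and cannot linger near \<tau>.\<close>
  have df_diff: "(27 / 2) * L * \<sigma> * \<bar>s - s'\<bar> \<le> \<bar>forcing_deriv L s - forcing_deriv L s'\<bar>" if "s \<in> ?I" "s' \<in> ?I" for s s'
  proof -
    have *: "(27 / 2) * L * \<sigma> * (s' - s) \<le> \<bar>forcing_deriv L s' - forcing_deriv L s\<bar>" if ss: "s \<in> ?I" "s' \<in> ?I" "s < s'" for s s'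
    proof -
      obtain z where z: "s < z" "z < s'" "forcing_deriv L s' - forcing_deriv L s = (s' - s) * - (4 * pi\<^sup>2 * L * cos (2 * pi * z))"
        using MVT2[OF ss(3), of "forcing_deriv L" "\<lambda>z. - (4 * pi\<^sup>2 * L * cos (2 * pi * z))"] DERIV_forcing_deriv by blast
      have "z \<in> ?I" using z ss by auto
      have "(3::real)\<^sup>2 \<le> pi\<^sup>2" using pi_gt3 by (intro power_mono) auto
      then have "(4 * 9 * L) * (3 * \<sigma> / 8) \<le> (4 * pi\<^sup>2 * L) * \<bar>cos (2 * pi * z)\<bar>"
        using Lpos sc(2)[OF \<open>z \<in> ?I\<close>] \<sigma> by (intro mult_mono) auto
      then have "(s' - s) * ((4 * 9 * L) * (3 * \<sigma> / 8)) \<le> (s' - s) * ((4 * pi\<^sup>2 * L) * \<bar>cos (2 * pi * z)\<bar>)"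
        using ss(3) by (intro mult_left_mono) auto
      also have "\<dots> = \<bar>forcing_deriv L s' - forcing_deriv L s\<bar>"
        unfolding z(3) using Lpos ss(3) by (simp add: abs_mult)
      finally show ?thesis by (simp add: mult_ac)
    qed
    show ?thesis
    proof (cases s s' rule: linorder_cases)
      case less
      then have "\<bar>s - s'\<bar> = s' - s" by simp
      then show ?thesis
        using *[OF that less] by (simp only: abs_minus_commute)
    next
      case greater
      then have "\<bar>s - s'\<bar> = s - s'" by simp
      then show ?thesis
        using *[OF that(2,1) greater] by (simp only:)
    qed simp
  qed
  \<comment> \<open>Cut the interval into thirds of length \<sigma>/12. If both outer thirds
    contained a slope within 1 of \<tau>, two slopes taken at distance \<sigma>/12 or more would
    differ by less than 2, against (9/8) L \<sigma>^2 > 112.\<close>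
  have "\<exists>\<alpha>. \<alpha>\<^sub>0 \<le> \<alpha> \<and> \<alpha> + \<sigma> / 12 \<le> \<alpha>\<^sub>0 + \<sigma> / 4 \<and> (\<forall>s\<in>{\<alpha>..\<alpha> + \<sigma> / 12}. 1 \<le> \<bar>forcing_deriv L s - \<tau>\<bar>)"
  proof (rule ccontr)
    assume neg: "\<not> ?thesis"
    from neg[THEN not_ex[THEN iffD1], THEN spec, of \<alpha>\<^sub>0] obtain s where
      s: "s \<in> {\<alpha>\<^sub>0..\<alpha>\<^sub>0 + \<sigma> / 12}" "\<bar>forcing_deriv L s - \<tau>\<bar> < 1" using \<sigma> by force
    from neg[THEN not_ex[THEN iffD1], THEN spec, of "\<alpha>\<^sub>0 + \<sigma> / 6"] obtain s' where
      s': "s' \<in> {\<alpha>\<^sub>0 + \<sigma> / 6..\<alpha>\<^sub>0 + \<sigma> / 6 + \<sigma> / 12}" "\<bar>forcing_deriv L s' - \<tau>\<bar> < 1" using \<sigma> by force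
    have "(27 / 2) * L * \<sigma> * \<bar>s - s'\<bar> \<le> \<bar>forcing_deriv L s - forcing_deriv L s'\<bar>"
      using s s' \<sigma> by (intro df_diff) auto
    moreover have "(27 / 2) * L * \<sigma> * (\<sigma> / 12) \<le> (27 / 2) * L * \<sigma> * \<bar>s - s'\<bar>"
      using s s' \<sigma> Lpos by (intro mult_left_mono) auto
    moreover have "(27 / 2) * L * \<sigma> * (\<sigma> / 12) = (9 / 8) * (L * \<sigma>\<^sup>2)"
      by (simp add: power2_eq_square)
    ultimately show False using s(2) s'(2) L by linarith
  qed
  then obtain \<alpha> where \<alpha>: "\<alpha>\<^sub>0 \<le> \<alpha>" "\<alpha> + \<sigma> / 12 \<le> \<alpha>\<^sub>0 + \<sigma> / 4"
    and avoid: "\<And>s. s \<in> {\<alpha>..\<alpha> + \<sigma> / 12} \<Longrightarrow> 1 \<le> \<bar>forcing_deriv L s - \<tau>\<bar>" by blast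
  define \<beta> where "\<beta> = \<alpha> + \<sigma> / 12"
  have sub: "s \<in> ?I" if "s \<in> {\<alpha>..\<beta>}" for s
    using that \<alpha> by (auto simp: \<beta>_def)
  have "\<alpha> < \<beta>" using \<sigma> by (simp add: \<beta>_def)
  \<comment> \<open>Over length \<sigma>/12 the sine changes by at most 2 \<sigma>/3, less than
    twice its lower bound 3 \<sigma>/8.\<close>
  have distortion: "\<bar>forcing_deriv L s\<bar> \<le> 3 * \<bar>forcing_deriv L s'\<bar>" if "s \<in> {\<alpha>..\<beta>}" "s' \<in> {\<alpha>..\<beta>}" for s s'
  proof -
    have "\<bar>sin (2 * pi * s) - sin (2 * pi * s')\<bar> \<le> \<bar>2 * pi * s - 2 * pi * s'\<bar>"
      by (rule abs_diff_sin_le)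
    also have "\<dots> = 2 * pi * \<bar>s - s'\<bar>"
      by (simp add: right_diff_distrib[symmetric] abs_mult)
    also have "\<dots> \<le> 2 * 4 * (\<sigma> / 12)"
    proof -
      have "\<bar>s - s'\<bar> \<le> \<sigma> / 12"
        using that by (intro abs_leI) (auto simp: \<beta>_def)
      then show ?thesis using pi_less_4 by (intro mult_mono) auto
    qed
    finally have "\<bar>sin (2 * pi * s)\<bar> \<le> 3 * \<bar>sin (2 * pi * s')\<bar>"
      using sc(1)[OF sub[OF that(2)]] \<sigma> by linarith
    then have "(2 * pi * L) * \<bar>sin (2 * pi * s)\<bar> \<le> (2 * pi * L) * (3 * \<bar>sin (2 * pi * s')\<bar>)"
      using Lpos by (intro mult_left_mono) auto
    then show ?thesis using Lpos by (simp add: forcing_deriv_def abs_mult)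
  qed
  define m where "m = \<bar>forcing_deriv L \<alpha>\<bar>"
  have m_ge: "(9 / 4) * L * \<sigma> \<le> m"
    unfolding m_def using \<open>\<alpha> < \<beta>\<close> by (intro df_ge sub) auto
  have "0 < 9 / 4 * L * \<sigma>" using Lpos \<sigma> by simp
  then have m_pos: "0 < m" using m_ge by (rule less_le_trans)
  have df_le: "\<bar>forcing_deriv L s\<bar> \<le> 3 * m" and df_ge': "m / 3 \<le> \<bar>forcing_deriv L s\<bar>" if "s \<in> {\<alpha>..\<beta>}" for s
    using distortion[of s \<alpha>] distortion[of \<alpha> s] that \<open>\<alpha> < \<beta>\<close> by (auto simp: m_def)
  \<comment> \<open>The sign \<open>e\<close> makes e f increasing, as substitution wants. The image
    has length at least m \<sigma>/36 and the slope is at most 3 m, so an arc of length 2 h receives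
    at least (m \<sigma>/36) / 2 times 2 h, divided by 3 m, which is \<sigma> h/108.\<close>
  have key: "ennreal (\<sigma> * h / 108)
       \<le> (\<integral>\<^sup>+s. indicator {s. near h (e * forcing L s - w)} s * indicator {\<alpha>..\<beta>} s \<partial>lborel)"
    if h: "0 < h" "h < 1 / 2" and e: "\<And>s. s \<in> {\<alpha>..\<beta>} \<Longrightarrow> e * forcing_deriv L s = \<bar>forcing_deriv L s\<bar>" for h w e
  proof -
    let ?X = "\<integral>\<^sup>+s. indicator {s. near h (e * forcing L s - w)} s * indicator {\<alpha>..\<beta>} s \<partial>lborel"
    have D: "((\<lambda>s. e * forcing L s) has_real_derivative e * forcing_deriv L s) (at s)" for s
      by (rule DERIV_cmult[OF DERIV_forcing])
    have gap: "m * \<sigma> / 36 \<le> e * forcing L \<beta> - e * forcing L \<alpha>"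
    proof -
      obtain z where z: "\<alpha> < z" "z < \<beta>" "e * forcing L \<beta> - e * forcing L \<alpha> = (\<beta> - \<alpha>) * (e * forcing_deriv L z)"
        using MVT2[OF \<open>\<alpha> < \<beta>\<close>, of "\<lambda>s. e * forcing L s" "\<lambda>s. e * forcing_deriv L s"] D by blast
      have "(\<sigma> / 12) * (m / 3) \<le> (\<beta> - \<alpha>) * (e * forcing_deriv L z)"
        using z df_ge'[of z] e[of z] \<sigma> m_pos by (intro mult_mono) (auto simp: \<beta>_def)
      then show ?thesis using z by (simp add: mult_ac)
    qed
    \<comment> \<open>m \<sigma> \<ge> 225, so the image is longer than six periods.\<close>
    have one: "1 \<le> m * \<sigma> / 36"
    proof -
      have "(9 / 4) * L * \<sigma> * \<sigma> \<le> m * \<sigma>"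
        using m_ge \<sigma> by (intro mult_right_mono) auto
      then show ?thesis using L by (simp add: power2_eq_square mult_ac)
    qed
    have J: "(\<integral>\<^sup>+x. indicator {x. near h (x - w)} x * indicator {0..<1} x \<partial>lborel) = ennreal (2 * h)"
      using h by (intro nn_integral_near) auto
    have per: "indicator {x. near h (x - w)} (x + 1) = (indicator {x. near h (x - w)} x :: ennreal)" for x
      using near_add_int[of h "x - w" 1] by (simp add: indicator_def algebra_simps)
    have "ennreal ((m * \<sigma> / 36) / 2) * ennreal (2 * h)
        \<le> ennreal ((e * forcing L \<beta> - e * forcing L \<alpha>) / 2) * ennreal (2 * h)"
      using gap by (intro mult_right_mono ennreal_leI divide_right_mono) simp_all
    also have "\<dots> \<le> ennreal (3 * m) * (\<integral>\<^sup>+s. indicator {x. near h (x - w)} (e * forcing L s) * indicator {\<alpha>..\<beta>} s \<partial>lborel)"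
      unfolding J[symmetric]
    proof (rule nn_integral_pullback_ge[where \<phi> = "indicator {x. near h (x - w)}" and g = "\<lambda>s. e * forcing L s"
          and g' = "\<lambda>s. e * forcing_deriv L s"])
      show "((\<lambda>s. e * forcing L s) has_real_derivative e * forcing_deriv L s) (at s)" for s
        by (rule D)
      show "continuous_on {\<alpha>..\<beta>} (\<lambda>s. e * forcing_deriv L s)"
        by (intro continuous_intros continuous_forcing_deriv)
      show "1 \<le> e * forcing L \<beta> - e * forcing L \<alpha>" using gap one by linarith
    qed (use e df_le per \<open>\<alpha> < \<beta>\<close> in simp_all)
    also have "(\<lambda>s. indicator {x. near h (x - w)} (e * forcing L s) * indicator {\<alpha>..\<beta>} s :: ennreal)
        = (\<lambda>s. indicator {s. near h (e * forcing L s - w)} s * indicator {\<alpha>..\<beta>} s)"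
      by (auto simp: indicator_def)
    finally have "ennreal (3 * m) * ennreal (\<sigma> * h / 108) \<le> ennreal (3 * m) * ?X"
      using m_pos \<sigma> h by (simp add: ennreal_mult[symmetric] mult_ac)
    then show ?thesis
      using m_pos by (subst (asm) ennreal_mult_le_mult_iff) auto
  qed
  have sgn: "(\<forall>s\<in>{\<alpha>..\<beta>}. 0 < forcing_deriv L s) \<or> (\<forall>s\<in>{\<alpha>..\<beta>}. forcing_deriv L s < 0)"
  proof (rule constant_sign[OF continuous_forcing_deriv])
    show "forcing_deriv L s \<noteq> 0" if "s \<in> {\<alpha>..\<beta>}" for s
      using df_ge'[OF that] m_pos by auto
  qed (use \<open>\<alpha> < \<beta>\<close> in simp)
  show thesis
  proof (rule that[of \<alpha> \<beta>])
    show "p - \<sigma> / 2 \<le> \<alpha>" "\<alpha> < \<beta>" "\<beta> \<le> p + \<sigma> / 2"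
      using \<alpha> \<alpha>\<^sub>0 \<sigma> by (auto simp: \<beta>_def)
    show "1 + 2 / \<sigma> \<le> \<bar>forcing_deriv L s\<bar>" if "s \<in> {\<alpha>..\<beta>}" for s
    proof -
      have "1 \<le> 1 / \<sigma>" using \<sigma> by simp
      moreover have "2 / \<sigma> = 2 * (1 / \<sigma>)" "100 / \<sigma> = 100 * (1 / \<sigma>)" by simp_all
      moreover have "(9 / 4) * L * \<sigma> = (9 / 4) * (L * \<sigma>)" by simp
      ultimately show ?thesis
        using df_ge[OF sub[OF that]] L\<sigma> by linarith
    qed
    show "1 \<le> \<bar>forcing_deriv L s - \<tau>\<bar>" if "s \<in> {\<alpha>..\<beta>}" for s
      using avoid that by (simp add: \<beta>_def)
    fix w h :: real assume h: "0 < h" "h < 1 / 2"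
    show "ennreal (\<sigma> * h / 108)
       \<le> (\<integral>\<^sup>+s. indicator {s. near h (forcing L s - w)} s * indicator {\<alpha>..\<beta>} s \<partial>lborel)"
      using sgn
    proof
      assume pos: "\<forall>s\<in>{\<alpha>..\<beta>}. 0 < forcing_deriv L s"
      have "1 * forcing_deriv L s = \<bar>forcing_deriv L s\<bar>" if "s \<in> {\<alpha>..\<beta>}" for s
        using bspec[OF pos that] by simp
      from key[OF h this, of w] show ?thesis by simp
    next
      \<comment> \<open>A decreasing f is treated through -f and -w, since \<open>near\<close> is
        symmetric.\<close>
      assume neg: "\<forall>s\<in>{\<alpha>..\<beta>}. forcing_deriv L s < 0"
      have "- 1 * forcing_deriv L s = \<bar>forcing_deriv L s\<bar>" if "s \<in> {\<alpha>..\<beta>}" for s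
        using bspec[OF neg that] by simp
      note * = key[OF h this, of "- w"]
      have "near h (- 1 * forcing L s - - w) \<longleftrightarrow> near h (forcing L s - w)" for s
        using near_minus[of h "forcing L s - w"] by simp
      with * show ?thesis by simp
    qed
  qed
qed

section \<open>The projective bundle\<close>

text \<open>Homogeneous coordinates on the bundle: all real lifts of the position and all nonzero
  multiples of the vector give the same point. The dynamics can thus be written without reduction
  modulo 1 and without normalisation.\<close>

definition bundle_point :: "real \<Rightarrow> real \<Rightarrow> point \<Rightarrow> point \<times> direction" where
  "bundle_point x y v = (mod1 (x, y), dir (v /\<^sub>R norm v))"

lemma dir_minus: "dir (- v) = dir v"
  by (auto simp: dir_def)

lemma dir_scaleR:
  fixes v :: point
  assumes "c \<noteq> 0"
  shows "dir ((c *\<^sub>R v) /\<^sub>R norm (c *\<^sub>R v)) = dir (v /\<^sub>R norm v)"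
proof -
  have *: "(c *\<^sub>R v) /\<^sub>R norm (c *\<^sub>R v) = (inverse \<bar>c\<bar> * c) *\<^sub>R (v /\<^sub>R norm v)"
    by (simp add: mult_ac)
  show ?thesis
  proof (cases "c > 0")
    case True
    then have "inverse \<bar>c\<bar> * c = 1" by simp
    then show ?thesis unfolding * by (simp only: scaleR_one)
  next
    case False
    with assms have "c < 0" by simp
    then have "inverse \<bar>c\<bar> * c = - 1" by (simp add: field_simps)
    then show ?thesis unfolding * by (simp only: scaleR_minus_left scaleR_one dir_minus)
  qed
qed

lemma bundle_point_scaleR: "c \<noteq> 0 \<Longrightarrow> bundle_point x y (c *\<^sub>R v) = bundle_point x y v"
  by (simp add: bundle_point_def dir_scaleR del: norm_scaleR scaleR_scaleR)

lemma mod1_add_int: "mod1 (x + of_int i, y + of_int j) = mod1 (x, y)"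
  by (simp add: mod1_def frac_def)

lemma bundle_point_period: "bundle_point (x + of_int i) (y + of_int j) v = bundle_point x y v"
  by (simp add: bundle_point_def mod1_add_int)

lemma D_torus_map_eq: "D_torus_map L w z v = (forcing_deriv L (fst z + w) * fst v - snd v, fst v)"
proof -
  have "(lift_map L w has_derivative (\<lambda>v. (forcing_deriv L (fst z + w) * fst v - snd v, fst v))) (at z)"
    unfolding lift_map_def[abs_def] forcing_deriv_def
    by (auto intro!: derivative_eq_intros simp: algebra_simps)
  then show ?thesis
    unfolding D_torus_map_def by (simp add: frechet_derivative_at[symmetric])
qed

text \<open>The derivative acts linearly, so normalising before or after it changes the vector only
  by nonzero factors; forcing and slope have period 1.\<close>

lemma proj_step_bundle_point:
  assumes "v \<noteq> 0"
  shows "proj_step L w (bundle_point x y v)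
    = bundle_point (forcing L (x + w) - y) (x + w) (forcing_deriv L (x + w) * fst v - snd v, fst v)"
proof -
  have arg: "frac x + w = (x + w) + of_int (- \<lfloor>x\<rfloor>)" by (simp add: frac_def)
  have 1: "torus_map L w (mod1 (x, y)) = mod1 (forcing L (x + w) - y, x + w)"
  proof -
    have "lift_map L w (mod1 (x, y)) = (forcing L (frac x + w) - frac y, frac x + w)"
      by (simp add: lift_map_def mod1_def forcing_def)
    also have "\<dots> = (forcing L (x + w) - y + of_int \<lfloor>y\<rfloor>, x + w + of_int (- \<lfloor>x\<rfloor>))"
      unfolding arg forcing_period by (simp add: frac_def)
    finally show ?thesis unfolding torus_map_def by (simp only: mod1_add_int)
  qed
  define T where "T v = (forcing_deriv L (x + w) * fst v - snd v, fst v)" for v :: point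
  have D: "D_torus_map L w (mod1 (x, y)) = T"
    unfolding D_torus_map_eq T_def mod1_def fst_conv arg forcing_deriv_period ..
  have T_scale: "T (c *\<^sub>R v) = c *\<^sub>R T v" for c v
    by (simp add: T_def algebra_simps)
  have T_minus: "T (- v) = - T v" for v
    by (simp add: T_def)
  have "(\<lambda>v. T v /\<^sub>R norm (T v)) ` dir (v /\<^sub>R norm v) = dir (T v /\<^sub>R norm (T v))"
  proof -
    have "(\<lambda>v. T v /\<^sub>R norm (T v)) ` dir u = dir (T u /\<^sub>R norm (T u))" for u
      by (simp add: dir_def T_minus)
    then have "(\<lambda>v. T v /\<^sub>R norm (T v)) ` dir (v /\<^sub>R norm v) = dir (T (v /\<^sub>R norm v) /\<^sub>R norm (T (v /\<^sub>R norm v)))" .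
    also have "\<dots> = dir (T v /\<^sub>R norm (T v))"
      unfolding T_scale using assms by (intro dir_scaleR) simp
    finally show ?thesis .
  qed
  then show ?thesis
    unfolding proj_step_def bundle_point_def fst_conv snd_conv 1 D by (simp add: T_def)
qed

section \<open>Measurability on the projective bundle\<close>

lemma dir_measurable: "dir \<in> restrict_space borel (sphere 0 1) \<rightarrow>\<^sub>M proj_line"
  unfolding proj_line_def
proof (rule measurable_measure_of)
  fix A assume "A \<in> {A. A \<subseteq> dir ` sphere 0 1 \<and> {v \<in> sphere 0 1. dir v \<in> A} \<in> sets borel}"
  moreover have "dir -` A \<inter> space (restrict_space borel (sphere 0 1)) = {v \<in> sphere 0 1. dir v \<in> A}"
    by (auto simp: space_restrict_space)
  ultimately show "dir -` A \<inter> space (restrict_space borel (sphere 0 1)) \<in> sets (restrict_space borel (sphere 0 1))"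
    by (auto simp: sets_restrict_space_iff)
qed (auto simp: space_restrict_space)

lemma space_proj_line: "space proj_line = dir ` sphere 0 1"
  unfolding proj_line_def by (intro space_measure_of) auto

lemma space_proj_bundle: "space proj_bundle = torus \<times> dir ` sphere 0 1"
  by (simp add: proj_bundle_def space_pair_measure space_proj_line space_restrict_space)

lemma bundle_point_measurable [measurable (raw)]:
  assumes [measurable]: "a \<in> borel_measurable N" "b \<in> borel_measurable N" and c [measurable]: "c \<in> borel_measurable N"
    and nz: "\<And>x. c x \<noteq> 0"
  shows "(\<lambda>x. bundle_point (a x) (b x) (c x)) \<in> N \<rightarrow>\<^sub>M proj_bundle"
  unfolding bundle_point_def proj_bundle_def
proof (rule measurable_Pair)
  have "(\<lambda>x. (a x, b x)) \<in> N \<rightarrow>\<^sub>M borel"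
    by (rule borel_measurable_Pair) measurable
  then have "(\<lambda>x. mod1 (a x, b x)) \<in> N \<rightarrow>\<^sub>M borel"
    by (rule measurable_compose[OF _ mod1_measurable])
  then show "(\<lambda>x. mod1 (a x, b x)) \<in> N \<rightarrow>\<^sub>M restrict_space borel torus"
    by (intro measurable_restrict_space2) (auto simp: mod1_in_torus)
  have "(\<lambda>x. c x /\<^sub>R norm (c x)) \<in> N \<rightarrow>\<^sub>M restrict_space borel (sphere 0 1)"
    using nz by (intro measurable_restrict_space2) auto
  then show "(\<lambda>x. dir (c x /\<^sub>R norm (c x))) \<in> N \<rightarrow>\<^sub>M proj_line"
    by (rule measurable_compose[OF _ dir_measurable])
qed

text \<open>The quotient sigma-algebra on directions does not by itself make maps out of the bundle
  measurable; this Borel section of \<open>v \<mapsto> {v, -v}\<close> reduces them to maps on unit vectors.\<close>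

definition canon :: "point \<Rightarrow> point" where
  "canon v = (if 0 < snd v \<or> (snd v = 0 \<and> 0 < fst v) then v else - v)"

definition representative :: "direction \<Rightarrow> point" where
  "representative D = canon (SOME v. v \<in> D)"

lemma canon_minus: "v \<noteq> 0 \<Longrightarrow> canon (- v) = canon v"
  by (auto simp: canon_def prod_eq_iff)

lemma representative_dir:
  assumes "v \<noteq> 0"
  shows "representative (dir v) = canon v"
proof -
  have "(SOME u. u \<in> dir v) \<in> dir v"
    by (rule someI[of _ v]) (simp add: dir_def)
  then show ?thesis
    using canon_minus[OF assms] by (auto simp: representative_def dir_def)
qed

lemma dir_canon: "dir (canon v) = dir v"
  by (auto simp: canon_def dir_def)

lemma representative_props:
  assumes "D \<in> space proj_line"
  shows "dir (representative D) = D" "norm (representative D) = 1"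
proof -
  obtain v where v: "norm v = 1" "D = dir v"
    using assms by (auto simp: space_proj_line)
  then have r: "representative D = canon v"
    by (auto intro!: representative_dir)
  show "dir (representative D) = D" unfolding r dir_canon by (rule v(2)[symmetric])
  show "norm (representative D) = 1" unfolding r using v(1) by (simp add: canon_def)
qed

lemma canon_measurable: "canon \<in> borel \<rightarrow>\<^sub>M borel"
proof -
  have "canon = (\<lambda>v. if 0 < snd v \<or> (snd v = 0 \<and> 0 < fst v) then (fst v, snd v) else (- fst v, - snd v))"
    by (auto simp: canon_def fun_eq_iff prod_eq_iff)
  also have "\<dots> \<in> borel \<Otimes>\<^sub>M borel \<rightarrow>\<^sub>M borel \<Otimes>\<^sub>M borel"
    by measurable
  finally show ?thesis by (simp only: borel_prod)
qed

lemma representative_measurable: "representative \<in> proj_line \<rightarrow>\<^sub>M borel"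
proof (rule measurableI)
  fix B :: "point set" assume B: "B \<in> sets borel"
  let ?A = "representative -` B \<inter> space proj_line"
  have "{v \<in> sphere 0 1. dir v \<in> ?A} = sphere 0 1 \<inter> canon -` B"
  proof -
    have "representative (dir v) = canon v" if "v \<in> sphere 0 1" for v
      using that by (intro representative_dir) auto
    then show ?thesis unfolding space_proj_line by auto
  qed
  also have "\<dots> \<in> sets borel"
    using measurable_sets[OF canon_measurable B] by (intro sets.Int) auto
  finally have "?A \<in> {A. A \<subseteq> dir ` sphere 0 1 \<and> {v \<in> sphere 0 1. dir v \<in> A} \<in> sets borel}"
    by (auto simp: space_proj_line)
  then show "?A \<in> sets proj_line"
    unfolding proj_line_def by (intro in_measure_of) auto
qed simp

text \<open>Gives homogeneous coordinates to an arbitrary state, so that the coordinate formulas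
  cover the whole bundle.\<close>

lemma proj_bundle_eq:
  assumes "u \<in> space proj_bundle"
  shows "u = bundle_point (fst (fst u)) (snd (fst u)) (representative (snd u))"
    and "representative (snd u) \<noteq> 0"
proof -
  have u: "fst u \<in> torus" "snd u \<in> space proj_line"
    using assms by (auto simp: space_proj_bundle space_proj_line)
  note r = representative_props[OF u(2)]
  show "representative (snd u) \<noteq> 0"
    using r(2) by (metis norm_zero zero_neq_one)
  show "u = bundle_point (fst (fst u)) (snd (fst u)) (representative (snd u))"
    unfolding bundle_point_def prod.collapse r(2) mod1_torus[OF u(1)] by (simp add: r(1))
qed

lemma proj_step_measurable:
  assumes [measurable_cong]: "sets \<mu> = sets borel"
  shows "(\<lambda>(w, u). proj_step L w u) \<in> \<mu> \<Otimes>\<^sub>M proj_bundle \<rightarrow>\<^sub>M proj_bundle"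
proof -
  define x y r where "x = (\<lambda>p::real \<times> (point \<times> direction). fst (fst (snd p)))"
    and "y = (\<lambda>p::real \<times> (point \<times> direction). snd (fst (snd p)))"
    and "r = (\<lambda>p::real \<times> (point \<times> direction). representative (snd (snd p)))"
  let ?N = "\<mu> \<Otimes>\<^sub>M proj_bundle"
  have z: "(\<lambda>p. fst (snd p)) \<in> ?N \<rightarrow>\<^sub>M borel \<Otimes>\<^sub>M borel"
    unfolding proj_bundle_def borel_prod
    by (intro measurable_compose[OF measurable_snd] measurable_compose[OF measurable_fst] measurable_restrict_space1) simp
  have [measurable]: "x \<in> borel_measurable ?N" "y \<in> borel_measurable ?N"
    unfolding x_def y_def
    using measurable_compose[OF z measurable_fst] measurable_compose[OF z measurable_snd] by simp_all
  have "r \<in> ?N \<rightarrow>\<^sub>M borel"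
    unfolding r_def proj_bundle_def
    by (intro measurable_compose[OF measurable_snd] measurable_compose[OF _ representative_measurable] measurable_snd)
  then have "r \<in> ?N \<rightarrow>\<^sub>M borel \<Otimes>\<^sub>M borel" by (simp only: borel_prod)
  from measurable_compose[OF this measurable_fst] measurable_compose[OF this measurable_snd]
  have [measurable]: "(\<lambda>p. fst (r p)) \<in> borel_measurable ?N" "(\<lambda>p. snd (r p)) \<in> borel_measurable ?N"
    by simp_all
  have [measurable]: "fst \<in> borel_measurable ?N"
    using measurable_fst[of \<mu> proj_bundle] by (simp cong: measurable_cong_sets)
  \<comment> \<open>\<open>bundle_point_measurable\<close> asks for a vector that vanishes nowhere,
    hence a default value where the formula gives 0; on the space this does not occur.\<close>
  define c where "c p = (let v = (forcing_deriv L (x p + fst p) * fst (r p) - snd (r p), fst (r p)) in if v = 0 then (1, 0) else v)" for p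
  have cm: "c \<in> ?N \<rightarrow>\<^sub>M borel"
  proof -
    have "c = (\<lambda>p. if forcing_deriv L (x p + fst p) * fst (r p) - snd (r p) = 0 \<and> fst (r p) = 0 then (1, 0)
        else (forcing_deriv L (x p + fst p) * fst (r p) - snd (r p), fst (r p)))"
      by (auto simp: c_def fun_eq_iff Let_def zero_prod_def)
    also have "\<dots> \<in> ?N \<rightarrow>\<^sub>M borel \<Otimes>\<^sub>M borel" by measurable
    finally show ?thesis by (simp only: borel_prod)
  qed
  have "c p \<noteq> 0" for p by (simp add: c_def Let_def zero_prod_def)
  then have m: "(\<lambda>p. bundle_point (forcing L (x p + fst p) - y p) (x p + fst p) (c p)) \<in> ?N \<rightarrow>\<^sub>M proj_bundle"
    by (intro bundle_point_measurable[OF _ _ cm]) measurable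
  have "(\<lambda>(w, u). proj_step L w u) p = bundle_point (forcing L (x p + fst p) - y p) (x p + fst p) (c p)"
    if "p \<in> space ?N" for p
  proof -
    have u: "snd p \<in> space proj_bundle" using that by (auto simp: space_pair_measure)
    have rp: "r p \<noteq> 0" using proj_bundle_eq(2)[OF u] by (simp add: r_def)
    then have "(forcing_deriv L (x p + fst p) * fst (r p) - snd (r p), fst (r p)) \<noteq> 0"
      by (auto simp: prod_eq_iff)
    then have "c p = (forcing_deriv L (x p + fst p) * fst (r p) - snd (r p), fst (r p))"
      by (simp add: c_def Let_def)
    moreover have "snd p = bundle_point (x p) (y p) (r p)"
      using proj_bundle_eq(1)[OF u] by (simp add: x_def y_def r_def)
    ultimately show ?thesis
      using proj_step_bundle_point[OF rp, of L "fst p" "x p" "y p"] by (simp add: case_prod_beta)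
  qed
  then show ?thesis using m by (subst measurable_cong) auto
qed

lemma random_map_proj: "L > 0 \<Longrightarrow> random_map (noise_law L \<delta>) proj_bundle (proj_step L)"
  by (intro random_map.intro random_map_axioms.intro prob_space_noise_law proj_step_measurable) simp_all

lemma proj_process_eq_orbit: "proj_process L u n \<omega> = orbit (proj_step L) u n \<omega>"
  by (induction n) auto

lemma proj_stationary_iff:
  assumes "L > 0"
  shows "proj_stationary L \<delta> \<nu> \<longleftrightarrow> random_map.stationary (noise_law L \<delta>) proj_bundle (proj_step L) \<nu>"
proof -
  interpret random_map "noise_law L \<delta>" proj_bundle "proj_step L"
    by (rule random_map_proj[OF assms])
  have "emeasure (noise L \<delta>) {\<omega> \<in> space (noise L \<delta>). proj_step L (\<omega> 0) u \<in> A}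
      = emeasure (noise_law L \<delta>) {w \<in> space (noise_law L \<delta>). proj_step L w u \<in> A}"
    if A: "A \<in> sets proj_bundle" and u: "u \<in> space proj_bundle" for A u
  proof -
    let ?B = "{w \<in> space (noise_law L \<delta>). proj_step L w u \<in> A}"
    have B: "?B \<in> sets (noise_law L \<delta>)"
      using measurable_sets[OF measurable_step_at[OF u] A] by (simp add: vimage_def)
    have "distr (noise L \<delta>) (noise_law L \<delta>) (\<lambda>\<omega>. \<omega> 0) = noise_law L \<delta>"
      unfolding noise_eq using prob_space_noise_law[OF assms] by (intro distr_PiM_component) auto
    then have "emeasure (noise_law L \<delta>) ?B = emeasure (distr (noise L \<delta>) (noise_law L \<delta>) (\<lambda>\<omega>. \<omega> 0)) ?B"
      by simp
    also have "\<dots> = emeasure (noise L \<delta>) ((\<lambda>\<omega>. \<omega> 0) -` ?B \<inter> space (noise L \<delta>))"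
      unfolding noise_eq using B by (intro emeasure_distr measurable_component_singleton) auto
    also have "(\<lambda>\<omega>. \<omega> 0) -` ?B \<inter> space (noise L \<delta>) = {\<omega> \<in> space (noise L \<delta>). proj_step L (\<omega> 0) u \<in> A}"
      by auto
    finally show ?thesis ..
  qed
  then show ?thesis
    unfolding proj_stationary_def stationary_def
    by (intro conj_cong refl ball_cong arg_cong2[where f = "(=)"] nn_integral_cong) (auto dest: sets_eq_imp_space_eq)
qed

section \<open>Minorization for the projective process\<close>

text \<open>Outside \<open>[-1,1]\<close> the library's \<open>arcsin\<close> is a junk constant, so it is Borel on the whole line.\<close>

lemma arcsin_measurable [measurable]: "(arcsin :: real \<Rightarrow> real) \<in> borel_measurable borel"
proof -
  have junk: "arcsin y = arcsin 2" if "y \<notin> {- 1..1}" for y :: real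
  proof -
    have "sin x \<noteq> y" "sin x \<noteq> 2" for x :: real
      using that sin_ge_minus_one[of x] sin_le_one[of x] unfolding atLeastAtMost_iff by linarith+
    then show ?thesis by (simp add: arcsin_def)
  qed
  have eq: "arcsin = (\<lambda>y::real. indicator {- 1..1} y *\<^sub>R arcsin y + indicator (- {- 1..1}) y * arcsin 2)"
  proof (rule ext)
    fix y :: real
    show "arcsin y = indicator {- 1..1} y *\<^sub>R arcsin y + indicator (- {- 1..1}) y * arcsin 2"
    proof (cases "y \<in> {- 1..1}")
      case False
      then have "indicator {- 1..1} y = (0 :: real)" "indicator (- {- 1..1}) y = (1 :: real)"
        unfolding indicator_def by auto
      then show ?thesis using junk[OF False] by (simp only: scaleR_zero_left add_0 mult_1)
    qed (simp add: indicator_def)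
  qed
  have [measurable]: "(\<lambda>y::real. indicator {- 1..1} y *\<^sub>R arcsin y) \<in> borel_measurable borel"
    by (intro borel_measurable_continuous_on_indicator continuous_on_arcsin') simp
  have "(\<lambda>y::real. indicator {- 1..1} y *\<^sub>R arcsin y + indicator (- {- 1..1}) y * arcsin 2) \<in> borel_measurable borel"
    by measurable
  then show ?thesis by (simp only: eq[symmetric])
qed

text \<open>\<open>A\<close> solves f'(A a) - q = f'(a): the angle \<open>A a\<close> with incoming
  correction \<open>q\<close> produces the slope that \<open>a\<close> produces without it. With |a|
  \<le> 1/16 the argument of the arcsine is at most 3/4 in size, away from its singularities, and
  the Jacobian of \<open>A\<close> is at least 1/2. The shift is of order |q| / L and |f'| of order
  \<open>L\<close>, so even f moves by at most |q|.\<close>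

lemma slope_substitution:
  fixes L q :: real
  assumes L: "1 \<le> L" and q: "\<bar>q\<bar> \<le> 1 / 2"
  obtains A where "A \<in> borel_measurable borel"
    "\<And>\<psi>. \<psi> \<in> borel_measurable borel \<Longrightarrow> ennreal (1 / 2) * (\<integral>\<^sup>+a. \<psi> (A a) * indicator {- 1 / 16..1 / 16} a \<partial>lborel)
        \<le> (\<integral>\<^sup>+a. \<psi> a * indicator {- 1 / 2..<1 / 2} a \<partial>lborel)"
    "\<And>a. a \<in> {- 1 / 16..1 / 16} \<Longrightarrow> forcing_deriv L (A a) - q = forcing_deriv L a"
    "\<And>a. a \<in> {- 1 / 16..1 / 16} \<Longrightarrow> \<bar>A a - a\<bar> \<le> \<bar>q\<bar> / 2"
    "\<And>a. a \<in> {- 1 / 16..1 / 16} \<Longrightarrow> \<bar>forcing L (A a) - forcing L a\<bar> \<le> \<bar>q\<bar>"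
proof -
  define g where "g a = sin (2 * pi * a) - q / (2 * pi * L)" for a
  define A where "A a = arcsin (g a) / (2 * pi)" for a
  let ?I = "{- 1 / 16..1 / 16} :: real set"
  have small: "\<bar>q / (2 * pi * L)\<bar> \<le> 1 / 4"
  proof -
    have "1 * 1 \<le> pi * L" using pi_gt3 L by (intro mult_mono) auto
    then have "\<bar>q\<bar> / (2 * (pi * L)) \<le> (1 / 2) / (2 * 1)"
      using q by (intro frac_le) auto
    then show ?thesis using L by (simp add: abs_mult mult.assoc)
  qed
  have arg: "\<bar>2 * pi * a\<bar> \<le> pi / 6" if "a \<in> ?I" for a
  proof -
    have "\<bar>a\<bar> \<le> 1 / 12" using that by (intro abs_leI) auto
    then have "2 * pi * \<bar>a\<bar> \<le> 2 * pi * (1 / 12)" by (intro mult_left_mono) auto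
    then show ?thesis by (simp add: abs_mult)
  qed
  have sin_le: "\<bar>sin (2 * pi * a)\<bar> \<le> 1 / 2" if "a \<in> ?I" for a
  proof -
    have "sin \<bar>2 * pi * a\<bar> \<le> sin (pi / 6)"
      using arg[OF that] abs_ge_zero[of "2 * pi * a"] pi_gt_zero by (intro sin_monotone_2pi_le) linarith+
    moreover have "0 \<le> sin \<bar>2 * pi * a\<bar>"
      using arg[OF that] abs_ge_zero[of "2 * pi * a"] pi_gt_zero by (intro sin_ge_zero) linarith+
    moreover have "\<bar>sin (2 * pi * a)\<bar> = \<bar>sin \<bar>2 * pi * a\<bar>\<bar>" by (simp add: abs_if)
    ultimately show ?thesis by (simp add: sin_30)
  qed
  have g_le: "\<bar>g a\<bar> \<le> 3 / 4" if "a \<in> ?I" for a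
    using sin_le[OF that] small unfolding g_def by linarith
  have g_bounds: "- 1 < g a" "g a < 1" "- 1 \<le> g a" "g a \<le> 1" if "a \<in> ?I" for a
    using g_le[OF that] by linarith+
  have dfA: "forcing_deriv L (A a) - q = forcing_deriv L a" if "a \<in> ?I" for a
  proof -
    have "sin (2 * pi * A a) = g a"
      using sin_arcsin[OF g_bounds(3,4)[OF that]] by (simp add: A_def)
    then have "forcing_deriv L (A a) = - (2 * pi * L * g a)" by (simp add: forcing_deriv_def)
    also have "2 * pi * L * g a = 2 * pi * L * sin (2 * pi * a) - q"
      unfolding g_def right_diff_distrib using L by simp
    finally show ?thesis by (simp add: forcing_deriv_def)
  qed
  have root_ge: "1 / 2 \<le> sqrt (1 - z\<^sup>2)" if "\<bar>z\<bar> \<le> 3 / 4" for z :: real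
  proof (rule real_le_rsqrt)
    have "z\<^sup>2 \<le> (3 / 4)\<^sup>2" using that by (intro abs_le_square_iff[THEN iffD1]) simp
    then show "(1 / 2)\<^sup>2 \<le> 1 - z\<^sup>2" by (simp add: power2_eq_square)
  qed
  have arcsin_lip: "\<bar>arcsin y - arcsin z\<bar> \<le> 2 * \<bar>y - z\<bar>" if "\<bar>y\<bar> \<le> 3 / 4" "\<bar>z\<bar> \<le> 3 / 4" for y z
  proof -
    have "norm (arcsin y - arcsin z) \<le> 2 * norm (y - z)"
    proof (rule field_differentiable_bound[where S = "{- 3 / 4..3 / 4}" and f' = "\<lambda>w. inverse (sqrt (1 - w\<^sup>2))"])
      fix w :: real assume w: "w \<in> {- 3 / 4..3 / 4}"
      then have w': "\<bar>w\<bar> \<le> 3 / 4" by (intro abs_leI) auto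
      show "(arcsin has_field_derivative inverse (sqrt (1 - w\<^sup>2))) (at w within {- 3 / 4..3 / 4})"
        using w by (intro has_field_derivative_at_within[OF DERIV_arcsin]) auto
      have "inverse (sqrt (1 - w\<^sup>2)) \<le> inverse (1 / 2)"
        using root_ge[OF w'] by (intro le_imp_inverse_le) auto
      moreover have "0 \<le> inverse (sqrt (1 - w\<^sup>2))"
        using root_ge[OF w'] by (intro inverse_nonnegative_iff_nonnegative[THEN iffD2]) linarith
      ultimately show "norm (inverse (sqrt (1 - w\<^sup>2))) \<le> 2" by simp
    qed (use that in \<open>auto simp: abs_le_iff\<close>)
    then show ?thesis by simp
  qed
  have dist: "2 * pi * \<bar>A a - a\<bar> \<le> \<bar>q\<bar> / (pi * L)" if "a \<in> ?I" for a
  proof -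
    have "arcsin (sin (2 * pi * a)) = 2 * pi * a"
      using arg[OF that] pi_gt_zero by (intro arcsin_sin) linarith+
    then have "2 * pi * (A a - a) = arcsin (g a) - arcsin (sin (2 * pi * a))"
      by (simp add: A_def algebra_simps)
    also have "\<bar>\<dots>\<bar> \<le> 2 * \<bar>g a - sin (2 * pi * a)\<bar>"
      using g_le[OF that] sin_le[OF that] by (intro arcsin_lip) auto
    also have "\<dots> = \<bar>q\<bar> / (pi * L)"
      using L by (simp add: g_def abs_mult)
    finally show ?thesis by (simp add: abs_mult)
  qed
  have piL: "1 \<le> pi * L"
    using mult_mono[of 1 pi 1 L] pi_gt3 L by simp
  have A1: "\<bar>A a - a\<bar> \<le> \<bar>q\<bar> / 2" if "a \<in> ?I" for a
  proof -
    have "2 * \<bar>A a - a\<bar> \<le> 2 * pi * \<bar>A a - a\<bar>"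
      using pi_gt3 by (intro mult_right_mono) auto
    also have "\<dots> \<le> \<bar>q\<bar> / (pi * L)" by (rule dist[OF that])
    also have "\<dots> \<le> \<bar>q\<bar> / 1" using piL by (intro divide_left_mono) auto
    finally show ?thesis by simp
  qed
  have A2: "\<bar>forcing L (A a) - forcing L a\<bar> \<le> \<bar>q\<bar>" if "a \<in> ?I" for a
  proof -
    have "\<bar>cos (2 * pi * A a) - cos (2 * pi * a)\<bar> \<le> \<bar>2 * pi * A a - 2 * pi * a\<bar>"
      using abs_diff_sin_le[of "pi / 2 - 2 * pi * A a" "pi / 2 - 2 * pi * a"]
      by (simp add: cos_sin_eq abs_minus_commute)
    also have "\<dots> = 2 * pi * \<bar>A a - a\<bar>"
      by (simp add: right_diff_distrib[symmetric] abs_mult)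
    also have "\<dots> \<le> \<bar>q\<bar> / (pi * L)" by (rule dist[OF that])
    finally have "L * \<bar>cos (2 * pi * A a) - cos (2 * pi * a)\<bar> \<le> L * (\<bar>q\<bar> / (pi * L))"
      using L by (intro mult_left_mono) auto
    also have "\<dots> = \<bar>q\<bar> / pi" using L by simp
    also have "\<dots> \<le> \<bar>q\<bar> / 1" using pi_gt3 by (intro divide_left_mono) auto
    finally show ?thesis using L by (simp add: forcing_def right_diff_distrib[symmetric] abs_mult)
  qed
  define A' where "A' a = cos (2 * pi * a) * inverse (sqrt (1 - (g a)\<^sup>2))" for a
  have deriv: "(A has_real_derivative A' a) (at a)" if "a \<in> ?I" for a
  proof -
    have "(g has_real_derivative (2 * pi * cos (2 * pi * a))) (at a)"
      unfolding g_def[abs_def] by (auto intro!: derivative_eq_intros)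
    from DERIV_cdivide[OF DERIV_chain2[OF DERIV_arcsin[OF g_bounds(1,2)[OF that]] this], of "2 * pi"]
    show ?thesis unfolding A_def[abs_def] A'_def by (simp add: mult_ac)
  qed
  have A'_ge: "1 / 2 \<le> A' a" if "a \<in> ?I" for a
  proof -
    have "cos (pi / 3) \<le> cos \<bar>2 * pi * a\<bar>"
      using arg[OF that] abs_ge_zero[of "2 * pi * a"] pi_gt_zero by (intro cos_monotone_0_pi_le) linarith+
    then have c: "1 / 2 \<le> cos (2 * pi * a)" by (simp add: cos_60 abs_if split: if_splits)
    have "sqrt (1 - (g a)\<^sup>2) \<le> 1" by simp
    moreover have "0 < sqrt (1 - (g a)\<^sup>2)" using root_ge[OF g_le[OF that]] by linarith
    ultimately have "1 \<le> inverse (sqrt (1 - (g a)\<^sup>2))" by (rule one_le_inverse[rotated])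
    then have "1 / 2 * 1 \<le> A' a"
      unfolding A'_def using c by (intro mult_mono) auto
    then show ?thesis by simp
  qed
  have contA': "continuous_on ?I A'"
    unfolding A'_def[abs_def] g_def[abs_def]
  proof (intro continuous_intros ballI)
    fix a assume "a \<in> ?I"
    then show "sqrt (1 - (sin (2 * pi * a) - q / (2 * pi * L))\<^sup>2) \<noteq> 0"
      using root_ge[OF g_le] unfolding g_def by fastforce
  qed
  have mA: "A \<in> borel_measurable borel"
    unfolding A_def[abs_def] g_def[abs_def] by measurable
  have sub: "ennreal (1 / 2) * (\<integral>\<^sup>+a. \<psi> (A a) * indicator ?I a \<partial>lborel)
        \<le> (\<integral>\<^sup>+a. \<psi> a * indicator {- 1 / 2..<1 / 2} a \<partial>lborel)" if \<psi> [measurable]: "\<psi> \<in> borel_measurable borel" for \<psi>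
  proof -
    note [measurable] = mA
    have "ennreal (1 / 2) * (\<integral>\<^sup>+a. \<psi> (A a) * indicator ?I a \<partial>lborel)
        = (\<integral>\<^sup>+a. ennreal (1 / 2) * (\<psi> (A a) * indicator ?I a) \<partial>lborel)"
      by (rule nn_integral_cmult[symmetric]) measurable
    also have "\<dots> \<le> (\<integral>\<^sup>+a. \<psi> (A a) * ennreal (A' a) * indicator ?I a \<partial>lborel)"
    proof (rule nn_integral_mono)
      fix a show "ennreal (1 / 2) * (\<psi> (A a) * indicator ?I a) \<le> \<psi> (A a) * ennreal (A' a) * indicator ?I a"
      proof (cases "a \<in> ?I")
        case True
        then have "ennreal (1 / 2) * \<psi> (A a) \<le> ennreal (A' a) * \<psi> (A a)"
          using A'_ge by (intro mult_right_mono ennreal_leI) auto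
        then show ?thesis using True by (simp add: mult_ac)
      qed simp
    qed
    also have "\<dots> = (\<integral>\<^sup>+a. \<psi> a * indicator {A (- 1 / 16)..A (1 / 16)} a \<partial>lborel)"
    proof (rule nn_integral_substitution_aux[symmetric, OF \<psi> zero_le deriv contA'])
      show "0 \<le> A' a" if "a \<in> ?I" for a using A'_ge[OF that] by linarith
    qed simp_all
    also have "\<dots> \<le> (\<integral>\<^sup>+a. \<psi> a * indicator {- 1 / 2..<1 / 2} a \<partial>lborel)"
    proof (rule nn_integral_mono)
      \<comment> \<open>The image of [-1/16, 1/16] stays inside one fundamental domain.\<close>
      have "\<bar>A (1 / 16) - 1 / 16\<bar> \<le> 1 / 4" "\<bar>A (- 1 / 16) - (- 1 / 16)\<bar> \<le> 1 / 4"
        using A1[of "1 / 16"] A1[of "- 1 / 16"] q by simp_all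
      then have "A (1 / 16) < 1 / 2" "- 1 / 2 \<le> A (- 1 / 16)" by linarith+
      then show "\<psi> a * indicator {A (- 1 / 16)..A (1 / 16)} a \<le> \<psi> a * indicator {- 1 / 2..<1 / 2} a" for a
        by (auto simp: indicator_def)
    qed
    finally show ?thesis .
  qed
  show thesis
    by (rule that[OF mA sub dfA A1 A2])
qed

section \<open>One step as an integral over the angle\<close>

definition near_ind :: "real \<Rightarrow> real \<Rightarrow> ennreal" where
  "near_ind h x = indicator {x. near h x} x"

lemma near_ind_measurable [measurable]: "near_ind h \<in> borel_measurable borel"
  unfolding near_ind_def[abs_def] by measurable

lemma near_ind_le: "(near h x \<Longrightarrow> near h' x') \<Longrightarrow> near_ind h x \<le> near_ind h' x'"
  by (auto simp: near_ind_def indicator_def)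

lemma near_ind_shift: "\<bar>x' - x\<bar> \<le> d \<Longrightarrow> h + d \<le> h' \<Longrightarrow> near_ind h x \<le> near_ind h' x'"
proof (rule near_ind_le)
  assume "\<bar>x' - x\<bar> \<le> d" "h + d \<le> h'" "near h x"
  then show "near h' x'"
    using near_mono[OF near_add[OF \<open>near h x\<close> nearI[of "x' - x" d]]] by simp
qed

lemma near_ind_add_int: "near_ind h (x + of_int k) = near_ind h x"
  by (simp add: near_ind_def indicator_def)

lemma nkoop_measurable:
  assumes "random_map \<mu> M F" and [measurable]: "\<phi> \<in> borel_measurable M"
  shows "random_map.nkoop \<mu> F \<phi> \<in> borel_measurable M"
proof -
  interpret random_map \<mu> M F by fact
  show ?thesis unfolding nkoop_def[abs_def] by measurable
qed

lemma nkoop_bundle_point: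
  assumes L: "0 < L" and \<sigma>: "\<sigma> = noise_size L \<delta>" and v: "v \<noteq> 0"
    and \<phi> [measurable]: "\<phi> \<in> borel_measurable proj_bundle"
  shows "random_map.nkoop (noise_law L \<delta>) (proj_step L) \<phi> (bundle_point x y v)
    = ennreal (1 / (2 * \<sigma>)) *
      (\<integral>\<^sup>+s. \<phi> (bundle_point (forcing L s - y) s (forcing_deriv L s * fst v - snd v, fst v)) * indicator {x - \<sigma>..x + \<sigma>} s \<partial>lborel)"
proof -
  interpret random_map "noise_law L \<delta>" proj_bundle "proj_step L" by (rule random_map_proj[OF L])
  have \<sigma>pos: "0 < \<sigma>" using L by (simp add: \<sigma> noise_size_def)
  define G where "G s = \<phi> (bundle_point (forcing L s - y) s (forcing_deriv L s * fst v - snd v, fst v))" for s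
  have nz: "(forcing_deriv L s * fst v - snd v, fst v) \<noteq> 0" for s
    using v by (auto simp: zero_prod_def prod_eq_iff)
  have vm: "(\<lambda>s. (forcing_deriv L s * fst v - snd v, fst v)) \<in> borel_measurable borel"
    by (rule borel_measurable_Pair) measurable
  have G [measurable]: "G \<in> borel_measurable borel"
    unfolding G_def by (intro measurable_compose[OF _ \<phi>] bundle_point_measurable vm nz) measurable
  have "nkoop \<phi> (bundle_point x y v) = (\<integral>\<^sup>+w. G (w + x) \<partial>uniform_measure lborel {- \<sigma>..\<sigma>})"
    unfolding nkoop_def proj_step_bundle_point[OF v] G_def by (simp add: noise_law_def \<sigma> add.commute)
  also have "\<dots> = (\<integral>\<^sup>+w. G (w + x) * indicator {- \<sigma>..\<sigma>} w \<partial>lborel) / emeasure lborel {- \<sigma>..\<sigma>}"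
    by (rule nn_integral_uniform_measure) measurable
  also have "(\<integral>\<^sup>+w. G (w + x) * indicator {- \<sigma>..\<sigma>} w \<partial>lborel)
      = (\<integral>\<^sup>+w. G (w + x) * indicator {x - \<sigma>..x + \<sigma>} (w + x) \<partial>lborel)"
    by (intro nn_integral_cong) (auto simp: indicator_def)
  also have "\<dots> = (\<integral>\<^sup>+s. G s * indicator {x - \<sigma>..x + \<sigma>} s \<partial>lborel)"
    by (rule nn_integral_shift) measurable
  also have "emeasure lborel {- \<sigma>..\<sigma>} = ennreal (2 * \<sigma>)" using \<sigma>pos by simp
  finally show ?thesis
    using \<sigma>pos by (simp add: G_def divide_ennreal_def inverse_ennreal mult.commute inverse_eq_divide)
qed

text \<open>The start enters through an indicator instead of the range of integration. The base
  point \<open>u\<close> of the fundamental domain is left free: the angle that will be shifted by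
  \<open>A\<close> wants a domain centred at 0, the others use [0, 1).\<close>

lemma nkoop_bundle_point_circle:
  assumes L: "0 < L" and \<sigma>: "\<sigma> = noise_size L \<delta>" "\<sigma> < 1 / 2" and v: "v \<noteq> 0"
    and \<phi> [measurable]: "\<phi> \<in> borel_measurable proj_bundle"
  shows "random_map.nkoop (noise_law L \<delta>) (proj_step L) \<phi> (bundle_point x y v)
    = ennreal (1 / (2 * \<sigma>)) *
      (\<integral>\<^sup>+s. \<phi> (bundle_point (forcing L s - y) s (forcing_deriv L s * fst v - snd v, fst v)) * near_ind \<sigma> (s - x)
        * indicator {u..<u + 1} s \<partial>lborel)"
proof -
  have \<sigma>pos: "0 < \<sigma>" using L by (simp add: \<sigma> noise_size_def)
  define G where "G s = \<phi> (bundle_point (forcing L s - y) s (forcing_deriv L s * fst v - snd v, fst v))" for s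
  have nz: "(forcing_deriv L s * fst v - snd v, fst v) \<noteq> 0" for s
    using v by (auto simp: zero_prod_def prod_eq_iff)
  have vm: "(\<lambda>s. (forcing_deriv L s * fst v - snd v, fst v)) \<in> borel_measurable borel"
    by (rule borel_measurable_Pair) measurable
  have G [measurable]: "G \<in> borel_measurable borel"
    unfolding G_def by (intro measurable_compose[OF _ \<phi>] bundle_point_measurable vm nz) measurable
  have per: "G (s + 1) = G s" for s
    unfolding G_def using bundle_point_period[of "forcing L s - y" 0 s 1] forcing_period[of L s 1] forcing_deriv_period[of L s 1]
    by simp
  have "(\<integral>\<^sup>+s. G s * indicator {x - \<sigma>..x + \<sigma>} s \<partial>lborel)
      = (\<integral>\<^sup>+s. G s * indicator {s. near \<sigma> (s - x)} s * indicator {0..<1} s \<partial>lborel)"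
    using \<sigma>pos \<sigma> by (intro nn_integral_window per G) auto
  also have "\<dots> = (\<integral>\<^sup>+s. G s * near_ind \<sigma> (s - x) * indicator {0..<1} s \<partial>lborel)"
    by (simp add: near_ind_def indicator_def)
  also have "\<dots> = (\<integral>\<^sup>+s. G s * near_ind \<sigma> (s - x) * indicator {u..<u + 1} s \<partial>lborel)"
  proof (rule nn_integral_period[symmetric])
    show "G (s + 1) * near_ind \<sigma> (s + 1 - x) = G s * near_ind \<sigma> (s - x)" for s
      unfolding per using near_ind_add_int[of \<sigma> "s - x" 1] by (simp add: algebra_simps)
  qed measurable
  finally show ?thesis
    unfolding nkoop_bundle_point[OF L \<sigma>(1) v \<phi>] G_def by simp
qed

text \<open>After three steps through the angles \<open>a\<close>, \<open>b\<close>, \<open>c\<close>, the state depends on \<open>a\<close> and on the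
  incoming direction only through \<open>\<rho>\<close>, the slope of the direction after the first of them.\<close>

definition final_value :: "real \<Rightarrow> (point \<times> direction \<Rightarrow> ennreal) \<Rightarrow> real \<Rightarrow> real \<Rightarrow> real \<Rightarrow> ennreal" where
  "final_value L \<phi> b c \<rho> =
    \<phi> (bundle_point (forcing L c - b) c (forcing_deriv L c * (forcing_deriv L b * \<rho> - 1) - \<rho>, forcing_deriv L b * \<rho> - 1))"

lemma final_value_measurable [measurable (raw)]:
  assumes \<phi>: "\<phi> \<in> borel_measurable proj_bundle"
    and [measurable]: "b \<in> borel_measurable N" "c \<in> borel_measurable N" "\<rho> \<in> borel_measurable N"
  shows "(\<lambda>x. final_value L \<phi> (b x) (c x) (\<rho> x)) \<in> borel_measurable N"
  unfolding final_value_def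
proof (intro measurable_compose[OF _ \<phi>] bundle_point_measurable)
  show "(\<lambda>x. (forcing_deriv L (c x) * (forcing_deriv L (b x) * \<rho> x - 1) - \<rho> x, forcing_deriv L (b x) * \<rho> x - 1)) \<in> borel_measurable N"
    by (rule borel_measurable_Pair) measurable
  show "(forcing_deriv L (c x) * (forcing_deriv L (b x) * \<rho> x - 1) - \<rho> x, forcing_deriv L (b x) * \<rho> x - 1) \<noteq> 0" for x
    by (auto simp: zero_prod_def)
qed measurable

text \<open>The bound \<open>0 + 1\<close> matches the shape \<open>{u..<u + 1}\<close> of
  \<open>nkoop_bundle_point_circle\<close>.\<close>

definition last_integral ::
  "real \<Rightarrow> (point \<times> direction \<Rightarrow> ennreal) \<Rightarrow> real \<Rightarrow> real \<Rightarrow> real \<Rightarrow> real \<Rightarrow> ennreal" where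
  "last_integral L \<phi> h a b \<rho> =
    (\<integral>\<^sup>+c. final_value L \<phi> b c \<rho> * near_ind h (c - (forcing L b - a)) * indicator {0..<0 + 1} c \<partial>lborel)"

lemma last_integral_measurable [measurable (raw)]:
  assumes [measurable]: "\<phi> \<in> borel_measurable proj_bundle"
    "a \<in> borel_measurable N" "b \<in> borel_measurable N" "\<rho> \<in> borel_measurable N"
  shows "(\<lambda>x. last_integral L \<phi> h (a x) (b x) (\<rho> x)) \<in> borel_measurable N"
  unfolding last_integral_def by measurable

text \<open>Three steps from (x, y) with the slope correction gone. The arcs have half-widths
  \<sigma>/2 and 3 \<sigma>/4 instead of \<sigma>, and this slack absorbs the shift of the angle
  \<open>a\<close>.\<close>

definition target_integral :: "real \<Rightarrow> (point \<times> direction \<Rightarrow> ennreal) \<Rightarrow> real \<Rightarrow> real \<Rightarrow> real \<Rightarrow> ennreal" where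
  "target_integral L \<phi> \<sigma> x y =
    (\<integral>\<^sup>+a. (\<integral>\<^sup>+b. last_integral L \<phi> (\<sigma> / 2) a b (forcing_deriv L a) * near_ind (\<sigma> / 2) (b - (forcing L a - y)) * indicator {0..<0 + 1} b \<partial>lborel)
       * near_ind (3 * \<sigma> / 4) (a - x) * indicator {- 1 / 16..1 / 16} a \<partial>lborel)"

text \<open>A single use of Tonelli, with each pair of variables regarded as one.\<close>

lemma nn_integral_swap_pairs:
  fixes G :: "real \<Rightarrow> real \<Rightarrow> real \<Rightarrow> real \<Rightarrow> ennreal"
  assumes m: "(\<lambda>(p, q). G (fst p) (snd p) (fst q) (snd q))
      \<in> borel_measurable ((lborel \<Otimes>\<^sub>M lborel) \<Otimes>\<^sub>M (lborel \<Otimes>\<^sub>M lborel))"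
  shows "(\<integral>\<^sup>+s. \<integral>\<^sup>+t. \<integral>\<^sup>+a. \<integral>\<^sup>+b. G s t a b \<partial>lborel \<partial>lborel \<partial>lborel \<partial>lborel)
    = (\<integral>\<^sup>+a. \<integral>\<^sup>+b. \<integral>\<^sup>+s. \<integral>\<^sup>+t. G s t a b \<partial>lborel \<partial>lborel \<partial>lborel \<partial>lborel)"
proof -
  let ?P = "lborel \<Otimes>\<^sub>M lborel :: (real \<times> real) measure"
  have sf: "sigma_finite_measure ?P"
    by (rule lborel_pair.sigma_finite_measure_axioms)
  interpret PQ: pair_sigma_finite ?P ?P
    by (intro pair_sigma_finite.intro sf)
  have flat: "(\<integral>\<^sup>+x. \<integral>\<^sup>+y. H (x, y) \<partial>lborel \<partial>lborel) = (\<integral>\<^sup>+p. H p \<partial>?P)"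
    if "H \<in> borel_measurable ?P" for H :: "real \<times> real \<Rightarrow> ennreal"
    using that by (rule lborel.nn_integral_fst)
  let ?G = "\<lambda>p q. G (fst p) (snd p) (fst q) (snd q)"
  have m1: "?G p \<in> borel_measurable ?P" for p
    using measurable_compose[OF measurable_Pair1'[of p ?P ?P] m] by (simp add: space_pair_measure)
  have m2: "(\<lambda>p. ?G p q) \<in> borel_measurable ?P" for q
    using measurable_compose[OF measurable_Pair2'[of q ?P ?P] m] by (simp add: space_pair_measure)
  have n1: "(\<lambda>p. \<integral>\<^sup>+q. ?G p q \<partial>?P) \<in> borel_measurable ?P"
    using sigma_finite_measure.borel_measurable_nn_integral[OF sf m] by simp
  have n2: "(\<lambda>q. \<integral>\<^sup>+p. ?G p q \<partial>?P) \<in> borel_measurable ?P"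
  proof (rule sigma_finite_measure.borel_measurable_nn_integral[OF sf])
    show "(\<lambda>(q, p). ?G p q) \<in> borel_measurable (?P \<Otimes>\<^sub>M ?P)"
      using measurable_pair_swap[OF m] by (simp add: case_prod_beta')
  qed
  have f1: "(\<integral>\<^sup>+a. \<integral>\<^sup>+b. G s t a b \<partial>lborel \<partial>lborel) = (\<integral>\<^sup>+q. ?G (s, t) q \<partial>?P)" for s t
    using flat[OF m1, of "(s, t)"] by simp
  have f2: "(\<integral>\<^sup>+s. \<integral>\<^sup>+t. G s t a b \<partial>lborel \<partial>lborel) = (\<integral>\<^sup>+p. ?G p (a, b) \<partial>?P)" for a b
    using flat[OF m2, of "(a, b)"] by simp
  have "(\<integral>\<^sup>+s. \<integral>\<^sup>+t. \<integral>\<^sup>+a. \<integral>\<^sup>+b. G s t a b \<partial>lborel \<partial>lborel \<partial>lborel \<partial>lborel)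
      = (\<integral>\<^sup>+s. \<integral>\<^sup>+t. \<integral>\<^sup>+q. ?G (s, t) q \<partial>?P \<partial>lborel \<partial>lborel)"
    by (simp only: f1)
  also have "\<dots> = (\<integral>\<^sup>+p. \<integral>\<^sup>+q. ?G p q \<partial>?P \<partial>?P)"
    by (rule flat[OF n1])
  also have "\<dots> = (\<integral>\<^sup>+q. \<integral>\<^sup>+p. ?G p q \<partial>?P \<partial>?P)"
    using PQ.Fubini'[OF m] ..
  also have "\<dots> = (\<integral>\<^sup>+a. \<integral>\<^sup>+b. \<integral>\<^sup>+p. ?G p (a, b) \<partial>?P \<partial>lborel \<partial>lborel)"
    by (rule flat[OF n2, symmetric])
  also have "\<dots> = (\<integral>\<^sup>+a. \<integral>\<^sup>+b. \<integral>\<^sup>+s. \<integral>\<^sup>+t. G s t a b \<partial>lborel \<partial>lborel \<partial>lborel \<partial>lborel)"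
    by (simp only: f2)
  finally show ?thesis .
qed

text \<open>With this threshold, |snd p| \<le> |fst p| implies |f' fst p - snd p| \<ge> (2/\<sigma>)
  |fst p|, so the correction passed on to the next step is at most \<sigma>/2.\<close>

definition steep :: "real \<Rightarrow> real \<Rightarrow> real \<Rightarrow> ennreal" where
  "steep L \<sigma> s = indicator {s. 1 + 2 / \<sigma> \<le> \<bar>forcing_deriv L s\<bar>} s"

lemma steep_measurable [measurable]: "steep L \<sigma> \<in> borel_measurable borel"
  unfolding steep_def[abs_def] by measurable

text \<open>What remains of \<open>target_integral\<close> without the two arcs whose centres depend
  on (x, y): no trace of the initial state is left.\<close>

definition bulk_integral :: "real \<Rightarrow> (point \<times> direction \<Rightarrow> ennreal) \<Rightarrow> real \<Rightarrow> ennreal" where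
  "bulk_integral L \<phi> \<sigma> =
    (\<integral>\<^sup>+a. \<integral>\<^sup>+b. last_integral L \<phi> (\<sigma> / 2) a b (forcing_deriv L a) * indicator {0..<0 + 1} b
       * indicator {- 1 / 16..1 / 16} a \<partial>lborel \<partial>lborel)"

context
  fixes L \<delta> \<sigma> :: real and \<phi> :: "point \<times> direction \<Rightarrow> ennreal"
  assumes \<sigma>_eq: "\<sigma> = noise_size L \<delta>" and \<sigma>_le: "\<sigma> \<le> 1 / 8" and L_ge: "1 \<le> L" and L\<sigma>: "100 \<le> L * \<sigma>\<^sup>2"
    and \<phi>_meas [measurable]: "\<phi> \<in> borel_measurable proj_bundle"
begin

interpretation random_map "noise_law L \<delta>" proj_bundle "proj_step L"
  by (rule random_map_proj) (use L_ge in simp)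

lemma \<sigma>_pos: "0 < \<sigma>"
  using L_ge by (simp add: \<sigma>_eq noise_size_def)

abbreviation "c\<^sub>0 \<equiv> ennreal (1 / (2 * \<sigma>))"

lemma nkoop_meas: "\<psi> \<in> borel_measurable proj_bundle \<Longrightarrow> nkoop \<psi> \<in> borel_measurable proj_bundle"
  by (rule nkoop_measurable) unfold_locales

lemmas circle_step = nkoop_bundle_point_circle[OF less_le_trans[OF zero_less_one L_ge] \<sigma>_eq]

lemma nkoop1:
  "nkoop \<phi> (bundle_point (forcing L b - a) b (forcing_deriv L b * \<rho> - 1, \<rho>)) = c\<^sub>0 * last_integral L \<phi> \<sigma> a b \<rho>"
  unfolding last_integral_def final_value_def
  by (subst circle_step[where u = 0]) (use \<sigma>_le in \<open>auto simp: zero_prod_def\<close>)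

lemma nkoop2:
  "nkoop (nkoop \<phi>) (bundle_point (forcing L a - y) a (\<rho>, 1))
    = c\<^sub>0 * (\<integral>\<^sup>+b. c\<^sub>0 * last_integral L \<phi> \<sigma> a b \<rho> * near_ind \<sigma> (b - (forcing L a - y)) * indicator {0..<0 + 1} b \<partial>lborel)"
  by (subst circle_step[where u = 0])
    (use \<sigma>_le in \<open>auto simp: zero_prod_def nkoop_meas nkoop1\<close>)

text \<open>Under the substitution, \<open>a\<close> moves by at most |q|/2 \<le> \<sigma>/4 and
  f(a) by at most |q| \<le> \<sigma>/2. These amounts fit into the gaps from 3 \<sigma>/4 to
  \<sigma> and from \<sigma>/2 to \<sigma>. The factor 1/2 is the bound on the Jacobian of
  \<open>A\<close>.\<close>

lemma nkoop3_ge: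
  assumes q: "\<bar>q\<bar> \<le> \<sigma> / 2"
  shows "c\<^sub>0 * c\<^sub>0 * c\<^sub>0 * ennreal (1 / 2) * target_integral L \<phi> \<sigma> x y
    \<le> nkoop (nkoop (nkoop \<phi>)) (bundle_point x y (1, q))"
proof -
  have "\<bar>q\<bar> \<le> 1 / 2" using q \<sigma>_le by linarith
  from slope_substitution[OF L_ge this] obtain A where A [measurable]: "A \<in> borel_measurable borel"
    and sub: "\<And>\<psi>. \<psi> \<in> borel_measurable borel \<Longrightarrow> ennreal (1 / 2) * (\<integral>\<^sup>+a. \<psi> (A a) * indicator {- 1 / 16..1 / 16} a \<partial>lborel)
        \<le> (\<integral>\<^sup>+a. \<psi> a * indicator {- 1 / 2..<1 / 2} a \<partial>lborel)"
    and dfA: "\<And>a. a \<in> {- 1 / 16..1 / 16} \<Longrightarrow> forcing_deriv L (A a) - q = forcing_deriv L a"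
    and distA: "\<And>a. a \<in> {- 1 / 16..1 / 16} \<Longrightarrow> \<bar>A a - a\<bar> \<le> \<bar>q\<bar> / 2"
    and distfA: "\<And>a. a \<in> {- 1 / 16..1 / 16} \<Longrightarrow> \<bar>forcing L (A a) - forcing L a\<bar> \<le> \<bar>q\<bar>"
    by blast
  define G where "G a \<rho> = (\<integral>\<^sup>+b. c\<^sub>0 * last_integral L \<phi> \<sigma> a b \<rho> * near_ind \<sigma> (b - (forcing L a - y)) * indicator {0..<0 + 1} b \<partial>lborel)" for a \<rho>
  have G_meas [measurable]: "(\<lambda>a. G (h a) (k a)) \<in> borel_measurable borel"
    if [measurable]: "h \<in> borel_measurable borel" "k \<in> borel_measurable borel" for h k :: "real \<Rightarrow> real"
    unfolding G_def by measurable
  define T where "T a = (\<integral>\<^sup>+b. last_integral L \<phi> (\<sigma> / 2) a b (forcing_deriv L a) * near_ind (\<sigma> / 2) (b - (forcing L a - y)) * indicator {0..<0 + 1} b \<partial>lborel)" for a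
  have [measurable]: "T \<in> borel_measurable borel" unfolding T_def by measurable
  have T_le: "c\<^sub>0 * T a \<le> G (A a) (forcing_deriv L a)" if a: "a \<in> {- 1 / 16..1 / 16}" for a
  proof -
    have d: "\<bar>A a - a\<bar> \<le> \<sigma> / 4" "\<bar>forcing L (A a) - forcing L a\<bar> \<le> \<sigma> / 2"
      using distA[OF a] distfA[OF a] q by linarith+
    have last: "last_integral L \<phi> (\<sigma> / 2) a b \<rho> \<le> last_integral L \<phi> \<sigma> (A a) b \<rho>" for b \<rho>
      unfolding last_integral_def
    proof (intro nn_integral_mono mult_right_mono mult_left_mono)
      show "near_ind (\<sigma> / 2) (c - (forcing L b - a)) \<le> near_ind \<sigma> (c - (forcing L b - A a))" for c
        using d(1) \<sigma>_pos by (intro near_ind_shift[of _ _ "\<sigma> / 4"]) auto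
    qed auto
    have "c\<^sub>0 * T a = (\<integral>\<^sup>+b. c\<^sub>0 * (last_integral L \<phi> (\<sigma> / 2) a b (forcing_deriv L a) * near_ind (\<sigma> / 2) (b - (forcing L a - y)) * indicator {0..<0 + 1} b) \<partial>lborel)"
      unfolding T_def by (rule nn_integral_cmult[symmetric]) measurable
    also have "\<dots> \<le> G (A a) (forcing_deriv L a)"
      unfolding G_def mult.assoc
    proof (intro nn_integral_mono mult_left_mono mult_mono last)
      show "near_ind (\<sigma> / 2) (b - (forcing L a - y)) \<le> near_ind \<sigma> (b - (forcing L (A a) - y))" for b
        using d(2) by (intro near_ind_shift[of _ _ "\<sigma> / 2"]) (simp_all add: abs_minus_commute)
    qed auto
    finally show ?thesis .
  qed
  have "nkoop (nkoop (nkoop \<phi>)) (bundle_point x y (1, q))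
      = c\<^sub>0 * (\<integral>\<^sup>+a. nkoop (nkoop \<phi>) (bundle_point (forcing L a - y) a (forcing_deriv L a - q, 1)) * near_ind \<sigma> (a - x)
          * indicator {- 1 / 2..<- 1 / 2 + 1} a \<partial>lborel)"
    by (subst circle_step[where u = "- 1 / 2"]) (use \<sigma>_le in \<open>auto simp: zero_prod_def nkoop_meas\<close>)
  also have "\<dots> = c\<^sub>0 * (\<integral>\<^sup>+a. (c\<^sub>0 * G a (forcing_deriv L a - q)) * near_ind \<sigma> (a - x) * indicator {- 1 / 2..<1 / 2} a \<partial>lborel)"
    unfolding nkoop2 G_def by simp
  finally have eq: "nkoop (nkoop (nkoop \<phi>)) (bundle_point x y (1, q))
      = c\<^sub>0 * (\<integral>\<^sup>+a. (c\<^sub>0 * G a (forcing_deriv L a - q)) * near_ind \<sigma> (a - x) * indicator {- 1 / 2..<1 / 2} a \<partial>lborel)" .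
  have "c\<^sub>0 * c\<^sub>0 * target_integral L \<phi> \<sigma> x y
      = (\<integral>\<^sup>+a. c\<^sub>0 * c\<^sub>0 * (T a * near_ind (3 * \<sigma> / 4) (a - x) * indicator {- 1 / 16..1 / 16} a) \<partial>lborel)"
    unfolding target_integral_def T_def[symmetric] by (rule nn_integral_cmult[symmetric]) measurable
  also have "\<dots> \<le> (\<integral>\<^sup>+a. (c\<^sub>0 * G (A a) (forcing_deriv L (A a) - q)) * near_ind \<sigma> (A a - x) * indicator {- 1 / 16..1 / 16} a \<partial>lborel)"
  proof (rule nn_integral_mono)
    fix a
    show "c\<^sub>0 * c\<^sub>0 * (T a * near_ind (3 * \<sigma> / 4) (a - x) * indicator {- 1 / 16..1 / 16} a)
        \<le> (c\<^sub>0 * G (A a) (forcing_deriv L (A a) - q)) * near_ind \<sigma> (A a - x) * indicator {- 1 / 16..1 / 16} a"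
    proof (cases "a \<in> {- 1 / 16..1 / 16}")
      case True
      have "\<bar>A a - a\<bar> \<le> \<sigma> / 4" using distA[OF True] q by linarith
      then have "near_ind (3 * \<sigma> / 4) (a - x) \<le> near_ind \<sigma> (A a - x)"
        by (intro near_ind_shift[of _ _ "\<sigma> / 4"]) auto
      then have "c\<^sub>0 * (c\<^sub>0 * T a) * near_ind (3 * \<sigma> / 4) (a - x) \<le> c\<^sub>0 * G (A a) (forcing_deriv L a) * near_ind \<sigma> (A a - x)"
        by (intro mult_mono mult_left_mono T_le True) auto
      then show ?thesis using True dfA[OF True] by (simp add: mult_ac)
    qed simp
  qed
  finally have "ennreal (1 / 2) * (c\<^sub>0 * c\<^sub>0 * target_integral L \<phi> \<sigma> x y)
      \<le> ennreal (1 / 2) * (\<integral>\<^sup>+a. (c\<^sub>0 * G (A a) (forcing_deriv L (A a) - q)) * near_ind \<sigma> (A a - x) * indicator {- 1 / 16..1 / 16} a \<partial>lborel)"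
    by (rule mult_left_mono) simp
  also have "\<dots> \<le> (\<integral>\<^sup>+a. (c\<^sub>0 * G a (forcing_deriv L a - q)) * near_ind \<sigma> (a - x) * indicator {- 1 / 2..<1 / 2} a \<partial>lborel)"
    by (rule sub) measurable
  finally have "c\<^sub>0 * (ennreal (1 / 2) * (c\<^sub>0 * c\<^sub>0 * target_integral L \<phi> \<sigma> x y))
      \<le> nkoop (nkoop (nkoop \<phi>)) (bundle_point x y (1, q))"
    unfolding eq by (rule mult_left_mono) simp
  then show ?thesis by (simp add: mult_ac)
qed

text \<open>For fixed \<open>a\<close> and \<open>b\<close>, the volume of first and second angles
  (s, t) that lead there from (x, y). The angle \<open>t\<close> has to be near \<open>w\<close>,
  which asks that f(s) be near y + w; then f(t) has to be near a + s, where \<open>s\<close> is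
  within \<sigma>/2 of \<open>x\<close>. Equidistribution of f with h = \<sigma>/2 for
  \<open>s\<close> and h = \<sigma>/4 for \<open>t\<close> yields the factors \<sigma>^2/216 and
  \<sigma>^2/432, whatever x, y, a, b are.\<close>

lemma overlap_volume:
  assumes \<alpha>\<beta>: "x - \<sigma> / 2 \<le> \<alpha>" "\<beta> \<le> x + \<sigma> / 2"
    and equi: "\<And>w h. 0 < h \<Longrightarrow> h < 1 / 2 \<Longrightarrow> ennreal (\<sigma> * h / 108)
       \<le> (\<integral>\<^sup>+s. indicator {s. near h (forcing L s - w)} s * indicator {\<alpha>..\<beta>} s \<partial>lborel)"
  shows "ennreal (\<sigma>\<^sup>2 / 216 * (\<sigma>\<^sup>2 / 432))
    \<le> (\<integral>\<^sup>+s. \<integral>\<^sup>+t. near_ind \<sigma> (t - (forcing L s - y)) * steep L \<sigma> t * near_ind (\<sigma> / 2) (b - (forcing L a - t))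
         * near_ind (3 * \<sigma> / 4) (a - (forcing L t - s)) * indicator {0..<1} t * indicator {\<alpha>..\<beta>} s \<partial>lborel \<partial>lborel)"
proof -
  define w where "w = forcing L a - b"
  obtain \<alpha>' \<beta>' where \<alpha>'\<beta>': "w - \<sigma> / 2 \<le> \<alpha>'" "\<alpha>' < \<beta>'" "\<beta>' \<le> w + \<sigma> / 2"
    and st: "\<And>s. s \<in> {\<alpha>'..\<beta>'} \<Longrightarrow> 1 + 2 / \<sigma> \<le> \<bar>forcing_deriv L s\<bar>"
    and "\<And>s. s \<in> {\<alpha>'..\<beta>'} \<Longrightarrow> 1 \<le> \<bar>forcing_deriv L s - 0\<bar>"
    and equi': "\<And>w h. 0 < h \<Longrightarrow> h < 1 / 2 \<Longrightarrow> ennreal (\<sigma> * h / 108)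
       \<le> (\<integral>\<^sup>+s. indicator {s. near h (forcing L s - w)} s * indicator {\<alpha>'..\<beta>'} s \<partial>lborel)"
    by (rule good_interval[OF \<sigma>_pos \<sigma>_le L\<sigma>, where p = w and \<tau> = 0]) (rule that; assumption)
  have ind_eq: "indicator {s. near h (forcing L s - w)} s = near_ind h (forcing L s - w)" for h w s
    by (simp add: near_ind_def indicator_def)
  have inner: "near_ind (\<sigma> / 2) (forcing L s - (y + w)) * ennreal (\<sigma>\<^sup>2 / 432)
      \<le> (\<integral>\<^sup>+t. near_ind \<sigma> (t - (forcing L s - y)) * steep L \<sigma> t * near_ind (\<sigma> / 2) (b - (forcing L a - t))
         * near_ind (3 * \<sigma> / 4) (a - (forcing L t - s)) * indicator {0..<1} t \<partial>lborel)"
    if s: "s \<in> {\<alpha>..\<beta>}" for s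
  proof -
    let ?G = "\<lambda>t. near_ind \<sigma> (t - (forcing L s - y)) * steep L \<sigma> t * near_ind (\<sigma> / 2) (b - (forcing L a - t))
         * near_ind (3 * \<sigma> / 4) (a - (forcing L t - s))"
    have sx: "\<bar>s - x\<bar> \<le> \<sigma> / 2"
      using s \<alpha>\<beta> by (intro abs_leI) auto
    have per: "?G (t + 1) = ?G t" for t
    proof -
      have "forcing L (t + 1) = forcing L t" "forcing_deriv L (t + 1) = forcing_deriv L t"
        using forcing_period[of L t 1] forcing_deriv_period[of L t 1] by simp_all
      moreover have "near_ind \<sigma> (t + 1 - (forcing L s - y)) = near_ind \<sigma> (t - (forcing L s - y))"
        using near_ind_add_int[of \<sigma> "t - (forcing L s - y)" 1] by (simp add: algebra_simps)
      moreover have "near_ind (\<sigma> / 2) (b - (forcing L a - (t + 1))) = near_ind (\<sigma> / 2) (b - (forcing L a - t))"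
        using near_ind_add_int[of "\<sigma> / 2" "b - (forcing L a - t)" 1] by (simp add: algebra_simps)
      ultimately show ?thesis by (simp add: steep_def indicator_def)
    qed
    have "near_ind (\<sigma> / 2) (forcing L s - (y + w)) * ennreal (\<sigma> * (\<sigma> / 4) / 108)
        \<le> near_ind (\<sigma> / 2) (forcing L s - (y + w)) * (\<integral>\<^sup>+t. near_ind (\<sigma> / 4) (forcing L t - (a + x)) * indicator {\<alpha>'..\<beta>'} t \<partial>lborel)"
      using equi'[of "\<sigma> / 4" "a + x"] \<sigma>_pos \<sigma>_le by (intro mult_left_mono) (simp_all add: ind_eq)
    also have "\<dots> = (\<integral>\<^sup>+t. near_ind (\<sigma> / 2) (forcing L s - (y + w)) * (near_ind (\<sigma> / 4) (forcing L t - (a + x)) * indicator {\<alpha>'..\<beta>'} t) \<partial>lborel)"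
      by (rule nn_integral_cmult[symmetric]) measurable
    \<comment> \<open>Half-widths add up to \<sigma>/2 + \<sigma>/2 = \<sigma> in the condition on
      \<open>t\<close>, and to \<sigma>/4 + \<sigma>/2 = 3 \<sigma>/4 in that on
      \<open>a\<close>.\<close>
    also have "\<dots> \<le> (\<integral>\<^sup>+t. ?G t * indicator {w - 1 / 2..<w - 1 / 2 + 1} t \<partial>lborel)"
    proof (rule nn_integral_mono)
      fix t
      show "near_ind (\<sigma> / 2) (forcing L s - (y + w)) * (near_ind (\<sigma> / 4) (forcing L t - (a + x)) * indicator {\<alpha>'..\<beta>'} t)
          \<le> ?G t * indicator {w - 1 / 2..<w - 1 / 2 + 1} t"
      proof (cases "near (\<sigma> / 2) (forcing L s - (y + w)) \<and> near (\<sigma> / 4) (forcing L t - (a + x)) \<and> t \<in> {\<alpha>'..\<beta>'}")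
        case True
        then have n1: "near (\<sigma> / 2) (forcing L s - (y + w))" and n2: "near (\<sigma> / 4) (forcing L t - (a + x))"
          and t: "t \<in> {\<alpha>'..\<beta>'}" by auto
        have tw: "\<bar>t - w\<bar> \<le> \<sigma> / 2"
          using t \<alpha>'\<beta>' by (intro abs_leI) auto
        have "near (\<sigma> / 2 + \<sigma> / 2) ((t - w) + - (forcing L s - (y + w)))"
          by (rule near_add[OF nearI[OF tw] near_minus[THEN iffD2, OF n1]])
        then have m1: "near \<sigma> (t - (forcing L s - y))" by (simp add: algebra_simps)
        have m2: "near (\<sigma> / 2) (b - (forcing L a - t))"
          using nearI[OF tw] by (simp add: w_def algebra_simps)
        have "near (\<sigma> / 4 + \<sigma> / 2) (- (forcing L t - (a + x)) + (s - x))"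
          by (rule near_add[OF near_minus[THEN iffD2, OF n2] nearI[OF sx]])
        then have m3: "near (3 * \<sigma> / 4) (a - (forcing L t - s))" by (simp add: algebra_simps)
        have "t \<in> {w - 1 / 2..<w - 1 / 2 + 1}"
          using t \<alpha>'\<beta>' \<sigma>_pos \<sigma>_le by auto
        then show ?thesis
          using m1 m2 m3 st[OF t] by (simp add: near_ind_def steep_def indicator_def)
      qed (auto simp: near_ind_def)
    qed
    also have "\<dots> = (\<integral>\<^sup>+t. ?G t * indicator {0..<1} t \<partial>lborel)"
      using per by (intro nn_integral_period) measurable
    finally show ?thesis by (simp add: power2_eq_square)
  qed
  have "ennreal (\<sigma>\<^sup>2 / 216 * (\<sigma>\<^sup>2 / 432)) = ennreal (\<sigma> * (\<sigma> / 2) / 108) * ennreal (\<sigma>\<^sup>2 / 432)"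
    using \<sigma>_pos by (simp add: ennreal_mult[symmetric] power2_eq_square)
  also have "\<dots> \<le> (\<integral>\<^sup>+s. near_ind (\<sigma> / 2) (forcing L s - (y + w)) * indicator {\<alpha>..\<beta>} s \<partial>lborel) * ennreal (\<sigma>\<^sup>2 / 432)"
    using equi[of "\<sigma> / 2" "y + w"] \<sigma>_pos \<sigma>_le by (intro mult_right_mono) (simp_all add: ind_eq)
  also have "\<dots> = (\<integral>\<^sup>+s. near_ind (\<sigma> / 2) (forcing L s - (y + w)) * indicator {\<alpha>..\<beta>} s * ennreal (\<sigma>\<^sup>2 / 432) \<partial>lborel)"
    by (rule nn_integral_multc[symmetric]) measurable
  also have "\<dots> \<le> (\<integral>\<^sup>+s. \<integral>\<^sup>+t. near_ind \<sigma> (t - (forcing L s - y)) * steep L \<sigma> t * near_ind (\<sigma> / 2) (b - (forcing L a - t))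
         * near_ind (3 * \<sigma> / 4) (a - (forcing L t - s)) * indicator {0..<1} t * indicator {\<alpha>..\<beta>} s \<partial>lborel \<partial>lborel)"
  proof (rule nn_integral_mono)
    fix s
    show "near_ind (\<sigma> / 2) (forcing L s - (y + w)) * indicator {\<alpha>..\<beta>} s * ennreal (\<sigma>\<^sup>2 / 432)
      \<le> (\<integral>\<^sup>+t. near_ind \<sigma> (t - (forcing L s - y)) * steep L \<sigma> t * near_ind (\<sigma> / 2) (b - (forcing L a - t))
         * near_ind (3 * \<sigma> / 4) (a - (forcing L t - s)) * indicator {0..<1} t * indicator {\<alpha>..\<beta>} s \<partial>lborel)"
      using inner[of s] by (cases "s \<in> {\<alpha>..\<beta>}") simp_all
  qed
  finally show ?thesis .
qed

text \<open>The first angle avoids the value \<open>snd v / fst v\<close>, so the vector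
  \<open>p\<close> after it is at least as long horizontally as vertically. A steep second angle
  then makes the correction at most \<sigma>/2, and \<open>nkoop3_ge\<close> applies. Tonelli puts
  (s, t) innermost, where \<open>overlap_volume\<close> removes the dependence on x, y and
  v.\<close>

lemma nkoop5_ge:
  assumes v: "v \<noteq> 0"
  shows "c\<^sub>0 * c\<^sub>0 * (c\<^sub>0 * c\<^sub>0 * c\<^sub>0 * ennreal (1 / 2)) * (ennreal (\<sigma>\<^sup>2 / 216 * (\<sigma>\<^sup>2 / 432)) * bulk_integral L \<phi> \<sigma>)
    \<le> nkoop (nkoop (nkoop (nkoop (nkoop \<phi>)))) (bundle_point x y v)"
proof -
  obtain \<alpha> \<beta> where \<alpha>: "x - \<sigma> / 2 \<le> \<alpha>" and "\<alpha> < \<beta>" and \<beta>: "\<beta> \<le> x + \<sigma> / 2"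
    and "\<And>s. s \<in> {\<alpha>..\<beta>} \<Longrightarrow> 1 + 2 / \<sigma> \<le> \<bar>forcing_deriv L s\<bar>"
    and avoid: "\<And>s. s \<in> {\<alpha>..\<beta>} \<Longrightarrow> 1 \<le> \<bar>forcing_deriv L s - snd v / fst v\<bar>"
    and equi: "\<And>w h. 0 < h \<Longrightarrow> h < 1 / 2 \<Longrightarrow> ennreal (\<sigma> * h / 108)
       \<le> (\<integral>\<^sup>+s. indicator {s. near h (forcing L s - w)} s * indicator {\<alpha>..\<beta>} s \<partial>lborel)"
    by (rule good_interval[OF \<sigma>_pos \<sigma>_le L\<sigma>, where p = x and \<tau> = "snd v / fst v"]) (rule that; assumption)
  define C where "C = c\<^sub>0 * c\<^sub>0 * c\<^sub>0 * ennreal (1 / 2)"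
  let ?T = "target_integral L \<phi> \<sigma>"
  let ?N3 = "nkoop (nkoop (nkoop \<phi>))"
  have N3: "?N3 \<in> borel_measurable proj_bundle"
    by (intro nkoop_meas \<phi>_meas)
  have T_meas [measurable]: "(\<lambda>x. ?T (g x) (h x)) \<in> borel_measurable M'"
    if [measurable]: "g \<in> borel_measurable M'" "h \<in> borel_measurable M'" for g h and M' :: "'z measure"
    unfolding target_integral_def by measurable
  have two: "c\<^sub>0 * (\<integral>\<^sup>+t. C * ?T (forcing L t - s) t * near_ind \<sigma> (t - (forcing L s - y)) * steep L \<sigma> t * indicator {0..<0 + 1} t \<partial>lborel)
      \<le> nkoop ?N3 (bundle_point (forcing L s - y) s (forcing_deriv L s * fst v - snd v, fst v))" if s: "s \<in> {\<alpha>..\<beta>}" for s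
  proof -
    define p where "p = (forcing_deriv L s * fst v - snd v, fst v)"
    have p: "fst p \<noteq> 0" "\<bar>snd p\<bar> \<le> \<bar>fst p\<bar>"
    proof -
      have "fst p \<noteq> 0 \<and> \<bar>snd p\<bar> \<le> \<bar>fst p\<bar>"
      \<comment> \<open>A vertical vector is mapped to a horizontal one; otherwise |fst p| is |f' -
        \<tau>| times |fst v|.\<close>
      proof (cases "fst v = 0")
        case True
        then show ?thesis using v by (auto simp: p_def prod_eq_iff)
      next
        case False
        then have "fst p = (forcing_deriv L s - snd v / fst v) * fst v" by (simp add: p_def field_simps)
        then have e: "\<bar>fst p\<bar> = \<bar>forcing_deriv L s - snd v / fst v\<bar> * \<bar>fst v\<bar>" by (simp add: abs_mult)
        have "1 * \<bar>fst v\<bar> \<le> \<bar>forcing_deriv L s - snd v / fst v\<bar> * \<bar>fst v\<bar>"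
          using avoid[OF s] by (intro mult_right_mono) auto
        then have "\<bar>snd p\<bar> \<le> \<bar>fst p\<bar>" unfolding e by (simp add: p_def)
        moreover have "0 < \<bar>snd p\<bar>" using False by (simp add: p_def)
        ultimately show ?thesis by linarith
      qed
      then show "fst p \<noteq> 0" "\<bar>snd p\<bar> \<le> \<bar>fst p\<bar>" by auto
    qed
    have pnz: "p \<noteq> 0" using p(1) by auto
    have "nkoop ?N3 (bundle_point (forcing L s - y) s p) = c\<^sub>0 * (\<integral>\<^sup>+t. ?N3 (bundle_point (forcing L t - s) t (forcing_deriv L t * fst p - snd p, fst p))
        * near_ind \<sigma> (t - (forcing L s - y)) * indicator {0..<0 + 1} t \<partial>lborel)"
      by (rule circle_step[OF _ pnz N3]) (use \<sigma>_le in simp)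
    moreover have "c\<^sub>0 * (\<integral>\<^sup>+t. C * ?T (forcing L t - s) t * near_ind \<sigma> (t - (forcing L s - y)) * steep L \<sigma> t * indicator {0..<0 + 1} t \<partial>lborel)
        \<le> c\<^sub>0 * (\<integral>\<^sup>+t. ?N3 (bundle_point (forcing L t - s) t (forcing_deriv L t * fst p - snd p, fst p))
        * near_ind \<sigma> (t - (forcing L s - y)) * indicator {0..<0 + 1} t \<partial>lborel)"
    proof (intro mult_left_mono nn_integral_mono)
      fix t
      show "C * ?T (forcing L t - s) t * near_ind \<sigma> (t - (forcing L s - y)) * steep L \<sigma> t * indicator {0..<0 + 1} t
          \<le> ?N3 (bundle_point (forcing L t - s) t (forcing_deriv L t * fst p - snd p, fst p)) * near_ind \<sigma> (t - (forcing L s - y)) * indicator {0..<0 + 1} t"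
      proof (cases "1 + 2 / \<sigma> \<le> \<bar>forcing_deriv L t\<bar>")
        case True
        define D where "D = forcing_deriv L t * fst p - snd p"
        have "(1 + 2 / \<sigma>) * \<bar>fst p\<bar> \<le> \<bar>forcing_deriv L t\<bar> * \<bar>fst p\<bar>"
          using True by (intro mult_right_mono) auto
        then have "2 / \<sigma> * \<bar>fst p\<bar> \<le> \<bar>forcing_deriv L t * fst p\<bar> - \<bar>snd p\<bar>"
          using p(2) by (simp add: algebra_simps abs_mult)
        also have "\<dots> \<le> \<bar>D\<bar>" unfolding D_def by (rule abs_triangle_ineq2)
        finally have D: "2 / \<sigma> * \<bar>fst p\<bar> \<le> \<bar>D\<bar>" .
        moreover have "0 < 2 / \<sigma> * \<bar>fst p\<bar>" using p(1) \<sigma>_pos by simp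
        ultimately have D0: "D \<noteq> 0" by auto
        have "\<bar>fst p / D\<bar> \<le> \<sigma> / 2"
          using D D0 \<sigma>_pos by (simp add: abs_divide field_simps)
        from nkoop3_ge[OF this, of "forcing L t - s" t]
        have "C * ?T (forcing L t - s) t \<le> ?N3 (bundle_point (forcing L t - s) t (1, fst p / D))"
          unfolding C_def .
        \<comment> \<open>Rescaling by \<open>D\<close> relates the vector to the normal form (1, q)
          of \<open>nkoop3_ge\<close>.\<close>
        also have "bundle_point (forcing L t - s) t (1, fst p / D) = bundle_point (forcing L t - s) t (forcing_deriv L t * fst p - snd p, fst p)"
          using bundle_point_scaleR[OF D0, of "forcing L t - s" t "(1, fst p / D)"] D0 by (simp add: D_def)
        finally show ?thesis
          using True by (simp add: steep_def indicator_def mult_right_mono)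
      qed (simp add: steep_def)
    qed simp
    ultimately show ?thesis by (simp add: p_def)
  qed
  have "c\<^sub>0 * c\<^sub>0 * C * (ennreal (\<sigma>\<^sup>2 / 216 * (\<sigma>\<^sup>2 / 432)) * bulk_integral L \<phi> \<sigma>)
      \<le> c\<^sub>0 * c\<^sub>0 * C * (\<integral>\<^sup>+s. \<integral>\<^sup>+t. ?T (forcing L t - s) t * near_ind \<sigma> (t - (forcing L s - y)) * steep L \<sigma> t * indicator {0..<1} t
          * indicator {\<alpha>..\<beta>} s \<partial>lborel \<partial>lborel)"
  proof (rule mult_left_mono)
    let ?LL = "\<lambda>a b. last_integral L \<phi> (\<sigma> / 2) a b (forcing_deriv L a) * indicator {0..<0 + 1} b * indicator {- 1 / 16..1 / 16} a"
    let ?V = "\<lambda>s t a b. near_ind \<sigma> (t - (forcing L s - y)) * steep L \<sigma> t * near_ind (\<sigma> / 2) (b - (forcing L a - t))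
         * near_ind (3 * \<sigma> / 4) (a - (forcing L t - s)) * indicator {0..<1} t * indicator {\<alpha>..\<beta>} s"
    have "ennreal (\<sigma>\<^sup>2 / 216 * (\<sigma>\<^sup>2 / 432)) * bulk_integral L \<phi> \<sigma>
        = (\<integral>\<^sup>+a. ennreal (\<sigma>\<^sup>2 / 216 * (\<sigma>\<^sup>2 / 432)) * (\<integral>\<^sup>+b. ?LL a b \<partial>lborel) \<partial>lborel)"
      unfolding bulk_integral_def by (rule nn_integral_cmult[symmetric]) measurable
    also have "\<dots> = (\<integral>\<^sup>+a. \<integral>\<^sup>+b. ennreal (\<sigma>\<^sup>2 / 216 * (\<sigma>\<^sup>2 / 432)) * ?LL a b \<partial>lborel \<partial>lborel)"
      by (intro nn_integral_cong nn_integral_cmult[symmetric]) measurable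
    \<comment> \<open>Pointwise in \<open>a\<close> and \<open>b\<close>, the constant is replaced
      by the (s, t)-volume that dominates it.\<close>
    also have "\<dots> \<le> (\<integral>\<^sup>+a. \<integral>\<^sup>+b. (\<integral>\<^sup>+s. \<integral>\<^sup>+t. ?V s t a b \<partial>lborel \<partial>lborel) * ?LL a b \<partial>lborel \<partial>lborel)"
      by (intro nn_integral_mono mult_right_mono overlap_volume[OF \<alpha> \<beta> equi]) auto
    also have "\<dots> = (\<integral>\<^sup>+a. \<integral>\<^sup>+b. \<integral>\<^sup>+s. \<integral>\<^sup>+t. ?V s t a b * ?LL a b \<partial>lborel \<partial>lborel \<partial>lborel \<partial>lborel)"
    proof (intro nn_integral_cong)
      fix a b
      have "(\<integral>\<^sup>+s. \<integral>\<^sup>+t. ?V s t a b \<partial>lborel \<partial>lborel) * ?LL a b = (\<integral>\<^sup>+s. (\<integral>\<^sup>+t. ?V s t a b \<partial>lborel) * ?LL a b \<partial>lborel)"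
        by (rule nn_integral_multc[symmetric]) measurable
      also have "\<dots> = (\<integral>\<^sup>+s. \<integral>\<^sup>+t. ?V s t a b * ?LL a b \<partial>lborel \<partial>lborel)"
        by (intro nn_integral_cong nn_integral_multc[symmetric]) measurable
      finally show "(\<integral>\<^sup>+s. \<integral>\<^sup>+t. ?V s t a b \<partial>lborel \<partial>lborel) * ?LL a b
          = (\<integral>\<^sup>+s. \<integral>\<^sup>+t. ?V s t a b * ?LL a b \<partial>lborel \<partial>lborel)" .
    qed
    also have "\<dots> = (\<integral>\<^sup>+s. \<integral>\<^sup>+t. \<integral>\<^sup>+a. \<integral>\<^sup>+b. ?V s t a b * ?LL a b \<partial>lborel \<partial>lborel \<partial>lborel \<partial>lborel)"
      by (rule nn_integral_swap_pairs[symmetric]) measurable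
    also have "\<dots> = (\<integral>\<^sup>+s. \<integral>\<^sup>+t. ?T (forcing L t - s) t * near_ind \<sigma> (t - (forcing L s - y)) * steep L \<sigma> t * indicator {0..<1} t
          * indicator {\<alpha>..\<beta>} s \<partial>lborel \<partial>lborel)"
    proof (intro nn_integral_cong)
      fix s t
      let ?K = "near_ind \<sigma> (t - (forcing L s - y)) * steep L \<sigma> t * indicator {0..<1} t * indicator {\<alpha>..\<beta>} s"
      let ?X = "\<lambda>a b. last_integral L \<phi> (\<sigma> / 2) a b (forcing_deriv L a) * near_ind (\<sigma> / 2) (b - (forcing L a - t)) * indicator {0..<0 + 1} b"
      let ?Y = "\<lambda>a. near_ind (3 * \<sigma> / 4) (a - (forcing L t - s)) * indicator {- 1 / 16..1 / 16} a"
      have "(\<integral>\<^sup>+a. \<integral>\<^sup>+b. ?V s t a b * ?LL a b \<partial>lborel \<partial>lborel) = (\<integral>\<^sup>+a. \<integral>\<^sup>+b. ?X a b * (?Y a * ?K) \<partial>lborel \<partial>lborel)"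
        by (intro nn_integral_cong) (simp add: mult_ac)
      also have "\<dots> = (\<integral>\<^sup>+a. (\<integral>\<^sup>+b. ?X a b \<partial>lborel) * (?Y a * ?K) \<partial>lborel)"
        by (intro nn_integral_cong nn_integral_multc) measurable
      also have "\<dots> = (\<integral>\<^sup>+a. ((\<integral>\<^sup>+b. ?X a b \<partial>lborel) * near_ind (3 * \<sigma> / 4) (a - (forcing L t - s)) * indicator {- 1 / 16..1 / 16} a) * ?K \<partial>lborel)"
        by (simp only: mult.assoc)
      also have "\<dots> = ?T (forcing L t - s) t * ?K"
        unfolding target_integral_def by (rule nn_integral_multc) measurable
      finally show "(\<integral>\<^sup>+a. \<integral>\<^sup>+b. ?V s t a b * ?LL a b \<partial>lborel \<partial>lborel)
          = ?T (forcing L t - s) t * near_ind \<sigma> (t - (forcing L s - y)) * steep L \<sigma> t * indicator {0..<1} t * indicator {\<alpha>..\<beta>} s"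
        by (simp only: mult.assoc)
    qed
    finally show "ennreal (\<sigma>\<^sup>2 / 216 * (\<sigma>\<^sup>2 / 432)) * bulk_integral L \<phi> \<sigma> \<le> \<dots>" .
  qed simp
  \<comment> \<open>Only constants and the indicator of \<open>s\<close> are moved through the
    integrals here.\<close>
  also have "\<dots> = c\<^sub>0 * (\<integral>\<^sup>+s. c\<^sub>0 * (\<integral>\<^sup>+t. C * ?T (forcing L t - s) t * near_ind \<sigma> (t - (forcing L s - y)) * steep L \<sigma> t
      * indicator {0..<0 + 1} t \<partial>lborel) * indicator {\<alpha>..\<beta>} s \<partial>lborel)"
  proof -
    let ?Z = "\<lambda>s t. ?T (forcing L t - s) t * near_ind \<sigma> (t - (forcing L s - y)) * steep L \<sigma> t * indicator {0..<1} t"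
    have "c\<^sub>0 * (\<integral>\<^sup>+t. C * ?T (forcing L t - s) t * near_ind \<sigma> (t - (forcing L s - y)) * steep L \<sigma> t
        * indicator {0..<0 + 1} t \<partial>lborel) * indicator {\<alpha>..\<beta>} s
        = (c\<^sub>0 * C) * (\<integral>\<^sup>+t. ?Z s t * indicator {\<alpha>..\<beta>} s \<partial>lborel)" for s
    proof -
      have "(\<integral>\<^sup>+t. C * ?T (forcing L t - s) t * near_ind \<sigma> (t - (forcing L s - y)) * steep L \<sigma> t * indicator {0..<0 + 1} t \<partial>lborel)
          = (\<integral>\<^sup>+t. C * ?Z s t \<partial>lborel)"
        by (simp add: mult.assoc)
      also have "\<dots> = C * (\<integral>\<^sup>+t. ?Z s t \<partial>lborel)"
        by (rule nn_integral_cmult) measurable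
      finally have 1: "(\<integral>\<^sup>+t. C * ?T (forcing L t - s) t * near_ind \<sigma> (t - (forcing L s - y)) * steep L \<sigma> t * indicator {0..<0 + 1} t \<partial>lborel)
          = C * (\<integral>\<^sup>+t. ?Z s t \<partial>lborel)" .
      have 2: "(\<integral>\<^sup>+t. ?Z s t * indicator {\<alpha>..\<beta>} s \<partial>lborel) = (\<integral>\<^sup>+t. ?Z s t \<partial>lborel) * indicator {\<alpha>..\<beta>} s"
        by (rule nn_integral_multc) measurable
      show ?thesis unfolding 1 2 by (simp only: mult.assoc)
    qed
    then have "(\<integral>\<^sup>+s. c\<^sub>0 * (\<integral>\<^sup>+t. C * ?T (forcing L t - s) t * near_ind \<sigma> (t - (forcing L s - y)) * steep L \<sigma> t
        * indicator {0..<0 + 1} t \<partial>lborel) * indicator {\<alpha>..\<beta>} s \<partial>lborel)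
        = (\<integral>\<^sup>+s. (c\<^sub>0 * C) * (\<integral>\<^sup>+t. ?Z s t * indicator {\<alpha>..\<beta>} s \<partial>lborel) \<partial>lborel)"
      by (simp only:)
    also have "\<dots> = (c\<^sub>0 * C) * (\<integral>\<^sup>+s. \<integral>\<^sup>+t. ?Z s t * indicator {\<alpha>..\<beta>} s \<partial>lborel \<partial>lborel)"
      by (rule nn_integral_cmult) measurable
    finally show ?thesis by (simp only: mult.assoc)
  qed
  also have "\<dots> \<le> c\<^sub>0 * (\<integral>\<^sup>+s. nkoop ?N3 (bundle_point (forcing L s - y) s (forcing_deriv L s * fst v - snd v, fst v))
      * indicator {x - \<sigma>..x + \<sigma>} s \<partial>lborel)"
  proof (intro mult_left_mono nn_integral_mono)
    fix s
    show "c\<^sub>0 * (\<integral>\<^sup>+t. C * ?T (forcing L t - s) t * near_ind \<sigma> (t - (forcing L s - y)) * steep L \<sigma> t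
        * indicator {0..<0 + 1} t \<partial>lborel) * indicator {\<alpha>..\<beta>} s
      \<le> nkoop ?N3 (bundle_point (forcing L s - y) s (forcing_deriv L s * fst v - snd v, fst v)) * indicator {x - \<sigma>..x + \<sigma>} s"
    proof (cases "s \<in> {\<alpha>..\<beta>}")
      case True
      then have "s \<in> {x - \<sigma>..x + \<sigma>}" using \<alpha> \<beta> \<sigma>_pos by auto
      then show ?thesis using two[OF True] True by simp
    qed simp
  qed simp
  also have "\<dots> = nkoop (nkoop ?N3) (bundle_point x y v)"
    by (rule nkoop_bundle_point[symmetric, OF _ \<sigma>_eq v nkoop_meas[OF N3]]) (use L_ge in simp)
  finally show ?thesis unfolding C_def .
qed

end

section \<open>Conclusion\<close>

text \<open>The constant is \<open>(1/2)^5 * 1/2 * (1/216 * 1/432) * 1/8\<close>, the factors of \<open>minorant\<close> without \<open>\<sigma>\<close>;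
  the powers of \<open>\<sigma>\<close> cancel, which makes the minorization uniform in \<open>L\<close> and \<open>\<delta>\<close>.\<close>

definition overlap_const :: real where
  "overlap_const = 1 / 47775744"

definition minorant :: "real \<Rightarrow> real \<Rightarrow> (point \<times> direction \<Rightarrow> ennreal) \<Rightarrow> ennreal" where
  "minorant L \<sigma> \<phi> = ennreal (1 / (2 * \<sigma>)) * ennreal (1 / (2 * \<sigma>)) *
     (ennreal (1 / (2 * \<sigma>)) * ennreal (1 / (2 * \<sigma>)) * ennreal (1 / (2 * \<sigma>)) * ennreal (1 / 2)) *
     (ennreal (\<sigma>\<^sup>2 / 216 * (\<sigma>\<^sup>2 / 432)) * bulk_integral L \<phi> \<sigma>)"

lemma last_integral_add:
  assumes [measurable]: "\<phi> \<in> borel_measurable proj_bundle" "\<psi> \<in> borel_measurable proj_bundle"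
  shows "last_integral L (\<lambda>u. \<phi> u + \<psi> u) h a b \<rho> = last_integral L \<phi> h a b \<rho> + last_integral L \<psi> h a b \<rho>"
proof -
  have "final_value L (\<lambda>u. \<phi> u + \<psi> u) b c \<rho> = final_value L \<phi> b c \<rho> + final_value L \<psi> b c \<rho>" for c
    by (simp add: final_value_def)
  then show ?thesis
    unfolding last_integral_def
    by (subst nn_integral_add[symmetric], measurable) (simp only: distrib_right)
qed

lemma bulk_integral_add:
  assumes [measurable]: "\<phi> \<in> borel_measurable proj_bundle" "\<psi> \<in> borel_measurable proj_bundle"
  shows "bulk_integral L (\<lambda>u. \<phi> u + \<psi> u) \<sigma> = bulk_integral L \<phi> \<sigma> + bulk_integral L \<psi> \<sigma>"
proof -
  let ?I = "\<lambda>\<phi> a. \<integral>\<^sup>+b. last_integral L \<phi> (\<sigma> / 2) a b (forcing_deriv L a) * indicator {0..<0 + 1} b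
      * indicator {- 1 / 16..1 / 16} a \<partial>lborel"
  have "?I (\<lambda>u. \<phi> u + \<psi> u) a = ?I \<phi> a + ?I \<psi> a" for a
    unfolding last_integral_add[OF assms]
    by (subst nn_integral_add[symmetric], measurable) (simp only: distrib_right)
  then have "bulk_integral L (\<lambda>u. \<phi> u + \<psi> u) \<sigma> = (\<integral>\<^sup>+a. ?I \<phi> a + ?I \<psi> a \<partial>lborel)"
    unfolding bulk_integral_def by (simp only:)
  also have "\<dots> = bulk_integral L \<phi> \<sigma> + bulk_integral L \<psi> \<sigma>"
    unfolding bulk_integral_def by (rule nn_integral_add) measurable
  finally show ?thesis .
qed

text \<open>The arc of the last angle contributes \<sigma>, the angle \<open>b\<close> contributes 1
  and \<open>a\<close> contributes 1/8.\<close>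

lemma bulk_integral_one:
  assumes "0 < \<sigma>" "\<sigma> < 1"
  shows "bulk_integral L (\<lambda>_. 1) \<sigma> = ennreal (\<sigma> / 8)"
proof -
  have "last_integral L (\<lambda>_. 1) (\<sigma> / 2) a b \<rho> = ennreal \<sigma>" for a b \<rho>
    using nn_integral_near[of "\<sigma> / 2" "forcing L b - a"] assms
    by (simp add: last_integral_def final_value_def near_ind_def indicator_def)
  then have "bulk_integral L (\<lambda>_. 1) \<sigma>
      = (\<integral>\<^sup>+a. \<integral>\<^sup>+b. (ennreal \<sigma> * indicator {- 1 / 16..1 / 16 :: real} a) * indicator {0..<1} (b :: real) \<partial>lborel \<partial>lborel)"
    unfolding bulk_integral_def by (simp add: mult_ac)
  also have "\<dots> = (\<integral>\<^sup>+a. ennreal \<sigma> * indicator {- 1 / 16..1 / 16::real} a \<partial>lborel)"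
    by (subst nn_integral_cmult) simp_all
  also have "\<dots> = ennreal \<sigma> * ennreal (1 / 8)"
    by (subst nn_integral_cmult) simp_all
  finally show ?thesis
    using assms by (simp add: ennreal_mult[symmetric])
qed

lemma minorant_one:
  assumes "0 < \<sigma>" "\<sigma> < 1"
  shows "minorant L \<sigma> (\<lambda>_. 1) = ennreal overlap_const"
proof -
  define c d e h where "c = 1 / (2 * \<sigma>)" and "d = \<sigma>\<^sup>2 / 216 * (\<sigma>\<^sup>2 / 432)"
    and "e = \<sigma> / 8" and "h = (1 / 2 :: real)"
  have nonneg: "0 \<le> c" "0 \<le> d" "0 \<le> e" "0 \<le> h" using assms by (simp_all add: c_def d_def e_def h_def)
  have "minorant L \<sigma> (\<lambda>_. 1) = ennreal c * ennreal c * (ennreal c * ennreal c * ennreal c * ennreal h) * (ennreal d * ennreal e)"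
    unfolding minorant_def bulk_integral_one[OF assms] c_def d_def e_def h_def ..
  also have "\<dots> = ennreal (c * c * (c * c * c * h) * (d * e))"
    by (simp only: ennreal_mult mult_nonneg_nonneg nonneg)
  also have "c * c * (c * c * c * h) * (d * e) = overlap_const"
    using assms by (simp add: c_def d_def e_def h_def overlap_const_def field_simps power2_eq_square)
  finally show ?thesis .
qed

lemma doeblin_proj:
  assumes \<sigma>: "\<sigma> = noise_size L \<delta>" "\<sigma> \<le> 1 / 8" and L: "1 \<le> L" "100 \<le> L * \<sigma>\<^sup>2"
  shows "doeblin (noise_law L \<delta>) proj_bundle (proj_step L) 5 (minorant L \<sigma>) overlap_const"
proof (intro doeblin.intro doeblin_axioms.intro)
  show "random_map (noise_law L \<delta>) proj_bundle (proj_step L)"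
    using L by (intro random_map_proj) simp
  have "0 < \<sigma>" using L by (simp add: \<sigma> noise_size_def)
  show "0 < overlap_const" "overlap_const < 1" by (simp_all add: overlap_const_def)
  have "((0, 0), dir (1, 0)) \<in> space proj_bundle"
    by (simp add: space_proj_bundle torus_def)
  then show "space proj_bundle \<noteq> {}" by blast
  show "minorant L \<sigma> (\<lambda>_. 1) = ennreal overlap_const"
    using \<open>0 < \<sigma>\<close> \<sigma>(2) by (intro minorant_one) auto
  show "minorant L \<sigma> (\<lambda>u. \<phi> u + \<psi> u) = minorant L \<sigma> \<phi> + minorant L \<sigma> \<psi>"
    if "\<phi> \<in> borel_measurable proj_bundle" "\<psi> \<in> borel_measurable proj_bundle" for \<phi> \<psi>
    unfolding minorant_def bulk_integral_add[OF that] by (simp only: distrib_left)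
  fix \<phi> :: "point \<times> direction \<Rightarrow> ennreal" and u
  assume \<phi>: "\<phi> \<in> borel_measurable proj_bundle" and u: "u \<in> space proj_bundle"
  let ?K = "random_map.nkoop (noise_law L \<delta>) (proj_step L)"
  have "minorant L \<sigma> \<phi> \<le> ?K (?K (?K (?K (?K \<phi>)))) u"
    using nkoop5_ge[OF \<sigma> L \<phi> proj_bundle_eq(2)[OF u], of "fst (fst u)" "snd (fst u)"]
    unfolding minorant_def proj_bundle_eq(1)[OF u, symmetric] .
  then show "minorant L \<sigma> \<phi> \<le> (?K ^^ 5) \<phi> u"
    by (simp add: numeral_eq_Suc)
qed simp

section \<open>Choice of parameters, uniformly in the noise and in the forcing\<close>

lemma abs_le_sup_norm:
  assumes "bounded (H ` space M)" "u \<in> space M"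
  shows "\<bar>H u\<bar> \<le> sup_norm M H"
proof -
  obtain B where "\<And>v. v \<in> space M \<Longrightarrow> \<bar>H v\<bar> \<le> B"
    using assms(1) by (auto simp: bounded_iff)
  then have "bdd_above ((\<lambda>v. \<bar>H v\<bar>) ` space M)"
    by (intro bdd_aboveI2)
  then show ?thesis
    unfolding sup_norm_def using assms(2) by (rule cSUP_upper[rotated])
qed

text \<open>The first bound amounts to L^\<delta> \<ge> 8. For the second, L \<sigma>^2 = L^(1 - 2
  \<delta>) \<ge> L^(1/2) \<ge> 100 because \<delta> < 1/4.\<close>

lemma noise_size_conditions:
  assumes \<delta>: "0 < \<delta>" "\<delta> < 1 / 4" and L: "10000 \<le> L" "8 powr (1 / \<delta>) \<le> L"
  shows "noise_size L \<delta> \<le> 1 / 8" "100 \<le> L * (noise_size L \<delta>)\<^sup>2"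
proof -
  have Lpos: "0 < L" using L(1) by linarith
  have "8 = (8 powr (1 / \<delta>)) powr \<delta>" using \<delta> by (simp add: powr_powr)
  also have "\<dots> \<le> L powr \<delta>" using L \<delta> by (intro powr_mono2) auto
  finally show "noise_size L \<delta> \<le> 1 / 8"
    using Lpos by (simp add: noise_size_def powr_minus field_simps)
  have "100 = sqrt (10000)" using real_sqrt_unique[of 100 10000] by simp
  also have "\<dots> \<le> sqrt L" using L(1) by (rule real_sqrt_le_mono)
  also have "\<dots> = L powr (1 / 2)" using Lpos by (simp add: powr_half_sqrt)
  also have "\<dots> \<le> L powr (1 + (- \<delta> + - \<delta>))" using \<delta> L by (intro powr_mono) auto
  also have "\<dots> = L * (noise_size L \<delta>)\<^sup>2"
    using Lpos by (simp only: powr_add noise_size_def power2_eq_square powr_one)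
  finally show "100 \<le> L * (noise_size L \<delta>)\<^sup>2" .
qed

lemma ex_power_le:
  fixes C \<gamma> \<epsilon> :: real
  assumes "0 \<le> C" "0 \<le> \<gamma>" "\<gamma> < 1" "0 < \<epsilon>"
  obtains N :: nat where "1 \<le> N" "C * \<gamma> ^ N \<le> \<epsilon>"
proof -
  have "(\<lambda>n. C * \<gamma> ^ n) \<longlonglongrightarrow> C * 0"
    using assms by (intro tendsto_intros LIMSEQ_power_zero) auto
  then have "\<forall>\<^sub>F n in sequentially. C * \<gamma> ^ n < \<epsilon>"
    using assms(4) by (intro order_tendstoD(2)) auto
  then obtain m where "\<And>n. m \<le> n \<Longrightarrow> C * \<gamma> ^ n < \<epsilon>"
    by (auto simp: eventually_sequentially)
  then show thesis by (intro that[of "max 1 m"]) (auto intro: less_imp_le)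
qed

text \<open>One \<kappa> has to serve both processes, so that a single \<open>c\<close> works in the
  conclusion.\<close>

lemma ex_rate:
  fixes K K' :: real and N N' :: nat
  assumes "1 \<le> N" "1 \<le> K" "1 \<le> N'" "1 \<le> K'"
  obtains \<kappa> :: real where "0 < \<kappa>"
    "\<kappa> * (real N * (2 * K + 1)) \<le> 1 / 16" "\<kappa> * (2 * (1 + 16 * K) * (real N)\<^sup>2) \<le> 1"
    "\<kappa> * (real N' * (2 * K' + 1)) \<le> 1 / 16" "\<kappa> * (2 * (1 + 16 * K') * (real N')\<^sup>2) \<le> 1"
proof -
  define p q p' q' where "p = real N * (2 * K + 1)" and "q = 2 * (1 + 16 * K) * (real N)\<^sup>2"
    and "p' = real N' * (2 * K' + 1)" and "q' = 2 * (1 + 16 * K') * (real N')\<^sup>2"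
  have pos: "0 < p" "0 < q" "0 < p'" "0 < q'"
    using assms by (simp_all add: p_def q_def p'_def q'_def)
  define s where "s = 16 * (p + q + p' + q')"
  have s: "0 < s" using pos by (simp add: s_def)
  show thesis
  proof (rule that[of "1 / s"], unfold p_def[symmetric] q_def[symmetric] p'_def[symmetric] q'_def[symmetric])
    show "0 < 1 / s" using s by simp
    show "1 / s * p \<le> 1 / 16" "1 / s * q \<le> 1" "1 / s * p' \<le> 1 / 16" "1 / s * q' \<le> 1"
      using s pos by (simp_all add: divide_le_eq) (simp_all add: s_def)
  qed
qed

theorem theorem2p5:
  fixes \<epsilon>\<^sub>0 :: real and t :: nat
  assumes "\<epsilon>\<^sub>0 > 0" and "t \<ge> 1" and "two_point_mixing \<epsilon>\<^sub>0 t"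
  shows "\<exists>C > 0. \<exists>c > 0. \<exists>\<delta>\<^sub>0 > 0. \<forall>\<delta>. 0 < \<delta> \<and> \<delta> < \<delta>\<^sub>0 \<longrightarrow>
    (\<exists>L\<^sub>0 > 0. \<forall>L \<ge> L\<^sub>0.
      (\<exists>!\<nu>. proj_stationary L \<delta> \<nu>) \<and>
      (\<forall>\<nu>. proj_stationary L \<delta> \<nu> \<longrightarrow>
        (\<forall>H \<in> borel_measurable proj_bundle. bounded (H ` space proj_bundle) \<longrightarrow>
          (\<forall>u \<in> space proj_bundle. \<forall>n::nat \<ge> 1. \<forall>\<epsilon> > 0.
            measure (noise L \<delta>)
              {\<omega> \<in> space (noise L \<delta>).
                \<bar>(\<Sum>j = 1..n. H (proj_process L u j \<omega>)) / real n - (\<integral>v. H v \<partial>\<nu>)\<bar> \<ge> \<epsilon>}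
            \<le> C * exp (- c * real n * (\<epsilon>\<^sup>2 / (sup_norm proj_bundle H)\<^sup>2))))) \<and>
      (\<forall>H \<in> borel_measurable pair_measure_offdiag. bounded (H ` space pair_measure_offdiag) \<longrightarrow>
        (\<forall>p \<in> space pair_measure_offdiag. \<forall>n::nat \<ge> 1. \<forall>\<epsilon> > 0.
          measure (noise L \<delta>)
            {\<omega> \<in> space (noise L \<delta>).
              \<bar>(\<Sum>j = 1..n. H (pair_process L p j \<omega>)) / real n
                - (\<integral>q. H q \<partial>pair_measure_offdiag)\<bar> \<ge> \<epsilon>}
          \<le> C * (1 + weight \<epsilon>\<^sub>0 t L p) * exp (- c * real n * (\<epsilon>\<^sup>2 / (sup_norm pair_measure_offdiag H)\<^sup>2)))))"
proof -
  obtain C' \<gamma> L\<^sub>0' \<delta>\<^sub>0' where C': "C' > 0" and \<gamma>: "0 < \<gamma>" "\<gamma> < 1" and \<delta>\<^sub>0': "0 < \<delta>\<^sub>0'"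
    and all: "\<forall>\<delta>. 0 < \<delta> \<and> \<delta> < \<delta>\<^sub>0' \<longrightarrow> (\<forall>L > L\<^sub>0'. \<forall>n \<ge> 1. \<forall>\<phi> \<in> borel_measurable pair_measure_offdiag.
        weight_norm \<epsilon>\<^sub>0 t L \<phi> < \<infinity> \<longrightarrow>
        weight_norm \<epsilon>\<^sub>0 t L (\<lambda>p. (koopman2 L \<delta> ^^ n) \<phi> p - (\<integral>q. \<phi> q \<partial>pair_measure_offdiag))
          \<le> ennreal (C' * \<gamma> ^ n) * weight_norm \<epsilon>\<^sub>0 t L \<phi>)"
    using assms(3) unfolding two_point_mixing_def by (elim exE conjE) (rule that)
  note mix = all[rule_format, OF conjI]
  \<comment> \<open>The block lengths \<open>N\<close> and \<open>5 * j\<close> and the rate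
    \<kappa> depend only on C', \<gamma> and \<open>overlap_const\<close>, hence are fixed before
    \<delta> and \<open>L\<close>.\<close>
  obtain N where N: "1 \<le> N" "C' * \<gamma> ^ N \<le> 1 / 8"
    by (rule ex_power_le[of C' \<gamma> "1 / 8"]) (use C' \<gamma> in auto)
  obtain j where j: "1 \<le> j" "1 * (1 - overlap_const) ^ j \<le> 1 / 16"
    by (rule ex_power_le[of 1 "1 - overlap_const" "1 / 16"]) (auto simp: overlap_const_def)
  obtain \<kappa> :: real where \<kappa>: "0 < \<kappa>"
    and \<kappa>1: "\<kappa> * (real (5 * j) * (2 * 1 + 1)) \<le> 1 / 16" "\<kappa> * (2 * (1 + 16 * 1) * (real (5 * j))\<^sup>2) \<le> 1"
    and \<kappa>2: "\<kappa> * (real N * (2 * (2 + 2 * C') + 1)) \<le> 1 / 16" "\<kappa> * (2 * (1 + 16 * (2 + 2 * C')) * (real N)\<^sup>2) \<le> 1"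
    by (rule ex_rate[of "5 * j" 1 N "2 + 2 * C'"]) (use j N C' in auto)
  show ?thesis
  proof (rule exI[of _ "12 :: real"], rule conjI, simp, rule exI[of _ "\<kappa> / 8"], rule conjI, simp add: \<kappa>,
      rule exI[of _ "min \<delta>\<^sub>0' (1 / 4)"], rule conjI, simp add: \<delta>\<^sub>0', intro allI impI, goal_cases)
    case (1 \<delta>)
    then have \<delta>: "0 < \<delta>" "\<delta> < \<delta>\<^sub>0'" "\<delta> < 1 / 4" by auto
    \<comment> \<open>The summand 1 turns \<open>L\<^sub>0 \<le> L\<close> into the strict
      inequality \<open>L\<^sub>0' < L\<close> that the mixing hypothesis asks for.\<close>
    define L\<^sub>0 where "L\<^sub>0 = max (10000) (max (8 powr (1 / \<delta>)) (L\<^sub>0' + 1))"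
    show ?case
    proof (rule exI[of _ L\<^sub>0], intro conjI allI impI ballI)
      show "0 < L\<^sub>0" by (simp add: L\<^sub>0_def)
      fix L assume "L\<^sub>0 \<le> L"
      then have L: "10000 \<le> L" "8 powr (1 / \<delta>) \<le> L" "L\<^sub>0' < L" by (auto simp: L\<^sub>0_def)
      have L1: "1 \<le> L" "0 < L" "2 < L" using L(1) by auto
      interpret doeblin "noise_law L \<delta>" proj_bundle "proj_step L" 5 "minorant L (noise_size L \<delta>)" overlap_const
        by (rule doeblin_proj[OF refl]) (use noise_size_conditions[OF \<delta>(1,3) L(1,2)] L1 in auto)
      note stat = proj_stationary_iff[OF L1(2)]
      show "\<exists>!\<nu>. proj_stationary L \<delta> \<nu>"
        unfolding stat by (rule ex1_stationary)
      show "measure (noise L \<delta>)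
          {\<omega> \<in> space (noise L \<delta>).
            \<bar>(\<Sum>j = 1..n. H (proj_process L u j \<omega>)) / real n - (\<integral>v. H v \<partial>\<nu>)\<bar> \<ge> \<epsilon>}
        \<le> 12 * exp (- (\<kappa> / 8) * real n * (\<epsilon>\<^sup>2 / (sup_norm proj_bundle H)\<^sup>2))"
        if \<nu>: "proj_stationary L \<delta> \<nu>" and H: "H \<in> borel_measurable proj_bundle" "bounded (H ` space proj_bundle)"
          and u: "u \<in> space proj_bundle" and n: "1 \<le> n" and \<epsilon>: "0 < \<epsilon>" for \<nu> H u n \<epsilon>
      proof -
        interpret W: weighted_mixing "noise_law L \<delta>" proj_bundle "proj_step L" \<nu> "\<lambda>_. 1" "5 * j" 1
          using weighted_mixing_doeblin[of \<nu> j] \<nu> j by (simp add: stat)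
        show ?thesis
          using W.concentration[OF H(1) abs_le_sup_norm[OF H(2)] u n \<epsilon> \<kappa> \<kappa>1]
          by (simp add: noise_eq proj_process_eq_orbit)
      qed
      show "measure (noise L \<delta>)
        {\<omega> \<in> space (noise L \<delta>).
          \<bar>(\<Sum>j = 1..n. H (pair_process L p j \<omega>)) / real n
            - (\<integral>q. H q \<partial>pair_measure_offdiag)\<bar> \<ge> \<epsilon>}
      \<le> 12 * (1 + weight \<epsilon>\<^sub>0 t L p) * exp (- (\<kappa> / 8) * real n * (\<epsilon>\<^sup>2 / (sup_norm pair_measure_offdiag H)\<^sup>2))"
        if H: "H \<in> borel_measurable pair_measure_offdiag" "bounded (H ` space pair_measure_offdiag)"
          and p: "p \<in> space pair_measure_offdiag" and n: "1 \<le> n" and \<epsilon>: "0 < \<epsilon>" for H p n \<epsilon>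
      proof -
        interpret W: weighted_mixing "noise_law L \<delta>" pair_measure_offdiag "pair_step L" pair_measure_offdiag
          "\<lambda>p. 1 + weight \<epsilon>\<^sub>0 t L p" N "2 + 2 * C'"
          by (rule weighted_mixing_pair[OF L1(3) assms(2) C' \<gamma> mix[OF \<delta>(1,2) L(3)] N])
        show ?thesis
          using W.concentration[OF H(1) abs_le_sup_norm[OF H(2)] p n \<epsilon> \<kappa> \<kappa>2]
          by (simp add: noise_eq pair_process_eq_orbit)
      qed
    qed
  qed
qed

end
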